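(* Suppose that $(M,\lambda,\alpha)$ is an exact lcs manifold satisfying the Reeb condition $\lambda(X_\alpha)>0$. If $(M,\lambda,\alpha)$ has an immersed Reeb 2-curve, then it also has a Reeb 1-curve. Furthermore, if it has an immersed elliptic Reeb 2-curve, then this Reeb 2-curve is normal.
   Context: An exact lcs manifold is $(M,\lambda,\alpha)$ with $\lambda,\alpha$ 1-forms on $M$, $\alpha$ closed and $\omega=d_\alpha\lambda:=d\lambda-\alpha\wedge\lambda$ non-degenerate. Vector fields $X_\lambda,X_\alpha$ are given by $\omega(X_\lambda,\cdot)=\lambda$, $\omega(X_\alpha,\cdot)=\alpha$, and $\mathcal{D}(p)=\operatorname{span}(X_\alpha(p),X_\lambda(p))$. The Reeb condition is that $\lambda(X_\alpha)>0$ everywhere. A nodal Riemann surface is $\Sigma=(\widetilde\Sigma,\mathcal{N})$ with $\widetilde\Sigma$ a Riemann surface and $\mathcal{N}$ a finite (possibly empty) set of pairs of points, points of distinct pairs being distinct; $\Sigma$ also denotes the quotient of $\widetilde\Sigma$ identifying the points of each pair. For $u:\Sigma\to M$ the normalization $\widetilde u:\widetilde\Sigma\to M$ is the composition with the quotient map; $u$ is smooth (an immersion) if $\widetilde u$ is, and normal if $\mathcal{N}=\emptyset$. A Reeb 2-curve in $(M,\lambda,\alpha)$ is a smooth map $u:\Sigma\to M$ from a closed nodal Riemann surface such that: (i) for each $z\in\widetilde\Sigma$, $\widetilde u_*(T_z\widetilde\Sigma)=\mathcal{D}(\widetilde u(z))$ whenever $d\widetilde u(z)\neq 0$ and $\dim\mathcal{D}(\widetilde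 u(z))=2$; (ii) $0\neq[u^*\alpha]\in H^1(\Sigma,\mathbb{R})$. It is elliptic if $\Sigma$ is a nodal, topological genus 1, closed, connected Riemann surface. A Reeb 1-curve in $(M,\lambda,\alpha)$ is a smooth map $o:S^1\to M$ such that for all $t\in S^1$: $\lambda(o'(t))>0$ and $o'(t)\in\mathcal{D}$. *)

theory Defs
  imports "HOL-Analysis.Analysis" "HOL-Homology.Homology"
begin

section \<open>Smooth manifolds, tangent vectors, smooth maps\<close>

text \<open>\<open>smooth_on\<close> is only meant for open sets.\<close>

primrec Ck_on :: "nat \<Rightarrow> 'a::euclidean_space set \<Rightarrow> ('a \<Rightarrow> 'b::real_normed_vector) \<Rightarrow> bool" where
  "Ck_on 0 S f \<longleftrightarrow> continuous_on S f"
| "Ck_on (Suc k) S f \<longleftrightarrow>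
     (\<forall>x\<in>S. f differentiable (at x)) \<and> (\<forall>v. Ck_on k S (\<lambda>x. frechet_derivative f (at x) v))"

definition smooth_on :: "'a::euclidean_space set \<Rightarrow> ('a \<Rightarrow> 'b::real_normed_vector) \<Rightarrow> bool" where
  "smooth_on S f \<longleftrightarrow> (\<forall>k. Ck_on k S f)"

text \<open>A chart is a pair of its domain and its coordinate map.\<close>

type_synonym ('p, 'e) chart = "'p set \<times> ('p \<Rightarrow> 'e)"

record ('p, 'e) charted_space =
  mtop :: "'p topology"
  atlas :: "('p, 'e) chart set"

abbreviation points :: "('p, 'e, 'z) charted_space_scheme \<Rightarrow> 'p set" where
  "points M \<equiv> topspace (mtop M)"

definition chart_inv :: "('p, 'e) chart \<Rightarrow> 'e \<Rightarrow> 'p" where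
  "chart_inv c = inv_into (fst c) (snd c)"

definition charts_at :: "('p, 'e, 'z) charted_space_scheme \<Rightarrow> 'p \<Rightarrow> ('p, 'e) chart set" where
  "charts_at M p = {c \<in> atlas M. p \<in> fst c}"

definition chart_at :: "('p, 'e, 'z) charted_space_scheme \<Rightarrow> 'p \<Rightarrow> ('p, 'e) chart" where
  "chart_at M p = (SOME c. c \<in> charts_at M p)"

definition topological_manifold :: "('p, 'e::euclidean_space, 'z) charted_space_scheme \<Rightarrow> bool" where
  "topological_manifold M \<longleftrightarrow>
     Hausdorff_space (mtop M) \<and> second_countable (mtop M) \<and>
     (\<Union>c\<in>atlas M. fst c) = points M \<and>
     (\<forall>c\<in>atlas M. openin (mtop M) (fst c) \<and> open (snd c ` fst c) \<and>
        homeomorphic_map (subtopology (mtop M) (fst c)) (top_of_set (snd c ` fst c)) (snd c))"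

definition smooth_manifold :: "('p, 'e::euclidean_space, 'z) charted_space_scheme \<Rightarrow> bool" where
  "smooth_manifold M \<longleftrightarrow> topological_manifold M \<and>
     (\<forall>c\<in>atlas M. \<forall>d\<in>atlas M. smooth_on (snd c ` (fst c \<inter> fst d)) (snd d \<circ> chart_inv c))"

definition riemann_surface :: "('p, complex, 'z) charted_space_scheme \<Rightarrow> bool" where
  "riemann_surface M \<longleftrightarrow> topological_manifold M \<and>
     (\<forall>c\<in>atlas M. \<forall>d\<in>atlas M. (snd d \<circ> chart_inv c) holomorphic_on (snd c ` (fst c \<inter> fst d)))"

definition euclid :: "('e::euclidean_space, 'e) charted_space" where
  "euclid = \<lparr> mtop = euclidean, atlas = {(UNIV, id)} \<rparr>"

text \<open>A tangent vector at \<open>p\<close> is the family of its coordinate vectors, one for each chart around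
  \<open>p\<close>, related by the derivatives of the coordinate changes (and \<open>0\<close> for all other arguments,
  so that equality of functions is equality of tangent vectors). The vector space operations are
  pointwise.\<close>

type_synonym ('p, 'e) tvec = "('p, 'e) chart \<Rightarrow> 'e"

definition tangent_space ::
    "('p, 'e::euclidean_space, 'z) charted_space_scheme \<Rightarrow> 'p \<Rightarrow> ('p, 'e) tvec set" where
  "tangent_space M p =
     {v. (\<forall>c\<in>charts_at M p. \<forall>d\<in>charts_at M p.
            v d = frechet_derivative (snd d \<circ> chart_inv c) (at (snd c p)) (v c)) \<and>
         (\<forall>c. c \<notin> charts_at M p \<longrightarrow> v c = 0)}"

text \<open>The tangent vector at \<open>p\<close> with coordinates \<open>w\<close> in the chart \<open>c\<close>.\<close>

definition coord_vec ::
    "('p, 'e::euclidean_space, 'z) charted_space_scheme \<Rightarrow> ('p, 'e) chart \<Rightarrow> 'p \<Rightarrow> 'e \<Rightarrow> ('p, 'e) tvec" where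
  "coord_vec M c p w =
     (\<lambda>d. if d \<in> charts_at M p then frechet_derivative (snd d \<circ> chart_inv c) (at (snd c p)) w else 0)"

definition smooth_map ::
    "('p, 'e::euclidean_space, 'y) charted_space_scheme \<Rightarrow>
     ('q, 'f::euclidean_space, 'z) charted_space_scheme \<Rightarrow> ('p \<Rightarrow> 'q) \<Rightarrow> bool" where
  "smooth_map M N f \<longleftrightarrow> continuous_map (mtop M) (mtop N) f \<and>
     (\<forall>c\<in>atlas M. \<forall>d\<in>atlas N.
        smooth_on (snd c ` {p \<in> fst c. f p \<in> fst d}) (snd d \<circ> f \<circ> chart_inv c))"

text \<open>The differential of \<open>f\<close> at \<open>p\<close>; it does not depend on the chosen chart around \<open>p\<close>.\<close>

definition tangent_map ::
    "('p, 'e::euclidean_space, 'y) charted_space_scheme \<Rightarrow>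
     ('q, 'f::euclidean_space, 'z) charted_space_scheme \<Rightarrow>
     ('p \<Rightarrow> 'q) \<Rightarrow> 'p \<Rightarrow> ('p, 'e) tvec \<Rightarrow> ('q, 'f) tvec" where
  "tangent_map M N f p v =
     (let c = chart_at M p in
      (\<lambda>d. if d \<in> charts_at N (f p)
           then frechet_derivative (snd d \<circ> f \<circ> chart_inv c) (at (snd c p)) (v c) else 0))"

definition immersion ::
    "('p, 'e::euclidean_space, 'y) charted_space_scheme \<Rightarrow>
     ('q, 'f::euclidean_space, 'z) charted_space_scheme \<Rightarrow> ('p \<Rightarrow> 'q) \<Rightarrow> bool" where
  "immersion M N f \<longleftrightarrow> smooth_map M N f \<and>
     (\<forall>p\<in>points M. inj_on (tangent_map M N f p) (tangent_space M p))"

definition velocity ::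
    "('p, 'e::euclidean_space, 'z) charted_space_scheme \<Rightarrow> (real \<Rightarrow> 'p) \<Rightarrow> real \<Rightarrow> ('p, 'e) tvec" where
  "velocity M \<gamma> t = tangent_map euclid M \<gamma> t (coord_vec euclid (UNIV, id) t 1)"


section \<open>Differential forms\<close>

text \<open>A 1-form assigns to each point a function on its tangent space; values outside the tangent
  spaces are irrelevant.\<close>

type_synonym ('p, 'e) form1 = "'p \<Rightarrow> ('p, 'e) tvec \<Rightarrow> real"

text \<open>The form in the coordinates \<open>x\<close> of the chart \<open>c\<close>.\<close>

definition local_form ::
    "('p, 'e::euclidean_space, 'z) charted_space_scheme \<Rightarrow> ('p, 'e) form1 \<Rightarrow>
     ('p, 'e) chart \<Rightarrow> 'e \<Rightarrow> 'e \<Rightarrow> real" where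
  "local_form M \<beta> c x w = \<beta> (chart_inv c x) (coord_vec M c (chart_inv c x) w)"

definition one_form :: "('p, 'e::euclidean_space, 'z) charted_space_scheme \<Rightarrow> ('p, 'e) form1 \<Rightarrow> bool" where
  "one_form M \<beta> \<longleftrightarrow>
     (\<forall>p\<in>points M. \<forall>v\<in>tangent_space M p. \<forall>w\<in>tangent_space M p. \<forall>a b.
        \<beta> p (\<lambda>c. a *\<^sub>R v c + b *\<^sub>R w c) = a * \<beta> p v + b * \<beta> p w) \<and>
     (\<forall>c\<in>atlas M. \<forall>w. smooth_on (snd c ` fst c) (\<lambda>x. local_form M \<beta> c x w))"

text \<open>In coordinates, \<open>d\<beta>(v, w) = D\<^sub>v (\<beta>(w)) - D\<^sub>w (\<beta>(v))\<close> for constant \<open>v\<close>, \<open>w\<close>; the value does not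
  depend on the chosen chart.\<close>

definition ext_deriv ::
    "('p, 'e::euclidean_space, 'z) charted_space_scheme \<Rightarrow> ('p, 'e) form1 \<Rightarrow>
     'p \<Rightarrow> ('p, 'e) tvec \<Rightarrow> ('p, 'e) tvec \<Rightarrow> real" where
  "ext_deriv M \<beta> p v w =
     (let c = chart_at M p in
        frechet_derivative (\<lambda>x. local_form M \<beta> c x (w c)) (at (snd c p)) (v c)
      - frechet_derivative (\<lambda>x. local_form M \<beta> c x (v c)) (at (snd c p)) (w c))"

definition closed_form :: "('p, 'e::euclidean_space, 'z) charted_space_scheme \<Rightarrow> ('p, 'e) form1 \<Rightarrow> bool" where
  "closed_form M \<beta> \<longleftrightarrow>
     (\<forall>p\<in>points M. \<forall>v\<in>tangent_space M p. \<forall>w\<in>tangent_space M p. ext_deriv M \<beta> p v w = 0)"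

definition pullback ::
    "('p, 'e::euclidean_space, 'y) charted_space_scheme \<Rightarrow>
     ('q, 'f::euclidean_space, 'z) charted_space_scheme \<Rightarrow> ('p \<Rightarrow> 'q) \<Rightarrow> ('q, 'f) form1 \<Rightarrow> ('p, 'e) form1" where
  "pullback M N f \<beta> = (\<lambda>p v. \<beta> (f p) (tangent_map M N f p v))"

definition dfun ::
    "('p, 'e::euclidean_space, 'z) charted_space_scheme \<Rightarrow> ('p \<Rightarrow> real) \<Rightarrow> ('p, 'e) form1" where
  "dfun M f = (\<lambda>p v. tangent_map M euclid f p v (UNIV, id))"


section \<open>Exact lcs manifolds\<close>

text \<open>\<open>\<omega> = d\<lambda> - \<alpha> \<and> \<lambda>\<close>, with \<open>(\<alpha> \<and> \<lambda>)(v, w) = \<alpha>(v) \<lambda>(w) - \<alpha>(w) \<lambda>(v)\<close>.\<close>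

definition lcs_form ::
    "('p, 'e::euclidean_space, 'z) charted_space_scheme \<Rightarrow> ('p, 'e) form1 \<Rightarrow> ('p, 'e) form1 \<Rightarrow>
     'p \<Rightarrow> ('p, 'e) tvec \<Rightarrow> ('p, 'e) tvec \<Rightarrow> real" where
  "lcs_form M lam \<alpha> p v w = ext_deriv M lam p v w - (\<alpha> p v * lam p w - \<alpha> p w * lam p v)"

definition exact_lcs ::
    "('p, 'e::euclidean_space, 'z) charted_space_scheme \<Rightarrow> ('p, 'e) form1 \<Rightarrow> ('p, 'e) form1 \<Rightarrow> bool" where
  "exact_lcs M lam \<alpha> \<longleftrightarrow>
     smooth_manifold M \<and> one_form M lam \<and> one_form M \<alpha> \<and> closed_form M \<alpha> \<and>
     (\<forall>p\<in>points M. \<forall>v\<in>tangent_space M p.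
        (\<forall>w\<in>tangent_space M p. lcs_form M lam \<alpha> p v w = 0) \<longrightarrow> v = (\<lambda>_. 0))"

text \<open>The \<open>\<omega>\<close>-dual vector field of a 1-form \<open>\<beta>\<close>, so that \<open>X\<^sub>\<lambda>\<close> and \<open>X\<^sub>\<alpha>\<close> are
  \<open>lcs_dual M lam \<alpha> lam\<close> and \<open>lcs_dual M lam \<alpha> \<alpha>\<close>.\<close>

definition lcs_dual ::
    "('p, 'e::euclidean_space, 'z) charted_space_scheme \<Rightarrow> ('p, 'e) form1 \<Rightarrow> ('p, 'e) form1 \<Rightarrow>
     ('p, 'e) form1 \<Rightarrow> 'p \<Rightarrow> ('p, 'e) tvec" where
  "lcs_dual M lam \<alpha> \<beta> p =
     (THE X. X \<in> tangent_space M p \<and> (\<forall>w\<in>tangent_space M p. lcs_form M lam \<alpha> p X w = \<beta> p w))"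

definition reeb_condition ::
    "('p, 'e::euclidean_space, 'z) charted_space_scheme \<Rightarrow> ('p, 'e) form1 \<Rightarrow> ('p, 'e) form1 \<Rightarrow> bool" where
  "reeb_condition M lam \<alpha> \<longleftrightarrow> (\<forall>p\<in>points M. lam p (lcs_dual M lam \<alpha> \<alpha> p) > 0)"

definition lcs_dist ::
    "('p, 'e::euclidean_space, 'z) charted_space_scheme \<Rightarrow> ('p, 'e) form1 \<Rightarrow> ('p, 'e) form1 \<Rightarrow>
     'p \<Rightarrow> ('p, 'e) tvec set" where
  "lcs_dist M lam \<alpha> p =
     {v. \<exists>a b. v = (\<lambda>c. a *\<^sub>R lcs_dual M lam \<alpha> \<alpha> p c + b *\<^sub>R lcs_dual M lam \<alpha> lam p c)}"

text \<open>The dimension of a set of tangent vectors at \<open>p\<close>, computed in coordinates.\<close>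

definition tangent_dim ::
    "('p, 'e::euclidean_space, 'z) charted_space_scheme \<Rightarrow> 'p \<Rightarrow> ('p, 'e) tvec set \<Rightarrow> nat" where
  "tangent_dim M p V = dim ((\<lambda>v. v (chart_at M p)) ` V)"


section \<open>Nodal Riemann surfaces\<close>

record 's nodal_surface = "('s, complex) charted_space" +
  nodes :: "'s set set"

definition nodal_riemann_surface :: "'s nodal_surface \<Rightarrow> bool" where
  "nodal_riemann_surface S \<longleftrightarrow> riemann_surface S \<and> finite (nodes S) \<and>
     (\<forall>e\<in>nodes S. e \<subseteq> points S \<and> card e = 2) \<and> disjoint (nodes S)"

definition normal_surface :: "'s nodal_surface \<Rightarrow> bool" where
  "normal_surface S \<longleftrightarrow> nodes S = {}"

text \<open>The points of the quotient are the classes of points of the normalization.\<close>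

definition node_proj :: "'s nodal_surface \<Rightarrow> 's \<Rightarrow> 's set" where
  "node_proj S x = insert x (\<Union>{e \<in> nodes S. x \<in> e})"

definition quotient_top :: "'s nodal_surface \<Rightarrow> 's set topology" where
  "quotient_top S = topology (\<lambda>W. W \<subseteq> node_proj S ` points S \<and>
     openin (mtop S) {x \<in> points S. node_proj S x \<in> W})"

lemma openin_quotient_top:
  "openin (quotient_top S) W \<longleftrightarrow>
     W \<subseteq> node_proj S ` points S \<and> openin (mtop S) {x \<in> points S. node_proj S x \<in> W}"
proof -
  have "istopology (\<lambda>W. W \<subseteq> node_proj S ` points S \<and>
     openin (mtop S) {x \<in> points S. node_proj S x \<in> W})"
  proof (unfold istopology_def, intro conjI allI impI)
    fix V W
    assume "V \<subseteq> node_proj S ` points S \<and> openin (mtop S) {x \<in> points S. node_proj S x \<in> V}"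
      "W \<subseteq> node_proj S ` points S \<and> openin (mtop S) {x \<in> points S. node_proj S x \<in> W}"
    moreover have "{x \<in> points S. node_proj S x \<in> V \<inter> W} =
      {x \<in> points S. node_proj S x \<in> V} \<inter> {x \<in> points S. node_proj S x \<in> W}" by auto
    ultimately show "V \<inter> W \<subseteq> node_proj S ` points S"
      "openin (mtop S) {x \<in> points S. node_proj S x \<in> V \<inter> W}" by auto
  next
    fix \<K>
    assume *: "\<forall>K\<in>\<K>. K \<subseteq> node_proj S ` points S \<and> openin (mtop S) {x \<in> points S. node_proj S x \<in> K}"
    show "\<Union>\<K> \<subseteq> node_proj S ` points S" using * by blast
    have "{x \<in> points S. node_proj S x \<in> \<Union>\<K>} = \<Union>((\<lambda>K. {x \<in> points S. node_proj S x \<in> K}) ` \<K>)"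
      by auto
    then show "openin (mtop S) {x \<in> points S. node_proj S x \<in> \<Union>\<K>}" using * by (auto intro: openin_Union)
  qed
  then show ?thesis
    unfolding quotient_top_def by (simp add: topology_inverse')
qed

lemma quotient_map_node_proj: "quotient_map (mtop S) (quotient_top S) (node_proj S)"
proof -
  have "{x \<in> points S. node_proj S x \<in> node_proj S ` points S} = points S" by auto
  then have "openin (quotient_top S) (node_proj S ` points S)"
    by (simp add: openin_quotient_top)
  then have "topspace (quotient_top S) = node_proj S ` points S"
    by (metis openin_quotient_top openin_subset openin_topspace subset_antisym)
  then show ?thesis
    unfolding quotient_map_def by (simp add: openin_quotient_top)
qed

abbreviation normalization :: "'s nodal_surface \<Rightarrow> ('s set \<Rightarrow> 'm) \<Rightarrow> 's \<Rightarrow> 'm" where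
  "normalization S u \<equiv> u \<circ> node_proj S"

definition closed_surface :: "'s nodal_surface \<Rightarrow> bool" where
  "closed_surface S \<longleftrightarrow> nodal_riemann_surface S \<and> compact_space (mtop S)"

text \<open>The class in \<open>H\<^sup>1(\<Sigma>, \<real>)\<close> of a closed 1-form on the normalization vanishes iff the form
  is \<open>df\<close> for a smooth function \<open>f\<close> on the nodal surface. So \<open>f\<close> takes equal values at the
  two points of each node, and loops through nodes contribute to \<open>H\<^sup>1\<close>.\<close>

definition null_class :: "'s nodal_surface \<Rightarrow> ('s, complex) form1 \<Rightarrow> bool" where
  "null_class S \<beta> \<longleftrightarrow>
     (\<exists>f :: 's set \<Rightarrow> real. smooth_map S euclid (normalization S f) \<and>
        (\<forall>z\<in>points S. \<forall>v\<in>tangent_space S z. \<beta> z v = dfun S (normalization S f) z v))"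

text \<open>A closed connected oriented surface has genus \<open>g\<close> iff its first integral homology is free
  of rank \<open>2g\<close>.\<close>

definition has_genus :: "'s topology \<Rightarrow> nat \<Rightarrow> bool" where
  "has_genus X g \<longleftrightarrow> homology_group 1 X \<cong> free_Abelian_group {..<2 * g}"

text \<open>The topological genus of a connected closed nodal surface is the genus of the surface obtained
  by replacing each node by a handle (smoothing), whose Euler characteristic is
  \<open>2 - 2g = (\<Sum>\<^sub>C 2 - 2 h(C)) - 2 #nodes\<close>, where \<open>C\<close> ranges over the components of
  the normalization and \<open>h(C)\<close> is the genus of \<open>C\<close>.\<close>

definition has_nodal_genus :: "'s nodal_surface \<Rightarrow> nat \<Rightarrow> bool" where
  "has_nodal_genus S g \<longleftrightarrow>
     (\<exists>h. (\<forall>C\<in>connected_components_of (mtop S). has_genus (subtopology (mtop S) C) (h C)) \<and>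
        2 - 2 * int g =
          (\<Sum>C\<in>connected_components_of (mtop S). 2 - 2 * int (h C)) - 2 * int (card (nodes S)))"

definition elliptic :: "'s nodal_surface \<Rightarrow> bool" where
  "elliptic S \<longleftrightarrow> closed_surface S \<and> connected_space (quotient_top S) \<and> has_nodal_genus S 1"


section \<open>Reeb curves\<close>

definition reeb_2_curve ::
    "('m, 'e::euclidean_space, 'z) charted_space_scheme \<Rightarrow> ('m, 'e) form1 \<Rightarrow> ('m, 'e) form1 \<Rightarrow>
     's nodal_surface \<Rightarrow> ('s set \<Rightarrow> 'm) \<Rightarrow> bool" where
  "reeb_2_curve M lam \<alpha> S u \<longleftrightarrow>
     closed_surface S \<and> smooth_map S M (normalization S u) \<and>
     (\<forall>z\<in>points S.
        (\<exists>v\<in>tangent_space S z. tangent_map S M (normalization S u) z v \<noteq> (\<lambda>_. 0)) \<and>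
        tangent_dim M (normalization S u z) (lcs_dist M lam \<alpha> (normalization S u z)) = 2 \<longrightarrow>
        tangent_map S M (normalization S u) z ` tangent_space S z =
          lcs_dist M lam \<alpha> (normalization S u z)) \<and>
     \<not> null_class S (pullback S M (normalization S u) \<alpha>)"

definition immersed ::
    "('m, 'e::euclidean_space, 'z) charted_space_scheme \<Rightarrow> 's nodal_surface \<Rightarrow> ('s set \<Rightarrow> 'm) \<Rightarrow> bool" where
  "immersed M S u \<longleftrightarrow> immersion S M (normalization S u)"

text \<open>The domain of \<open>\<gamma>\<close> is the unit circle in the complex plane, with angular coordinate \<open>t\<close>.\<close>

definition reeb_1_curve ::
    "('m, 'e::euclidean_space, 'z) charted_space_scheme \<Rightarrow> ('m, 'e) form1 \<Rightarrow> ('m, 'e) form1 \<Rightarrow>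
     (complex \<Rightarrow> 'm) \<Rightarrow> bool" where
  "reeb_1_curve M lam \<alpha> \<gamma> \<longleftrightarrow>
     smooth_map euclid M (\<gamma> \<circ> cis) \<and>
     (\<forall>t. lam (\<gamma> (cis t)) (velocity M (\<gamma> \<circ> cis) t) > 0 \<and>
          velocity M (\<gamma> \<circ> cis) t \<in> lcs_dist M lam \<alpha> (\<gamma> (cis t)))"

end

theory Submission
  imports Defs "HOL-Complex_Analysis.Complex_Analysis"
begin

text \<open>Write \<open>X\<^sub>\<alpha>\<close>, \<open>X\<^sub>\<lambda>\<close> for the \<open>\<omega>\<close>-dual fields and \<open>U\<close> for the normalized curve. Since
  \<open>\<omega>\<close> is skew, \<open>\<lambda>(X\<^sub>\<lambda>) = \<alpha>(X\<^sub>\<alpha>) = 0\<close> and \<open>\<alpha>(X\<^sub>\<lambda>) = - \<lambda>(X\<^sub>\<alpha>)\<close>, which is negative under the Reeb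
  condition. So the distribution is a plane everywhere and neither \<open>\<lambda>\<close> nor \<open>\<alpha>\<close> vanishes on it. As \<open>U\<close> is
  immersed and tangent to the distribution, both \<open>U\<^sup>*\<lambda>\<close> and \<open>U\<^sup>*\<alpha>\<close> are nowhere zero on the compact
  nonempty surface.

  A Reeb 1-curve is obtained by mapping to \<open>M\<close> a closed curve in the surface on which \<open>U\<^sup>*\<lambda>\<close> is
  positive. Such a curve exists for every nowhere zero 1-form on a compact nonempty manifold
  (\<open>closed_positive_curve\<close>), by the argument which produces closed timelike curves in compact
  spacetimes: every point has a neighbourhood whose points can all be reached from one starting point along
  positive curves, finitely many of these neighbourhoods cover the manifold, and a finite relation in
  which everything has a predecessor has a cycle. The curves have to be smooth; \<open>smooth_corner\<close> rounds their corners, using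
  that the admissible velocities form an open convex cone at each point.

  For the second claim, suppose a component \<open>C\<close> of the normalization had genus 0. The closed form \<open>\<alpha>\<close> has local
  primitives by the Poincare lemma, and so has \<open>U\<^sup>*\<alpha>\<close>. Because \<open>H\<^sub>1(C) = 0\<close>, these fit together to a
  primitive on \<open>C\<close> (\<open>global_potential\<close>), and at a maximum of it \<open>U\<^sup>*\<alpha>\<close> vanishes: a contradiction. So all genera
  are at least 1, all terms in the sum over the components in
  \<open>0 = 2 - 2 \<cdot> 1 = (\<Sum>\<^sub>C 2 - 2 h(C)) - 2 #nodes\<close> are at most 0, and there are no nodes.\<close>

section \<open>Calculus of smooth functions\<close>

lemma Ck_on_continuous:
  assumes "Ck_on k S f" shows "continuous_on S f"
proof (cases k)
  case (Suc j)
  then show ?thesis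
    using assms by (auto intro: continuous_at_imp_continuous_on differentiable_imp_continuous_within)
qed (use assms in simp)

lemma Ck_on_Suc_D: "Ck_on (Suc k) S f \<Longrightarrow> Ck_on k S f"
proof (induction k arbitrary: f)
  case 0
  then show ?case by (metis Ck_on.simps(1) Ck_on_continuous)
next
  case (Suc k)
  then show ?case by (metis Ck_on.simps(2))
qed

lemma Ck_on_subset: "Ck_on k S f \<Longrightarrow> T \<subseteq> S \<Longrightarrow> Ck_on k T f"
  by (induction k arbitrary: f) (auto intro: continuous_on_subset)

lemma Ck_on_local:
  assumes "\<And>x. x \<in> S \<Longrightarrow> \<exists>V. open V \<and> x \<in> V \<and> Ck_on k V f"
  shows "Ck_on k S f"
  using assms
proof (induction k arbitrary: f)
  case 0
  have "continuous_on S f"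
    unfolding continuous_on_eq_continuous_within
    using 0 by (metis Ck_on.simps(1) continuous_at_imp_continuous_at_within continuous_on_eq_continuous_at)
  then show ?case by simp
next
  case (Suc k)
  then show ?case unfolding Ck_on.simps by meson
qed

lemma frechet_derivative_cong_open:
  assumes "open V" "x \<in> V" "\<And>y. y \<in> V \<Longrightarrow> f y = g y"
  shows "frechet_derivative f (at x) = frechet_derivative g (at x)"
    "f differentiable (at x) \<longleftrightarrow> g differentiable (at x)"
proof -
  have "(f has_derivative D) (at x) \<longleftrightarrow> (g has_derivative D) (at x)" for D
    using assms by (metis has_derivative_transform_within_open)
  then show "frechet_derivative f (at x) = frechet_derivative g (at x)"
    "f differentiable (at x) \<longleftrightarrow> g differentiable (at x)"
    by (simp_all add: frechet_derivative_def differentiable_def)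
qed

lemma Ck_on_cong:
  assumes "open S" "\<And>x. x \<in> S \<Longrightarrow> f x = g x"
  shows "Ck_on k S f \<longleftrightarrow> Ck_on k S g"
  using assms(2)
proof (induction k arbitrary: f g)
  case 0
  then show ?case by (auto cong: continuous_on_cong)
next
  case (Suc k)
  then have "\<And>x. x \<in> S \<Longrightarrow> frechet_derivative f (at x) = frechet_derivative g (at x)"
    "\<And>x. x \<in> S \<Longrightarrow> f differentiable (at x) \<longleftrightarrow> g differentiable (at x)"
    using frechet_derivative_cong_open[OF assms(1)] by blast+
  then show ?case
    unfolding Ck_on.simps using Suc.IH[of "\<lambda>x. frechet_derivative f (at x) v" "\<lambda>x. frechet_derivative g (at x) v" for v]
    by auto
qed

text \<open>Closure properties are proved by induction on the order of differentiability: exhibit the derivative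
  by a formula that involves derivatives of the given functions only, and apply the induction hypothesis to it.\<close>

lemma Ck_on_SucI:
  assumes "open S" "\<And>x. x \<in> S \<Longrightarrow> (f has_derivative f' x) (at x)" "\<And>v. Ck_on k S (\<lambda>x. f' x v)"
  shows "Ck_on (Suc k) S f"
proof -
  have "\<And>x. x \<in> S \<Longrightarrow> frechet_derivative f (at x) = f' x"
    using assms(2) frechet_derivative_at by metis
  then have "Ck_on k S (\<lambda>x. frechet_derivative f (at x) v)" for v
    using Ck_on_cong[OF assms(1), of "\<lambda>x. frechet_derivative f (at x) v" "\<lambda>x. f' x v" k] assms(3)[of v]
    by simp
  then show ?thesis
    using assms(2) by (auto simp: differentiable_def)
qed

lemma smooth_on_differentiable: "smooth_on S f \<Longrightarrow> x \<in> S \<Longrightarrow> f differentiable (at x)"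
  unfolding smooth_on_def by (metis Ck_on.simps(2))

lemma smooth_on_has_derivative:
  "smooth_on S f \<Longrightarrow> x \<in> S \<Longrightarrow> (f has_derivative frechet_derivative f (at x)) (at x)"
  by (meson frechet_derivative_works smooth_on_differentiable)

lemma smooth_on_frechet_derivative: "smooth_on S f \<Longrightarrow> smooth_on S (\<lambda>x. frechet_derivative f (at x) v)"
  unfolding smooth_on_def by (metis Ck_on.simps(2))

lemma smooth_on_continuous: "smooth_on S f \<Longrightarrow> continuous_on S f"
  unfolding smooth_on_def using Ck_on.simps(1) by blast

lemma smooth_on_subset: "smooth_on S f \<Longrightarrow> T \<subseteq> S \<Longrightarrow> smooth_on T f"
  unfolding smooth_on_def using Ck_on_subset by blast

lemma smooth_on_cong: "open S \<Longrightarrow> (\<And>x. x \<in> S \<Longrightarrow> f x = g x) \<Longrightarrow> smooth_on S f \<longleftrightarrow> smooth_on S g"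
  unfolding smooth_on_def using Ck_on_cong by blast

lemma smooth_on_local:
  assumes "\<And>x. x \<in> S \<Longrightarrow> \<exists>V g. open V \<and> x \<in> V \<and> smooth_on V g \<and> (\<forall>y\<in>V. f y = g y)"
  shows "smooth_on S f"
  unfolding smooth_on_def
proof (intro allI Ck_on_local)
  fix k x assume "x \<in> S"
  then obtain V g where "open V" "x \<in> V" "smooth_on V g" "\<forall>y\<in>V. f y = g y" using assms by blast
  then show "\<exists>V. open V \<and> x \<in> V \<and> Ck_on k V f"
    using smooth_on_cong[of V f g] by (auto simp: smooth_on_def)
qed

lemma Ck_on_const: "Ck_on k S (\<lambda>_. c)"
proof (induction k arbitrary: c)
  case (Suc k)
  have "frechet_derivative (\<lambda>_. c) (at x) = (\<lambda>_. 0)" for x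
    by (metis frechet_derivative_at has_derivative_const)
  with Suc show ?case by simp
qed simp

lemma smooth_on_const: "smooth_on S (\<lambda>_. c)"
  by (simp add: smooth_on_def Ck_on_const)

lemma smooth_on_bounded_linear:
  assumes "bounded_linear L" shows "smooth_on S L"
proof -
  have "frechet_derivative L (at x) = L" for x
    using assms bounded_linear_imp_has_derivative frechet_derivative_at by metis
  moreover have "L differentiable (at x)" for x
    using assms by (simp add: bounded_linear_imp_differentiable)
  moreover have "continuous_on S L"
    using assms by (simp add: linear_continuous_on)
  ultimately have "Ck_on k S L" for k
    by (cases k) (simp_all add: Ck_on_const)
  then show ?thesis by (simp add: smooth_on_def)
qed

lemma smooth_on_id: "smooth_on S (\<lambda>x. x)"
  using bounded_linear_ident by (rule smooth_on_bounded_linear)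

lemma Ck_on_add:
  assumes "open S" "Ck_on k S f" "Ck_on k S g" shows "Ck_on k S (\<lambda>x. f x + g x)"
  using assms(2-)
proof (induction k arbitrary: f g)
  case 0
  then show ?case by (simp add: continuous_on_add)
next
  case (Suc k)
  show ?case
  proof (rule Ck_on_SucI[OF assms(1)])
    show "((\<lambda>x. f x + g x) has_derivative
        (\<lambda>v. frechet_derivative f (at x) v + frechet_derivative g (at x) v)) (at x)" if "x \<in> S" for x
      using Suc.prems that by (auto intro!: has_derivative_add simp: frechet_derivative_works)
    show "Ck_on k S (\<lambda>x. frechet_derivative f (at x) v + frechet_derivative g (at x) v)" for v
      using Suc by simp
  qed
qed

lemma smooth_on_add: "open S \<Longrightarrow> smooth_on S f \<Longrightarrow> smooth_on S g \<Longrightarrow> smooth_on S (\<lambda>x. f x + g x)"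
  by (simp add: smooth_on_def Ck_on_add)

lemma Ck_on_sum:
  "open S \<Longrightarrow> (\<And>i. i \<in> I \<Longrightarrow> Ck_on k S (f i)) \<Longrightarrow> Ck_on k S (\<lambda>x. \<Sum>i\<in>I. f i x)"
  by (induction I rule: infinite_finite_induct) (simp_all add: Ck_on_const Ck_on_add)

lemma smooth_on_sum:
  "open S \<Longrightarrow> (\<And>i. i \<in> I \<Longrightarrow> smooth_on S (f i)) \<Longrightarrow> smooth_on S (\<lambda>x. \<Sum>i\<in>I. f i x)"
  by (simp add: smooth_on_def Ck_on_sum)

lemma Ck_on_bilinear:
  assumes "bounded_bilinear B" "open S" "Ck_on k S f" "Ck_on k S g"
  shows "Ck_on k S (\<lambda>x. B (f x) (g x))"
  using assms(3-)
proof (induction k arbitrary: f g)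
  case 0
  then show ?case using bounded_bilinear.continuous_on[OF assms(1)] by simp
next
  case (Suc k)
  show ?case
  proof (rule Ck_on_SucI[OF assms(2)])
    show "((\<lambda>x. B (f x) (g x)) has_derivative
        (\<lambda>v. B (f x) (frechet_derivative g (at x) v) + B (frechet_derivative f (at x) v) (g x))) (at x)"
      if "x \<in> S" for x
      using Suc.prems that by (intro bounded_bilinear.FDERIV[OF assms(1)]) (simp_all flip: frechet_derivative_works)
    show "Ck_on k S (\<lambda>x. B (f x) (frechet_derivative g (at x) v) + B (frechet_derivative f (at x) v) (g x))" for v
      using Suc.prems Ck_on_Suc_D[OF Suc.prems(1)] Ck_on_Suc_D[OF Suc.prems(2)]
      by (intro Ck_on_add[OF assms(2)] Suc.IH) auto
  qed
qed

lemma smooth_on_bilinear: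
  "bounded_bilinear B \<Longrightarrow> open S \<Longrightarrow> smooth_on S f \<Longrightarrow> smooth_on S g \<Longrightarrow> smooth_on S (\<lambda>x. B (f x) (g x))"
  by (simp add: smooth_on_def Ck_on_bilinear)

lemmas smooth_on_scaleR = smooth_on_bilinear[OF bounded_bilinear_scaleR]
lemmas smooth_on_mult = smooth_on_bilinear[OF bounded_bilinear_mult]

lemma frechet_derivative_Basis_sum:
  fixes f :: "'a::euclidean_space \<Rightarrow> 'b::real_normed_vector"
  assumes "f differentiable (at x)"
  shows "frechet_derivative f (at x) v = (\<Sum>b\<in>Basis. (v \<bullet> b) *\<^sub>R frechet_derivative f (at x) b)"
proof -
  have l: "linear (frechet_derivative f (at x))"
    using assms linear_frechet_derivative by blast
  have "frechet_derivative f (at x) v = frechet_derivative f (at x) (\<Sum>b\<in>Basis. (v \<bullet> b) *\<^sub>R b)"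
    by (simp add: euclidean_representation)
  then show ?thesis by (simp add: linear_sum[OF l] linear_scale[OF l])
qed

text \<open>The derivative of a composition is expanded in a basis, so that it becomes a sum of products
  to which the induction hypothesis and the product rule apply.\<close>

lemma Ck_on_compose:
  fixes f :: "'a::euclidean_space \<Rightarrow> 'b::euclidean_space" and g :: "'b \<Rightarrow> 'c::real_normed_vector"
  assumes "open S" "Ck_on k S f" "Ck_on k T g" "f ` S \<subseteq> T"
  shows "Ck_on k S (g \<circ> f)"
  using assms(2-)
proof (induction k arbitrary: g)
  case 0
  then show ?case by (simp add: continuous_on_compose2 o_def)
next
  case (Suc k)
  let ?D = "\<lambda>x v. \<Sum>b\<in>Basis. (frechet_derivative f (at x) v \<bullet> b) *\<^sub>R frechet_derivative g (at (f x)) b"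
  show ?case
  proof (rule Ck_on_SucI[OF assms(1)])
    fix x assume "x \<in> S"
    then have f: "f differentiable (at x)" and g: "g differentiable (at (f x))"
      using Suc.prems by auto
    then have "(g \<circ> f has_derivative frechet_derivative g (at (f x)) \<circ> frechet_derivative f (at x)) (at x)"
      by (intro diff_chain_at) (auto simp: frechet_derivative_works)
    also have "frechet_derivative g (at (f x)) \<circ> frechet_derivative f (at x) = ?D x"
      by (rule ext) (simp only: o_def frechet_derivative_Basis_sum[OF g, of "frechet_derivative f (at x) _"])
    finally show "(g \<circ> f has_derivative ?D x) (at x)" .
  next
    fix v
    show "Ck_on k S (\<lambda>x. ?D x v)"
    proof (rule Ck_on_sum[OF assms(1)], rule Ck_on_bilinear[OF bounded_bilinear_scaleR assms(1)])
      fix b :: 'b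
      show "Ck_on k S (\<lambda>x. frechet_derivative f (at x) v \<bullet> b)"
        using Suc.prems by (intro Ck_on_bilinear[OF bounded_bilinear_inner assms(1)] Ck_on_const) auto
      have "Ck_on k S ((\<lambda>y. frechet_derivative g (at y) b) \<circ> f)"
        using Suc.prems Ck_on_Suc_D[OF Suc.prems(1)] by (intro Suc.IH) auto
      then show "Ck_on k S (\<lambda>x. frechet_derivative g (at (f x)) b)" by (simp add: o_def)
    qed
  qed
qed

lemma smooth_on_compose:
  fixes f :: "'a::euclidean_space \<Rightarrow> 'b::euclidean_space" and g :: "'b \<Rightarrow> 'c::real_normed_vector"
  assumes "open S" "smooth_on S f" "smooth_on T g" "f ` S \<subseteq> T"
  shows "smooth_on S (g \<circ> f)"
  using assms Ck_on_compose unfolding smooth_on_def by blast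

lemma holomorphic_imp_smooth_on:
  assumes "open S" "f holomorphic_on S" shows "smooth_on S f"
proof -
  have "Ck_on k S f" for k
    using assms(2)
  proof (induction k arbitrary: f)
    case 0
    then show ?case by (simp add: holomorphic_on_imp_continuous_on)
  next
    case (Suc k)
    show ?case
    proof (rule Ck_on_SucI[OF assms(1)])
      show "(f has_derivative (\<lambda>v. deriv f x * v)) (at x)" if "x \<in> S" for x
        using Suc.prems assms(1) that holomorphic_derivI[of f S x]
        by (simp add: has_field_derivative_def)
      show "Ck_on k S (\<lambda>x. deriv f x * v)" for v
        using Suc.prems assms(1) by (intro Suc.IH holomorphic_intros) auto
    qed
  qed
  then show ?thesis by (simp add: smooth_on_def)
qed

section \<open>Symmetry of second derivatives and the Poincare lemma\<close>

text \<open>Both iterated derivatives are the limit of the second difference quotient, which is symmetric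
  in the two directions; the mean value theorem is applied once in each direction.\<close>

lemma second_difference_quotient:
  fixes f :: "'a::euclidean_space \<Rightarrow> real"
  assumes S: "open S" "x \<in> S" and f: "Ck_on 2 S f"
  shows "((\<lambda>s. (f (x + s *\<^sub>R v + s *\<^sub>R w) - f (x + s *\<^sub>R v) - f (x + s *\<^sub>R w) + f x) / s\<^sup>2) \<longlongrightarrow>
     frechet_derivative (\<lambda>y. frechet_derivative f (at y) v) (at x) w) (at_right 0)"
proof (rule tendstoI)
  define fv where "fv y = frechet_derivative f (at y) v" for y
  define fvw where "fvw y = frechet_derivative fv (at y) w" for y
  have d1: "(f has_derivative frechet_derivative f (at y)) (at y)" if "y \<in> S" for y
    using f that by (simp add: numeral_2_eq_2 frechet_derivative_works)
  have d2: "(fv has_derivative frechet_derivative fv (at y)) (at y)" if "y \<in> S" for y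
    using f that unfolding fv_def by (simp add: numeral_2_eq_2 frechet_derivative_works)
  have c: "continuous_on S fvw"
    using f unfolding fvw_def fv_def by (simp add: numeral_2_eq_2)
  fix e :: real assume "e > 0"
  then obtain d where d: "d > 0" "ball x d \<subseteq> S" "\<And>y. y \<in> ball x d \<Longrightarrow> dist (fvw y) (fvw x) < e"
  proof -
    obtain d1 where "d1 > 0" "ball x d1 \<subseteq> S" using S openE by blast
    moreover obtain d2 where "d2 > 0" "\<And>y. y \<in> S \<Longrightarrow> dist y x < d2 \<Longrightarrow> dist (fvw y) (fvw x) < e"
      using c S \<open>e > 0\<close> unfolding continuous_on_iff by metis
    ultimately show ?thesis
      using that[of "min d1 d2"] by (auto simp: subset_iff dist_commute)
  qed
  define r where "r = d / (norm v + norm w + 1)"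
  have nz: "norm v + norm w + 1 > 0" by (smt (verit) norm_ge_zero)
  have r: "r > 0" using d(1) nz unfolding r_def by simp
  have inb: "x + a *\<^sub>R v + b *\<^sub>R w \<in> ball x d" if "0 \<le> a" "a \<le> s" "0 \<le> b" "b \<le> s" "s < r" for a b s
  proof -
    have "norm (a *\<^sub>R v + b *\<^sub>R w) \<le> s * norm v + s * norm w"
      using that by (intro norm_triangle_le add_mono) (auto simp: mult_right_mono)
    also have "\<dots> \<le> s * (norm v + norm w + 1)" using that by (simp add: algebra_simps)
    also have "\<dots> < r * (norm v + norm w + 1)" using that nz by (intro mult_strict_right_mono) auto
    also have "\<dots> = d" using nz by (simp add: r_def)
    finally show ?thesis by (simp add: dist_norm add.assoc) (metis norm_minus_cancel minus_add_distrib add_uminus_conv_diff)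
  qed
  have "dist ((f (x + s *\<^sub>R v + s *\<^sub>R w) - f (x + s *\<^sub>R v) - f (x + s *\<^sub>R w) + f x) / s\<^sup>2) (fvw x) < e"
    if s: "0 < s" "s < r" for s
  proof -
    define g where "g a = f (x + a *\<^sub>R v + s *\<^sub>R w) - f (x + a *\<^sub>R v + 0 *\<^sub>R w)" for a
    have pt: "((\<lambda>a. f (x + a *\<^sub>R v + b *\<^sub>R w)) has_derivative (\<lambda>h. h * fv (x + a *\<^sub>R v + b *\<^sub>R w))) (at a)"
      if "0 \<le> a" "a \<le> s" "0 \<le> b" "b \<le> s" for a b
    proof -
      have y: "x + a *\<^sub>R v + b *\<^sub>R w \<in> S" using inb[OF that s(2)] d(2) by auto
      have "((\<lambda>a. x + a *\<^sub>R v + b *\<^sub>R w) has_derivative (\<lambda>h. h *\<^sub>R v)) (at a)"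
        by (auto intro!: derivative_eq_intros)
      from diff_chain_at[OF this d1[OF y]] show ?thesis
        using linear_frechet_derivative[OF differentiableI[OF d1[OF y]]]
        by (simp add: o_def fv_def linear_scale)
    qed
    have "(g has_real_derivative (fv (x + a *\<^sub>R v + s *\<^sub>R w) - fv (x + a *\<^sub>R v + 0 *\<^sub>R w))) (at a)"
      if "0 \<le> a" "a \<le> s" for a
      unfolding g_def has_field_derivative_def
      by (rule has_derivative_eq_rhs[OF has_derivative_diff[OF pt pt]])
        (use that s in \<open>auto simp: algebra_simps\<close>)
    from MVT2[OF s(1) this] obtain a where a: "0 < a" "a < s"
      "g s - g 0 = s * (fv (x + a *\<^sub>R v + s *\<^sub>R w) - fv (x + a *\<^sub>R v + 0 *\<^sub>R w))"
      by auto
    have "((\<lambda>b. fv (x + a *\<^sub>R v + b *\<^sub>R w)) has_real_derivative fvw (x + a *\<^sub>R v + b *\<^sub>R w)) (at b)"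
      if "0 \<le> b" "b \<le> s" for b
    proof -
      have y: "x + a *\<^sub>R v + b *\<^sub>R w \<in> S" using inb[of a s b] that a s d(2) by auto
      have "((\<lambda>b. x + a *\<^sub>R v + b *\<^sub>R w) has_derivative (\<lambda>h. h *\<^sub>R w)) (at b)"
        by (auto intro!: derivative_eq_intros)
      from diff_chain_at[OF this d2[OF y]] show ?thesis
        using linear_frechet_derivative[OF differentiableI[OF d2[OF y]]]
        by (simp add: o_def fvw_def linear_scale has_field_derivative_def mult_commute_abs)
    qed
    from MVT2[OF s(1) this] obtain b where b: "0 < b" "b < s"
      "fv (x + a *\<^sub>R v + s *\<^sub>R w) - fv (x + a *\<^sub>R v + 0 *\<^sub>R w) = s * fvw (x + a *\<^sub>R v + b *\<^sub>R w)"
      by auto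
    have "(f (x + s *\<^sub>R v + s *\<^sub>R w) - f (x + s *\<^sub>R v) - f (x + s *\<^sub>R w) + f x) / s\<^sup>2
        = fvw (x + a *\<^sub>R v + b *\<^sub>R w)"
      using a(3) b(3) s(1) by (simp add: g_def power2_eq_square field_simps)
    then show ?thesis using d(3) inb[of a s b] a b s by simp
  qed
  then show "\<forall>\<^sub>F s in at_right 0.
      dist ((f (x + s *\<^sub>R v + s *\<^sub>R w) - f (x + s *\<^sub>R v) - f (x + s *\<^sub>R w) + f x) / s\<^sup>2)
       (frechet_derivative (\<lambda>y. frechet_derivative f (at y) v) (at x) w) < e"
    unfolding eventually_at_right_field fvw_def fv_def using r by auto
qed

lemma second_derivative_symmetric_real:
  fixes f :: "'a::euclidean_space \<Rightarrow> real"
  assumes "open S" "x \<in> S" "Ck_on 2 S f"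
  shows "frechet_derivative (\<lambda>y. frechet_derivative f (at y) v) (at x) w =
    frechet_derivative (\<lambda>y. frechet_derivative f (at y) w) (at x) v"
proof (rule tendsto_unique[OF _ second_difference_quotient[OF assms]])
  have "(\<lambda>s. (f (x + s *\<^sub>R w + s *\<^sub>R v) - f (x + s *\<^sub>R w) - f (x + s *\<^sub>R v) + f x) / s\<^sup>2) =
    (\<lambda>s. (f (x + s *\<^sub>R v + s *\<^sub>R w) - f (x + s *\<^sub>R v) - f (x + s *\<^sub>R w) + f x) / s\<^sup>2)"
    by (simp add: algebra_simps)
  with second_difference_quotient[OF assms, of w v]
  show "((\<lambda>s. (f (x + s *\<^sub>R v + s *\<^sub>R w) - f (x + s *\<^sub>R v) - f (x + s *\<^sub>R w) + f x) / s\<^sup>2) \<longlongrightarrow>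
     frechet_derivative (\<lambda>y. frechet_derivative f (at y) w) (at x) v) (at_right 0)" by simp
qed simp

lemma frechet_derivative_inner_right:
  assumes "f differentiable (at x)"
  shows "frechet_derivative (\<lambda>y. f y \<bullet> b) (at x) = (\<lambda>v. frechet_derivative f (at x) v \<bullet> b)"
  using assms by (intro frechet_derivative_at[symmetric] has_derivative_inner_left)
    (simp flip: frechet_derivative_works)

lemma second_derivative_symmetric:
  fixes f :: "'a::euclidean_space \<Rightarrow> 'b::euclidean_space"
  assumes S: "open S" "x \<in> S" and f: "smooth_on S f"
  shows "frechet_derivative (\<lambda>y. frechet_derivative f (at y) v) (at x) w =
    frechet_derivative (\<lambda>y. frechet_derivative f (at y) w) (at x) v"
proof (rule euclidean_eqI)
  fix b :: 'b
  have sb: "smooth_on S (\<lambda>y. f y \<bullet> b)"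
    by (rule smooth_on_bilinear[OF bounded_bilinear_inner S(1) f smooth_on_const])
  have e: "frechet_derivative (\<lambda>y. frechet_derivative (\<lambda>y. f y \<bullet> b) (at y) v) (at x) w
      = frechet_derivative (\<lambda>y. frechet_derivative f (at y) v) (at x) w \<bullet> b" for v w
  proof -
    have "frechet_derivative (\<lambda>y. frechet_derivative (\<lambda>y. f y \<bullet> b) (at y) v) (at x)
      = frechet_derivative (\<lambda>y. frechet_derivative f (at y) v \<bullet> b) (at x)"
      by (rule frechet_derivative_cong_open[OF S])
        (simp add: frechet_derivative_inner_right smooth_on_differentiable[OF f])
    then show ?thesis
      using smooth_on_differentiable[OF smooth_on_frechet_derivative[OF f] S(2)]
      by (simp add: frechet_derivative_inner_right)
  qed
  show "frechet_derivative (\<lambda>y. frechet_derivative f (at y) v) (at x) w \<bullet> b =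
    frechet_derivative (\<lambda>y. frechet_derivative f (at y) w) (at x) v \<bullet> b"
    using second_derivative_symmetric_real[OF S, of "\<lambda>y. f y \<bullet> b" v w] sb
    by (simp add: e smooth_on_def)
qed


text \<open>The primitive is the integral of the form along the segment from the centre; closedness turns
  the derivative of the integrand into a total derivative along the segment.\<close>

lemma Poincare_lemma_ball:
  fixes \<beta> :: "'a::euclidean_space \<Rightarrow> 'a \<Rightarrow> real"
  assumes lin: "\<And>x. x \<in> ball a r \<Longrightarrow> linear (\<beta> x)"
    and C1: "\<And>w. Ck_on 1 (ball a r) (\<lambda>x. \<beta> x w)"
    and closed: "\<And>x v w. x \<in> ball a r \<Longrightarrow>
      frechet_derivative (\<lambda>y. \<beta> y w) (at x) v = frechet_derivative (\<lambda>y. \<beta> y v) (at x) w"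
  shows "\<exists>F. \<forall>x\<in>ball a r. (F has_derivative \<beta> x) (at x)"
proof -
  define D where "D b z h = frechet_derivative (\<lambda>y. \<beta> y b) (at z) h" for b z h
  define y where "y x t = a + t *\<^sub>R (x - a)" for x t
  define f where "f x t = (\<Sum>b\<in>Basis. ((x - a) \<bullet> b) * \<beta> (y x t) b)" for x t
  define g where "g x t h = (\<Sum>b\<in>Basis. ((x - a) \<bullet> b) * (t * D b (y x t) h) + (h \<bullet> b) * \<beta> (y x t) b)" for x t h
  have yball: "y x t \<in> ball a r" if "x \<in> ball a r" "t \<in> {0..1}" for x t
  proof -
    have "y x t \<in> closed_segment a x"
      unfolding y_def in_segment using that by (auto simp: algebra_simps)
    moreover have "closed_segment a x \<subseteq> ball a r"
      using that(1) by (intro closed_segment_subset) (auto simp: le_less_trans[OF zero_le_dist])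
    ultimately show ?thesis by blast
  qed
  have D: "((\<lambda>y. \<beta> y b) has_derivative D b z) (at z)" if "z \<in> ball a r" for b z
    using C1[of b] that unfolding D_def by (simp flip: frechet_derivative_works)
  have linD: "linear (D b z)" if "z \<in> ball a r" for b z
    using D[OF that] has_derivative_linear by blast
  have Dsym: "D b z h = D h z b" if "z \<in> ball a r" for b z h
    using closed[OF that] by (simp add: D_def)
  have contD: "continuous_on (ball a r) (\<lambda>z. D b z h)" for b h
    using C1[of b] by (simp add: D_def)
  have cont\<beta>: "continuous_on (ball a r) (\<lambda>z. \<beta> z b)" for b
    using C1[of b] Ck_on_continuous by blast
  have blg: "bounded_linear (g x t)" if "x \<in> ball a r" "t \<in> {0..1}" for x t
    unfolding g_def linear_conv_bounded_linear[symmetric]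
    using linD[OF yball[OF that]] by (intro linear_compose_sum ballI linear_compose_add)
      (auto simp: linear_iff algebra_simps inner_add_left)
  have df: "((\<lambda>x. f x t) has_derivative g x t) (at x within ball a r)"
    if "x \<in> ball a r" "t \<in> {0..1}" for x t
    unfolding f_def g_def
  proof (intro has_derivative_sum has_derivative_mult)
    fix b :: 'a
    show "((\<lambda>x. (x - a) \<bullet> b) has_derivative (\<lambda>h. h \<bullet> b)) (at x within ball a r)"
      by (auto intro!: derivative_eq_intros)
    have "((\<lambda>x. y x t) has_derivative (\<lambda>h. t *\<^sub>R h)) (at x within ball a r)"
      unfolding y_def by (auto intro!: derivative_eq_intros)
    from diff_chain_within[OF this has_derivative_at_withinI[OF D[OF yball[OF that]]]]
    show "((\<lambda>x. \<beta> (y x t) b) has_derivative (\<lambda>h. t * D b (y x t) h)) (at x within ball a r)"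
      using linD[OF yball[OF that]] by (simp add: o_def linear_scale)
  qed
  have conty: "continuous_on (ball a r \<times> {0..1}) (\<lambda>p. y (fst p) (snd p))"
    unfolding y_def by (intro continuous_intros)
  have ysub: "(\<lambda>p. y (fst p) (snd p)) ` (ball a r \<times> {0..1}) \<subseteq> ball a r"
    using yball by auto
  have contf: "continuous_on (ball a r \<times> {0..1}) (\<lambda>p. f (fst p) (snd p))"
    unfolding f_def using continuous_on_compose2[OF cont\<beta> conty ysub] by (intro continuous_intros)
  have cont_g: "continuous_on (ball a r \<times> cbox 0 1) (\<lambda>(x, t). Blinfun (g x t))"
  proof (rule continuous_on_blinfun_componentwise)
    fix i :: 'a assume "i \<in> Basis"
    have "continuous_on (ball a r \<times> {0..1}) (\<lambda>p. g (fst p) (snd p) i)"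
      unfolding g_def using continuous_on_compose2[OF cont\<beta> conty ysub] continuous_on_compose2[OF contD conty ysub]
      by (intro continuous_intros)
    moreover have "blinfun_apply (Blinfun (g (fst p) (snd p))) i = g (fst p) (snd p) i"
      if "p \<in> ball a r \<times> {0..1}" for p
      using that by (simp add: bounded_linear_Blinfun_apply[OF blg] mem_Times_iff)
    ultimately show "continuous_on (ball a r \<times> cbox 0 1)
        (\<lambda>p. blinfun_apply (case p of (x, t) \<Rightarrow> Blinfun (g x t)) i)"
      by (simp add: case_prod_unfold cong: continuous_on_cong)
  qed
  have contf1: "continuous_on {0..1} (f x)" if "x \<in> ball a r" for x
  proof -
    have "continuous_on {0..1} (\<lambda>t. f (fst (x, t)) (snd (x, t)))"
      using that by (intro continuous_on_compose2[OF contf] continuous_intros) auto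
    then show ?thesis by simp
  qed
  have contg1: "continuous_on (cbox 0 1) (\<lambda>t. Blinfun (g x t))" if "x \<in> ball a r" for x
  proof -
    have "continuous_on (cbox 0 1) (\<lambda>t. case (x, t) of (x, t) \<Rightarrow> Blinfun (g x t))"
      using that by (intro continuous_on_compose2[OF cont_g] continuous_intros) auto
    then show ?thesis by simp
  qed
  define F where "F x = integral (cbox 0 1) (f x)" for x
  have "(F has_derivative \<beta> x) (at x)" if x: "x \<in> ball a r" for x
  proof -
    have "(F has_derivative integral (cbox 0 1) (\<lambda>t. Blinfun (g x t))) (at x within ball a r)"
      unfolding F_def
    proof (rule leibniz_rule[OF _ _ cont_g x])
      show "f x integrable_on cbox 0 1" if "x \<in> ball a r" for x
        using contf1[OF that] by (intro integrable_continuous) simp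
      show "((\<lambda>x. f x t) has_derivative blinfun_apply (Blinfun (g x t))) (at x within ball a r)"
        if "x \<in> ball a r" "t \<in> cbox 0 1" for x t
        using df[of x t] that by (simp add: bounded_linear_Blinfun_apply[OF blg])
    qed simp
    moreover have "blinfun_apply (integral (cbox 0 1) (\<lambda>t. Blinfun (g x t))) h = \<beta> x h" for h
    proof -
      have "((\<lambda>t. t * \<beta> (y x t) h) has_vector_derivative g x t h) (at t within {0..1})"
        if t: "t \<in> {0..1}" for t
      proof -
        note yt = yball[OF x t]
        have "((\<lambda>t. y x t) has_derivative (\<lambda>s. s *\<^sub>R (x - a))) (at t within {0..1})"
          unfolding y_def by (auto intro!: derivative_eq_intros)
        from diff_chain_within[OF this has_derivative_at_withinI[OF D[OF yt, of h]]]
        have "((\<lambda>t. \<beta> (y x t) h) has_derivative (\<lambda>s. s * D h (y x t) (x - a))) (at t within {0..1})"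
          using linD[OF yt] by (simp add: o_def linear_scale)
        from has_derivative_mult[OF has_derivative_ident this]
        have d: "((\<lambda>t. t * \<beta> (y x t) h) has_derivative
            (\<lambda>s. t * (s * D h (y x t) (x - a)) + s * \<beta> (y x t) h)) (at t within {0..1})" .
        have e1: "(\<Sum>b\<in>Basis. ((x - a) \<bullet> b) * (t * D b (y x t) h)) = t * D h (y x t) (x - a)"
        proof -
          have "D h (y x t) (x - a) = D h (y x t) (\<Sum>b\<in>Basis. ((x - a) \<bullet> b) *\<^sub>R b)"
            by (simp only: euclidean_representation)
          also have "\<dots> = (\<Sum>b\<in>Basis. ((x - a) \<bullet> b) * D h (y x t) b)"
            by (simp add: linear_sum[OF linD[OF yt]] linear_scale[OF linD[OF yt]])
          finally show ?thesis
            by (simp add: sum_distrib_left Dsym[OF yt, of h] mult_ac)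
        qed
        have e2: "(\<Sum>b\<in>Basis. (h \<bullet> b) * \<beta> (y x t) b) = \<beta> (y x t) h"
        proof -
          have "\<beta> (y x t) h = \<beta> (y x t) (\<Sum>b\<in>Basis. (h \<bullet> b) *\<^sub>R b)"
            by (simp only: euclidean_representation)
          then show ?thesis by (simp add: linear_sum[OF lin[OF yt]] linear_scale[OF lin[OF yt]])
        qed
        have "g x t h = t * D h (y x t) (x - a) + \<beta> (y x t) h"
          unfolding g_def sum.distrib e1 e2 ..
        then show ?thesis
          using d unfolding has_vector_derivative_def by (simp add: algebra_simps)
      qed
      from fundamental_theorem_of_calculus[OF zero_le_one this]
      have "((\<lambda>t. g x t h) has_integral \<beta> x h) {0..1}" by (simp add: y_def)
      moreover have "blinfun_apply (integral (cbox 0 1) (\<lambda>t. Blinfun (g x t))) h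
          = integral (cbox 0 1) (\<lambda>t. blinfun_apply (Blinfun (g x t)) h)"
        using contg1[OF x] by (intro blinfun_apply_integral integrable_continuous)
      moreover have "\<dots> = integral (cbox 0 1) (\<lambda>t. g x t h)"
        using x by (intro integral_cong) (simp add: bounded_linear_Blinfun_apply[OF blg])
      ultimately show ?thesis by (simp add: integral_unique)
    qed
    ultimately show ?thesis
      using x by (simp add: at_within_open[OF x open_ball] fun_eq_iff) (metis ext)
  qed
  then show ?thesis by blast
qed

section \<open>A smooth step function\<close>

text \<open>The family \<open>t\<^sup>-\<^sup>n exp (- 1 / t)\<close>, extended by \<open>0\<close>, is closed under differentiation up to
  linear combinations, so each member is smooth.\<close>

definition flat_exp :: "nat \<Rightarrow> real \<Rightarrow> real" where
  "flat_exp n t = (if t > 0 then (1 / t) ^ n * exp (- (1 / t)) else 0)"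

lemma flat_exp_has_derivative:
  "(flat_exp n has_real_derivative (flat_exp (n + 2) t - real n * flat_exp (n + 1) t)) (at t)"
proof (cases t "0::real" rule: linorder_cases)
  case less
  have "((\<lambda>_. 0) has_real_derivative 0) (at t)" by simp
  then have "(flat_exp n has_real_derivative 0) (at t)"
    by (rule has_field_derivative_transform_within_open[where S="{..<0}"]) (use less in \<open>auto simp: flat_exp_def\<close>)
  then show ?thesis using less by (simp add: flat_exp_def)
next
  case equal
  have "((\<lambda>h. (1 / h) ^ (n + 1) * exp (- (1 / h))) \<longlongrightarrow> 0) (at_right (0::real))"
  proof -
    have "filterlim (\<lambda>h::real. 1 / h) at_top (at_right 0)"
      using filterlim_inverse_at_top_right by (simp add: inverse_eq_divide)
    from filterlim_compose[OF tendsto_power_div_exp_0 this]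
    have "((\<lambda>h. (1 / h) ^ (n + 1) / exp (1 / h)) \<longlongrightarrow> 0) (at_right (0::real))" .
    note lim = this
    have e: "(1 / h) ^ (n + 1) / exp (1 / h) = (1 / h) ^ (n + 1) * exp (- (1 / h))" for h :: real
      by (metis divide_inverse exp_minus)
    show ?thesis using lim unfolding e .
  qed
  then have r: "((\<lambda>h. (flat_exp n (0 + h) - flat_exp n 0) / h) \<longlongrightarrow> 0) (at_right 0)"
    by (rule tendsto_cong[THEN iffD1, rotated])
      (auto simp: flat_exp_def eventually_at_right_field power_add intro!: exI[of _ 1])
  have "((\<lambda>h. (flat_exp n (0 + h) - flat_exp n 0) / h) \<longlongrightarrow> 0) (at_left 0)"
    by (rule tendsto_cong[THEN iffD1, rotated, OF tendsto_const])
      (auto simp: flat_exp_def eventually_at_left_field intro!: exI[of _ "-1"])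
  with r have "((\<lambda>h. (flat_exp n (0 + h) - flat_exp n 0) / h) \<longlongrightarrow> 0) (at 0)"
    using filterlim_split_at by blast
  then have "(flat_exp n has_real_derivative 0) (at 0)" by (simp add: DERIV_def)
  then show ?thesis using equal by (simp add: flat_exp_def)
next
  case greater
  have "((\<lambda>t. (1 / t) ^ n * exp (- (1 / t))) has_real_derivative
      (flat_exp (n + 2) t - real n * flat_exp (n + 1) t)) (at t)"
  proof -
    have i: "((\<lambda>t. 1 / t) has_real_derivative - ((1 / t) ^ 2)) (at t)"
      using greater by (auto intro!: derivative_eq_intros simp: power2_eq_square)
    have "flat_exp (n + 2) t - real n * flat_exp (n + 1) t =
        real n * ((1 / t) ^ (n - 1) * - ((1 / t) ^ 2)) * exp (- (1 / t))
        + exp (- (1 / t)) * - (- ((1 / t) ^ 2)) * (1 / t) ^ n"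
      using greater by (cases n) (simp_all add: flat_exp_def power2_eq_square algebra_simps)
    with DERIV_mult[OF DERIV_power[OF i, of n] DERIV_fun_exp[OF DERIV_minus[OF i]]] show ?thesis
      by (simp add: mult_ac)
  qed
  then show ?thesis
    by (rule has_field_derivative_transform_within_open[where S="{0<..}"])
      (use greater in \<open>auto simp: flat_exp_def\<close>)
qed

lemma smooth_on_flat_exp: "smooth_on UNIV (flat_exp n)"
proof -
  have "Ck_on k UNIV (flat_exp n)" for k
  proof (induction k arbitrary: n)
    case 0
    show ?case
      using continuous_at_imp_continuous_on[OF ballI[OF DERIV_isCont[OF flat_exp_has_derivative]]] by simp
  next
    case (Suc k)
    show ?case
    proof (rule Ck_on_SucI[OF open_UNIV])
      fix t :: real
      show "(flat_exp n has_derivative (\<lambda>v. (flat_exp (n + 2) t + (- real n) * flat_exp (n + 1) t) * v)) (at t)"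
        using flat_exp_has_derivative[of n t] by (simp add: has_field_derivative_def)
    next
      fix v :: real
      show "Ck_on k UNIV (\<lambda>t. (flat_exp (n + 2) t + (- real n) * flat_exp (n + 1) t) * v)"
        by (intro Ck_on_bilinear[OF bounded_bilinear_mult] Ck_on_add Ck_on_const Suc.IH open_UNIV)
    qed
  qed
  then show ?thesis by (simp add: smooth_on_def)
qed

text \<open>For \<open>h = flat_exp 0\<close>, the argument \<open>h 1 - h (1 - t)\<close> of the outer \<open>h\<close> is at most 0 for \<open>t \<le> 0\<close> and
  equal to \<open>h 1\<close> for \<open>t \<ge> 1\<close>. Nesting \<open>h\<close> in this way avoids dividing by a non-constant function.\<close>

definition smooth_step :: "real \<Rightarrow> real" where
  "smooth_step t = flat_exp 0 (flat_exp 0 1 - flat_exp 0 (1 - t)) / flat_exp 0 (flat_exp 0 1)"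

lemma flat_exp_mono: "s \<le> t \<Longrightarrow> flat_exp 0 s \<le> flat_exp 0 t"
  by (auto simp: flat_exp_def frac_le)

lemma flat_exp_pos: "t > 0 \<Longrightarrow> flat_exp 0 t > 0"
  by (simp add: flat_exp_def)

lemma smooth_step_eq_0: "t \<le> 0 \<Longrightarrow> smooth_step t = 0"
  using flat_exp_mono[of 1 "1 - t"] by (simp add: smooth_step_def) (simp add: flat_exp_def)

lemma smooth_step_eq_1: "t \<ge> 1 \<Longrightarrow> smooth_step t = 1"
proof -
  assume "t \<ge> 1"
  then have "flat_exp 0 (1 - t) = 0" by (simp add: flat_exp_def)
  then show ?thesis
    using flat_exp_pos[OF flat_exp_pos[OF zero_less_one]] by (simp add: smooth_step_def)
qed

lemma smooth_step_mono: "s \<le> t \<Longrightarrow> smooth_step s \<le> smooth_step t"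
  unfolding smooth_step_def
  by (intro divide_right_mono flat_exp_mono diff_left_mono less_imp_le[OF flat_exp_pos] flat_exp_pos) auto

lemma smooth_step_nonneg: "smooth_step t \<ge> 0" and smooth_step_le_1: "smooth_step t \<le> 1"
  using smooth_step_mono[of "min t 0" t] smooth_step_eq_0[of "min t 0"]
    smooth_step_mono[of t "max t 1"] smooth_step_eq_1[of "max t 1"] by auto

lemma smooth_on_affine: "smooth_on S (\<lambda>t::'a::euclidean_space. c *\<^sub>R t + d)"
  unfolding smooth_on_def
  by (intro allI Ck_on_subset[OF Ck_on_add[OF open_UNIV]] Ck_on_const)
    (use smooth_on_bounded_linear[OF bounded_linear_scaleR_right] in \<open>auto simp: smooth_on_def\<close>)

lemma smooth_on_smooth_step: "smooth_on UNIV smooth_step"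
proof -
  have "smooth_on UNIV (\<lambda>t::real. flat_exp 0 (1 - t))"
    using smooth_on_compose[OF open_UNIV smooth_on_affine[of UNIV "-1::real" 1] smooth_on_flat_exp[of 0]]
    by (simp add: o_def)
  from smooth_on_compose[OF open_UNIV this smooth_on_affine[of UNIV "-1" "flat_exp 0 1"]]
  have "smooth_on UNIV (\<lambda>t. flat_exp 0 1 - flat_exp 0 (1 - t))"
    by (simp add: o_def)
  from smooth_on_compose[OF open_UNIV smooth_on_compose[OF open_UNIV this smooth_on_flat_exp[of 0]]
      smooth_on_affine[of UNIV "1 / flat_exp 0 (flat_exp 0 1)" 0]]
  show ?thesis by (simp add: o_def smooth_step_def[abs_def])
qed

section \<open>Charts, tangent vectors and smooth maps\<close>

abbreviation chart_change :: "('p, 'e::euclidean_space) chart \<Rightarrow> ('p, 'e) chart \<Rightarrow> 'p \<Rightarrow> 'e \<Rightarrow> 'e" where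
  "chart_change c d p \<equiv> frechet_derivative (snd d \<circ> chart_inv c) (at (snd c p))"

abbreviation coord_deriv ::
    "('p \<Rightarrow> 'q) \<Rightarrow> ('p, 'e::euclidean_space) chart \<Rightarrow> ('q, 'f::euclidean_space) chart \<Rightarrow> 'p \<Rightarrow> 'e \<Rightarrow> 'f" where
  "coord_deriv f c d p \<equiv> frechet_derivative (snd d \<circ> f \<circ> chart_inv c) (at (snd c p))"

lemma charts_at_iff: "c \<in> charts_at M p \<longleftrightarrow> c \<in> atlas M \<and> p \<in> fst c"
  by (simp add: charts_at_def)

lemma smooth_manifold_topological: "smooth_manifold M \<Longrightarrow> topological_manifold M"
  by (simp add: smooth_manifold_def)

lemma chart_openin: "topological_manifold M \<Longrightarrow> c \<in> atlas M \<Longrightarrow> openin (mtop M) (fst c)"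
  by (simp add: topological_manifold_def)

lemma chart_subset: "topological_manifold M \<Longrightarrow> c \<in> atlas M \<Longrightarrow> fst c \<subseteq> points M"
  by (simp add: chart_openin openin_subset)

lemma charts_at_imp_point: "topological_manifold M \<Longrightarrow> c \<in> charts_at M p \<Longrightarrow> p \<in> points M"
  using chart_subset unfolding charts_at_iff by blast

lemma chart_homeomorphic:
  "topological_manifold M \<Longrightarrow> c \<in> atlas M \<Longrightarrow>
    homeomorphic_map (subtopology (mtop M) (fst c)) (top_of_set (snd c ` fst c)) (snd c)"
  by (simp add: topological_manifold_def)

lemma chart_inv_left [simp]:
  assumes "topological_manifold M" "c \<in> atlas M" "p \<in> fst c"
  shows "chart_inv c (snd c p) = p"
proof -
  have "inj_on (snd c) (fst c)"
    using homeomorphic_imp_injective_map[OF chart_homeomorphic[OF assms(1,2)]] chart_subset[OF assms(1,2)]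
    by (simp add: Int_absorb1)
  then show ?thesis
    using assms(3) by (simp add: chart_inv_def)
qed

lemma chart_inv_right [simp]: "x \<in> snd c ` fst c \<Longrightarrow> snd c (chart_inv c x) = x"
  and chart_inv_in [simp]: "x \<in> snd c ` fst c \<Longrightarrow> chart_inv c x \<in> fst c"
  by (simp_all add: chart_inv_def f_inv_into_f inv_into_into)

lemma chart_in_image_iff:
  assumes "topological_manifold M" "c \<in> atlas M" "p \<in> fst c"
  shows "snd c p \<in> snd c ` (fst c \<inter> W) \<longleftrightarrow> p \<in> W"
proof
  assume "snd c p \<in> snd c ` (fst c \<inter> W)"
  then obtain q where "snd c p = snd c q" "q \<in> fst c" "q \<in> W" by blast
  then show "p \<in> W" using chart_inv_left[OF assms(1,2)] assms(3) by metis
qed (use assms(3) in blast)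

lemma chart_at_in:
  assumes "topological_manifold M" "p \<in> points M" shows "chart_at M p \<in> charts_at M p"
proof -
  have "\<exists>c. c \<in> charts_at M p"
    using assms unfolding topological_manifold_def charts_at_def by blast
  then show ?thesis unfolding chart_at_def by (rule someI_ex)
qed

lemma chart_image_open:
  assumes "topological_manifold M" "c \<in> atlas M" "openin (mtop M) W"
  shows "open (snd c ` (fst c \<inter> W))"
proof -
  have "openin (subtopology (mtop M) (fst c)) (fst c \<inter> W)"
    using assms(3) openin_subtopology_Int2 by blast
  then have "openin (top_of_set (snd c ` fst c)) (snd c ` (fst c \<inter> W))"
    using homeomorphic_map_openness_eq[OF chart_homeomorphic[OF assms(1,2)]] by blast
  moreover have "open (snd c ` fst c)"
    using assms(1,2) by (auto simp: topological_manifold_def)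
  ultimately show ?thesis by (meson openin_open_trans)
qed

lemma chart_open_image: "topological_manifold M \<Longrightarrow> c \<in> atlas M \<Longrightarrow> open (snd c ` fst c)"
  by (auto simp: topological_manifold_def)

lemma chart_preimage_openin:
  assumes "topological_manifold M" "c \<in> atlas M" "open V"
  shows "openin (mtop M) {p \<in> fst c. snd c p \<in> V}"
proof -
  have "continuous_map (subtopology (mtop M) (fst c)) (top_of_set (snd c ` fst c)) (snd c)"
    using chart_homeomorphic[OF assms(1,2)] homeomorphic_imp_continuous_map by blast
  then have "continuous_map (subtopology (mtop M) (fst c)) euclidean (snd c)"
    using continuous_map_into_fulltopology by blast
  then have "openin (subtopology (mtop M) (fst c)) {p \<in> topspace (subtopology (mtop M) (fst c)). snd c p \<in> V}"
    using assms(3) by (auto simp: continuous_map_def)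
  moreover have "{p \<in> topspace (subtopology (mtop M) (fst c)). snd c p \<in> V} = {p \<in> fst c. snd c p \<in> V}"
    using chart_subset[OF assms(1,2)] by auto
  ultimately show ?thesis
    using chart_openin[OF assms(1,2)] openin_trans_full by metis
qed

lemma chart_inv_continuous:
  assumes "topological_manifold M" "c \<in> atlas M"
  shows "continuous_map (top_of_set (snd c ` fst c)) (mtop M) (chart_inv c)"
proof -
  have "snd c ` (fst c \<inter> W) = {x \<in> snd c ` fst c. chart_inv c x \<in> W}" for W
    using chart_inv_left[OF assms] by auto
  then have "openin (top_of_set (snd c ` fst c)) {x \<in> snd c ` fst c. chart_inv c x \<in> W}"
    if "openin (mtop M) W" for W
    using chart_image_open[OF assms that] by (metis (no_types, lifting) inf_le1 image_mono open_openin_trans openin_open_eq chart_open_image[OF assms])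
  then show ?thesis
    using chart_subset[OF assms] by (auto simp: continuous_map_def)
qed

lemma transition_smooth_on:
  "smooth_manifold M \<Longrightarrow> c \<in> atlas M \<Longrightarrow> d \<in> atlas M \<Longrightarrow>
    smooth_on (snd c ` (fst c \<inter> fst d)) (snd d \<circ> chart_inv c)"
  by (simp add: smooth_manifold_def)

lemma transition_has_derivative:
  assumes "smooth_manifold M" "c \<in> charts_at M p" "d \<in> charts_at M p"
  shows "((snd d \<circ> chart_inv c) has_derivative chart_change c d p)
    (at (snd c p))"
  using assms transition_smooth_on[of M c d]
  by (intro smooth_on_has_derivative) (auto simp: charts_at_iff)

lemma riemann_surface_imp_smooth_manifold:
  assumes "riemann_surface M" shows "smooth_manifold M"
proof -
  have t: "topological_manifold M" using assms by (simp add: riemann_surface_def)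
  have "smooth_on (snd c ` (fst c \<inter> fst d)) (snd d \<circ> chart_inv c)" if "c \<in> atlas M" "d \<in> atlas M" for c d
    using that assms chart_image_open[OF t that(1) chart_openin[OF t that(2)]]
    by (intro holomorphic_imp_smooth_on) (auto simp: riemann_surface_def)
  then show ?thesis using t by (simp add: smooth_manifold_def)
qed

text \<open>Near the point, the new coordinate expression is the old one composed with the coordinate change.\<close>

lemma has_derivative_change_target_chart:
  assumes M: "smooth_manifold M" and V: "open V" "x \<in> V" "\<And>y. y \<in> V \<Longrightarrow> g y \<in> fst d"
    and de: "d \<in> charts_at M (g x)" "e \<in> charts_at M (g x)"
    and L: "((snd d \<circ> g) has_derivative L) (at x)"
  shows "((snd e \<circ> g) has_derivative
    chart_change d e (g x) \<circ> L) (at x)"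
proof -
  have "((snd e \<circ> chart_inv d) \<circ> (snd d \<circ> g) has_derivative
    chart_change d e (g x) \<circ> L) (at x)"
    using diff_chain_at[OF L] transition_has_derivative[OF M de] by auto
  then show ?thesis
    by (rule has_derivative_transform_within_open[OF _ V(1,2)])
      (use V(3) de smooth_manifold_topological[OF M] in \<open>auto simp: charts_at_iff\<close>)
qed

lemma has_derivative_change_source_chart:
  assumes M: "smooth_manifold M" and cd: "c \<in> charts_at M p" "d \<in> charts_at M p"
    and L: "((g \<circ> chart_inv c) has_derivative L) (at (snd c p))"
  shows "((g \<circ> chart_inv d) has_derivative
    L \<circ> chart_change d c p) (at (snd d p))"
proof -
  have t: "topological_manifold M" using M by (simp add: smooth_manifold_topological)
  have at: "c \<in> atlas M" "d \<in> atlas M" "p \<in> fst c" "p \<in> fst d" using cd by (auto simp: charts_at_iff)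
  have "((snd c \<circ> chart_inv d) (snd d p)) = snd c p" using t at by simp
  then have "((g \<circ> chart_inv c) \<circ> (snd c \<circ> chart_inv d) has_derivative
    L \<circ> chart_change d c p) (at (snd d p))"
    using L by (intro diff_chain_at[OF transition_has_derivative[OF M cd(2,1)]]) simp
  then show ?thesis
    by (rule has_derivative_transform_within_open[OF _ chart_image_open[OF t at(2) chart_openin[OF t at(1)]]])
      (use at t in auto)
qed

lemma transition_cocycle:
  assumes M: "smooth_manifold M" and c: "c \<in> charts_at M p" "d \<in> charts_at M p" "e \<in> charts_at M p"
  shows "chart_change c e p w =
    chart_change d e p
      (chart_change c d p w)"
proof -
  have "((snd e \<circ> chart_inv c) has_derivative
     chart_change d e p \<circ>
      chart_change c d p) (at (snd c p))"
    using has_derivative_change_source_chart[OF M c(2,1) transition_has_derivative[OF M c(2,3)]] .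
  from frechet_derivative_at[OF this] show ?thesis by (metis comp_apply)
qed

lemma transition_refl:
  assumes "smooth_manifold M" "c \<in> charts_at M p"
  shows "chart_change c c p w = w"
proof -
  have t: "topological_manifold M" using assms by (simp add: smooth_manifold_topological)
  have "chart_change c c p = frechet_derivative (\<lambda>x. x) (at (snd c p))"
    by (rule frechet_derivative_cong_open[OF chart_open_image[OF t]]) (use assms in \<open>auto simp: charts_at_iff\<close>)
  then show ?thesis
    using frechet_derivative_at[OF has_derivative_ident] by metis
qed

lemma coord_vec_in_tangent_space:
  assumes "smooth_manifold M" "c \<in> charts_at M p"
  shows "coord_vec M c p w \<in> tangent_space M p"
proof -
  have "coord_vec M c p w e = chart_change d e p (coord_vec M c p w d)"
    if "d \<in> charts_at M p" "e \<in> charts_at M p" for d e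
    using that unfolding coord_vec_def by (simp only: if_True transition_cocycle[OF assms that])
  moreover have "coord_vec M c p w e = 0" if "e \<notin> charts_at M p" for e
    using that by (simp add: coord_vec_def)
  ultimately show ?thesis unfolding tangent_space_def by blast
qed

lemma coord_vec_same:
  "smooth_manifold M \<Longrightarrow> c \<in> charts_at M p \<Longrightarrow> coord_vec M c p w c = w"
  by (simp add: coord_vec_def transition_refl)

lemma tangent_vec_eq_coord_vec:
  assumes "c \<in> charts_at M p" "v \<in> tangent_space M p" shows "coord_vec M c p (v c) = v"
proof
  fix d
  have "d \<in> charts_at M p \<Longrightarrow> v d = chart_change c d p (v c)"
    "d \<notin> charts_at M p \<Longrightarrow> v d = 0"
    using assms unfolding tangent_space_def by blast+
  then show "coord_vec M c p (v c) d = v d" by (simp add: coord_vec_def)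
qed

lemma coord_vec_linear:
  assumes "smooth_manifold M" "c \<in> charts_at M p"
  shows "coord_vec M c p (a *\<^sub>R v + b *\<^sub>R w) = (\<lambda>d. a *\<^sub>R coord_vec M c p v d + b *\<^sub>R coord_vec M c p w d)"
proof
  fix d
  show "coord_vec M c p (a *\<^sub>R v + b *\<^sub>R w) d = a *\<^sub>R coord_vec M c p v d + b *\<^sub>R coord_vec M c p w d"
  proof (cases "d \<in> charts_at M p")
    case True
    have "linear (chart_change c d p)"
      using transition_has_derivative[OF assms True] has_derivative_linear by blast
    then show ?thesis using True by (simp add: coord_vec_def linear_add linear_scale)
  qed (simp add: coord_vec_def)
qed

lemma tangent_space_linear:
  assumes M: "smooth_manifold M" "p \<in> points M" and v: "v \<in> tangent_space M p" "w \<in> tangent_space M p"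
  shows "(\<lambda>c. a *\<^sub>R v c + b *\<^sub>R w c) \<in> tangent_space M p"
proof -
  have c: "chart_at M p \<in> charts_at M p"
    using M by (simp add: chart_at_in smooth_manifold_topological)
  have "(\<lambda>d. a *\<^sub>R v d + b *\<^sub>R w d) = coord_vec M (chart_at M p) p (a *\<^sub>R v (chart_at M p) + b *\<^sub>R w (chart_at M p))"
    using coord_vec_linear[OF M(1) c] tangent_vec_eq_coord_vec[OF c v(1)] tangent_vec_eq_coord_vec[OF c v(2)]
    by simp
  then show ?thesis using coord_vec_in_tangent_space[OF M(1) c] by simp
qed

lemma zero_in_tangent_space:
  assumes M: "smooth_manifold M" "p \<in> points M" shows "(\<lambda>_. 0) \<in> tangent_space M p"
proof -
  have "chart_at M p \<in> charts_at M p" using M by (simp add: chart_at_in smooth_manifold_topological)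
  note v = coord_vec_in_tangent_space[OF M(1) this, of 0]
  show ?thesis using tangent_space_linear[OF M v v, of 0 0] by simp
qed

lemma smooth_map_continuous: "smooth_map M N f \<Longrightarrow> continuous_map (mtop M) (mtop N) f"
  by (simp add: smooth_map_def)

lemma smooth_map_in_points: "smooth_map M N f \<Longrightarrow> p \<in> points M \<Longrightarrow> f p \<in> points N"
  using smooth_map_continuous continuous_map_image_subset_topspace by blast

lemma smooth_map_domain_open:
  assumes "topological_manifold M" "topological_manifold N" "continuous_map (mtop M) (mtop N) f"
    "c \<in> atlas M" "openin (mtop N) W"
  shows "open (snd c ` {p \<in> fst c. f p \<in> W})"
proof -
  have "openin (mtop M) {p \<in> points M. f p \<in> W}"
    using assms by (simp add: continuous_map_def)
  moreover have "fst c \<inter> {p \<in> points M. f p \<in> W} = {p \<in> fst c. f p \<in> W}"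
    using chart_subset[OF assms(1,4)] by auto
  ultimately show ?thesis
    using chart_image_open[OF assms(1,4)] by metis
qed

lemma smooth_map_smooth_on:
  "smooth_map M N f \<Longrightarrow> c \<in> atlas M \<Longrightarrow> d \<in> atlas N \<Longrightarrow>
    smooth_on (snd c ` {p \<in> fst c. f p \<in> fst d}) (snd d \<circ> f \<circ> chart_inv c)"
  by (simp add: smooth_map_def)

lemma smooth_map_has_derivative:
  assumes "smooth_map M N f" "c \<in> charts_at M p" "d \<in> charts_at N (f p)"
  shows "((snd d \<circ> f \<circ> chart_inv c) has_derivative
    coord_deriv f c d p) (at (snd c p))"
  using assms smooth_map_smooth_on[OF assms(1), of c d]
  by (intro smooth_on_has_derivative) (auto simp: charts_at_iff)

text \<open>The chart chosen in the definition of the differential is immaterial by the chain rule.\<close>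

lemma tangent_map_chart:
  assumes M: "smooth_manifold M" and f: "smooth_map M N f"
    and c: "c \<in> charts_at M p" and v: "v \<in> tangent_space M p" and d: "d \<in> charts_at N (f p)"
  shows "tangent_map M N f p v d = coord_deriv f c d p (v c)"
proof -
  define b where "b = chart_at M p"
  have p: "p \<in> points M" using charts_at_imp_point[OF smooth_manifold_topological[OF M] c] .
  have b: "b \<in> charts_at M p"
    using p M by (simp add: b_def chart_at_in smooth_manifold_topological)
  have "((snd d \<circ> f) \<circ> chart_inv b has_derivative
     coord_deriv f c d p \<circ> chart_change b c p)
     (at (snd b p))"
    by (rule has_derivative_change_source_chart[OF M c b smooth_map_has_derivative[OF f c d]])
  then have e: "coord_deriv f b d p = 
     coord_deriv f c d p \<circ> chart_change b c p"
    using frechet_derivative_at by metis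
  have "v c = chart_change b c p (v b)"
    using v b c unfolding tangent_space_def by blast
  then show ?thesis
    using d by (simp add: tangent_map_def Let_def e flip: b_def)
qed

lemma tangent_map_outside: "d \<notin> charts_at N (f p) \<Longrightarrow> tangent_map M N f p v d = 0"
  by (simp add: tangent_map_def Let_def)

text \<open>This is what makes the differential of a map take values in the tangent spaces of the target.\<close>

lemma derivative_change_target_chart:
  assumes M: "smooth_manifold M" and N: "smooth_manifold N" and f: "smooth_map M N f"
    and c: "c \<in> charts_at M p" and d: "d \<in> charts_at N (f p)" and e: "e \<in> charts_at N (f p)"
  shows "coord_deriv f c e p w =
    chart_change d e (f p)
      (coord_deriv f c d p w)"
proof -
  have t: "topological_manifold M" "topological_manifold N" using M N by (auto simp: smooth_manifold_topological)
  have at: "c \<in> atlas M" "p \<in> fst c" "d \<in> atlas N" "e \<in> atlas N" "f p \<in> fst d" "f p \<in> fst e"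
    using c d e by (auto simp: charts_at_iff)
  let ?V = "snd c ` {p \<in> fst c. f p \<in> fst d}"
  have fp: "(f \<circ> chart_inv c) (snd c p) = f p" using t at by simp
  have "(snd e \<circ> (f \<circ> chart_inv c) has_derivative
      chart_change d e ((f \<circ> chart_inv c) (snd c p)) \<circ>
      coord_deriv f c d p) (at (snd c p))"
  proof (rule has_derivative_change_target_chart[OF N, where V = ?V and x = "snd c p"])
    show "open ?V"
      using smooth_map_domain_open[OF t smooth_map_continuous[OF f] at(1) chart_openin[OF t(2) at(3)]] .
    show "snd c p \<in> ?V" using at by auto
    show "(f \<circ> chart_inv c) y \<in> fst d" if "y \<in> ?V" for y using that t at by auto
    show "d \<in> charts_at N ((f \<circ> chart_inv c) (snd c p))" "e \<in> charts_at N ((f \<circ> chart_inv c) (snd c p))"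
      using d e fp by simp_all
    show "(snd d \<circ> (f \<circ> chart_inv c) has_derivative
        coord_deriv f c d p) (at (snd c p))"
      using smooth_map_has_derivative[OF f c d] by (simp add: o_assoc)
  qed
  from frechet_derivative_at[OF this] show ?thesis
    unfolding fp by (metis comp_apply o_assoc)
qed

lemma tangent_map_in_tangent_space:
  assumes M: "smooth_manifold M" and N: "smooth_manifold N" and f: "smooth_map M N f" and p: "p \<in> points M"
  shows "tangent_map M N f p v \<in> tangent_space N (f p)"
proof -
  have "chart_at M p \<in> charts_at M p" using p M by (simp add: chart_at_in smooth_manifold_topological)
  note change = derivative_change_target_chart[OF M N f this]
  have "tangent_map M N f p v e =
      chart_change d e (f p) (tangent_map M N f p v d)"
    if "d \<in> charts_at N (f p)" "e \<in> charts_at N (f p)" for d e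
    using that unfolding tangent_map_def Let_def by (simp only: if_True change[OF that])
  moreover have "tangent_map M N f p v e = 0" if "e \<notin> charts_at N (f p)" for e
    using that by (rule tangent_map_outside)
  ultimately show ?thesis unfolding tangent_space_def by blast
qed

lemma tangent_map_linear:
  assumes M: "smooth_manifold M" and f: "smooth_map M N f" and p: "p \<in> points M"
  shows "tangent_map M N f p (\<lambda>c. a *\<^sub>R v c + b *\<^sub>R w c) =
    (\<lambda>d. a *\<^sub>R tangent_map M N f p v d + b *\<^sub>R tangent_map M N f p w d)"
proof
  fix d
  show "tangent_map M N f p (\<lambda>c. a *\<^sub>R v c + b *\<^sub>R w c) d =
    a *\<^sub>R tangent_map M N f p v d + b *\<^sub>R tangent_map M N f p w d"
  proof (cases "d \<in> charts_at N (f p)")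
    case True
    have "chart_at M p \<in> charts_at M p" using p M by (simp add: chart_at_in smooth_manifold_topological)
    from has_derivative_linear[OF smooth_map_has_derivative[OF f this True]] True show ?thesis
      by (simp add: tangent_map_def Let_def linear_add linear_scale)
  qed (simp add: tangent_map_outside)
qed

lemma smooth_map_compose:
  assumes M: "smooth_manifold M" and N: "smooth_manifold N" and P: "smooth_manifold P"
    and f: "smooth_map M N f" and g: "smooth_map N P g"
  shows "smooth_map M P (g \<circ> f)"
proof -
  have t: "topological_manifold M" "topological_manifold N" "topological_manifold P"
    using M N P by (auto simp: smooth_manifold_topological)
  have cont: "continuous_map (mtop M) (mtop P) (g \<circ> f)"
    using f g by (meson continuous_map_compose smooth_map_continuous)
  have "smooth_on (snd c ` {p \<in> fst c. (g \<circ> f) p \<in> fst e}) (snd e \<circ> (g \<circ> f) \<circ> chart_inv c)"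
    if c: "c \<in> atlas M" and e: "e \<in> atlas P" for c e
  proof (rule smooth_on_local)
    fix x assume "x \<in> snd c ` {p \<in> fst c. (g \<circ> f) p \<in> fst e}"
    then obtain p where p: "x = snd c p" "p \<in> fst c" "g (f p) \<in> fst e" by auto
    then have "f p \<in> points N"
      using chart_subset[OF t(1) c] smooth_map_in_points[OF f] by auto
    from chart_at_in[OF t(2) this] obtain d where d: "d \<in> atlas N" "f p \<in> fst d"
      unfolding charts_at_iff by blast
    define W where "W = {q \<in> fst d. g q \<in> fst e}"
    have W: "openin (mtop N) W"
    proof -
      have "openin (mtop N) (fst d \<inter> {q \<in> points N. g q \<in> fst e})"
        using chart_openin[OF t(2) d(1)] chart_openin[OF t(3) e] smooth_map_continuous[OF g]
        by (intro openin_Int) (auto simp: continuous_map_def)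
      moreover have "fst d \<inter> {q \<in> points N. g q \<in> fst e} = W"
        using chart_subset[OF t(2) d(1)] by (auto simp: W_def)
      ultimately show ?thesis by simp
    qed
    define V where "V = snd c ` {p \<in> fst c. f p \<in> W}"
    have V: "open V" "x \<in> V"
      using smooth_map_domain_open[OF t(1,2) smooth_map_continuous[OF f] c W] p d by (auto simp: V_def W_def)
    have inv: "chart_inv c y \<in> fst c" "f (chart_inv c y) \<in> fst d" "g (f (chart_inv c y)) \<in> fst e" if "y \<in> V" for y
      using that t c by (auto simp: V_def W_def)
    have sf: "smooth_on V (snd d \<circ> f \<circ> chart_inv c)"
      by (rule smooth_on_subset[OF smooth_map_smooth_on[OF f c d(1)]]) (auto simp: V_def W_def)
    have "smooth_on V ((snd e \<circ> g \<circ> chart_inv d) \<circ> (snd d \<circ> f \<circ> chart_inv c))"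
      by (rule smooth_on_compose[OF V(1) sf smooth_map_smooth_on[OF g d(1) e]]) (use inv in auto)
    moreover have "(snd e \<circ> (g \<circ> f) \<circ> chart_inv c) y = ((snd e \<circ> g \<circ> chart_inv d) \<circ> (snd d \<circ> f \<circ> chart_inv c)) y"
      if "y \<in> V" for y
      using inv[OF that] t d by simp
    ultimately show "\<exists>V h. open V \<and> x \<in> V \<and> smooth_on V h \<and> (\<forall>y\<in>V. (snd e \<circ> (g \<circ> f) \<circ> chart_inv c) y = h y)"
      using V by blast
  qed
  with cont show ?thesis by (simp add: smooth_map_def)
qed

lemma tangent_map_compose:
  assumes M: "smooth_manifold M" and N: "smooth_manifold N"
    and f: "smooth_map M N f" and g: "smooth_map N P g" and p: "p \<in> points M"
  shows "tangent_map M P (g \<circ> f) p v = tangent_map N P g (f p) (tangent_map M N f p v)"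
proof
  fix e
  show "tangent_map M P (g \<circ> f) p v e = tangent_map N P g (f p) (tangent_map M N f p v) e"
  proof (cases "e \<in> charts_at P (g (f p))")
    case e: True
    have t: "topological_manifold M" "topological_manifold N"
      using M N by (auto simp: smooth_manifold_topological)
    define c where "c = chart_at M p"
    define d where "d = chart_at N (f p)"
    have c: "c \<in> charts_at M p" using p t by (simp add: c_def chart_at_in)
    have d: "d \<in> charts_at N (f p)"
      using smooth_map_in_points[OF f p] t by (simp add: d_def chart_at_in)
    have at: "c \<in> atlas M" "p \<in> fst c" "d \<in> atlas N" "f p \<in> fst d" using c d by (auto simp: charts_at_iff)
    let ?V = "snd c ` {p \<in> fst c. f p \<in> fst d}"
    have V: "open ?V" "snd c p \<in> ?V"
      using smooth_map_domain_open[OF t smooth_map_continuous[OF f] at(1) chart_openin[OF t(2) at(3)]] at by auto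
    have "((snd e \<circ> g \<circ> chart_inv d) \<circ> (snd d \<circ> f \<circ> chart_inv c) has_derivative
        frechet_derivative (snd e \<circ> g \<circ> chart_inv d) (at (snd d (f p))) \<circ>
        coord_deriv f c d p) (at (snd c p))"
      using diff_chain_at[OF smooth_map_has_derivative[OF f c d]] smooth_map_has_derivative[OF g d e] t at
      by simp
    then have "(snd e \<circ> (g \<circ> f) \<circ> chart_inv c has_derivative
        frechet_derivative (snd e \<circ> g \<circ> chart_inv d) (at (snd d (f p))) \<circ>
        coord_deriv f c d p) (at (snd c p))"
      by (rule has_derivative_transform_within_open[OF _ V]) (use t at in auto)
    from frechet_derivative_at[OF this] show ?thesis
      using e d by (simp add: tangent_map_def Let_def flip: c_def d_def) (metis comp_apply)
  qed (simp add: tangent_map_outside)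
qed

subsection \<open>Euclidean space and curves\<close>

lemma euclid_simps [simp]:
  "mtop euclid = euclidean" "atlas euclid = {(UNIV, id)}" "charts_at euclid p = {(UNIV, id)}"
  "chart_at euclid p = (UNIV, id)" "chart_inv (UNIV, id) = id"
proof -
  show a: "mtop euclid = euclidean" "atlas euclid = {(UNIV, id)}" by (simp_all add: euclid_def)
  then show b: "charts_at euclid p = {(UNIV, id)}" for p by (auto simp: charts_at_def)
  show "chart_at euclid p = (UNIV, id)" by (simp add: chart_at_def b)
  show "chart_inv (UNIV, id) = id" by (simp add: chart_inv_def inv_id[unfolded id_def] id_def)
qed

lemma smooth_manifold_euclid: "smooth_manifold (euclid :: ('e::euclidean_space, 'e) charted_space)"
proof -
  have "second_countable (euclidean :: 'e topology)"
  proof -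
    obtain B :: "'e set set" where "countable B" "topological_basis B"
      using ex_countable_basis by blast
    then show ?thesis
      unfolding second_countable_def by (intro exI[of _ B])
        (auto simp: topological_basis_open elim!: topological_basisE)
  qed
  then show ?thesis
    unfolding smooth_manifold_def topological_manifold_def
    by (simp add: smooth_on_id[unfolded id_def[symmetric]] id_def[symmetric] homeomorphic_map_id)
qed

lemma velocity_chart:
  "velocity M \<gamma> t d = (if d \<in> charts_at M (\<gamma> t) then frechet_derivative (snd d \<circ> \<gamma>) (at t) 1 else 0)"
proof -
  have "coord_vec euclid (UNIV, id) t 1 (UNIV, id) = 1"
    by (rule coord_vec_same[OF smooth_manifold_euclid]) simp
  then show ?thesis by (simp add: velocity_def tangent_map_def Let_def)
qed

lemma velocity_in_tangent_space:
  "smooth_manifold M \<Longrightarrow> smooth_map euclid M \<gamma> \<Longrightarrow> velocity M \<gamma> t \<in> tangent_space M (\<gamma> t)"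
  unfolding velocity_def by (rule tangent_map_in_tangent_space[OF smooth_manifold_euclid]) auto

lemma velocity_compose:
  assumes "smooth_manifold M" "smooth_map euclid M \<gamma>" "smooth_map M N f"
  shows "velocity N (f \<circ> \<gamma>) t = tangent_map M N f (\<gamma> t) (velocity M \<gamma> t)"
  unfolding velocity_def by (rule tangent_map_compose[OF smooth_manifold_euclid assms]) auto

subsection \<open>Differential 1-forms in coordinates\<close>

lemma one_form_linear:
  "one_form M \<beta> \<Longrightarrow> p \<in> points M \<Longrightarrow> v \<in> tangent_space M p \<Longrightarrow> w \<in> tangent_space M p \<Longrightarrow>
    \<beta> p (\<lambda>c. a *\<^sub>R v c + b *\<^sub>R w c) = a * \<beta> p v + b * \<beta> p w"
  by (simp add: one_form_def)

lemma form_eq_local_form: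
  assumes "smooth_manifold M" "c \<in> charts_at M p" "v \<in> tangent_space M p"
  shows "\<beta> p v = local_form M \<beta> c (snd c p) (v c)"
  using assms(2,3) smooth_manifold_topological[OF assms(1)]
  by (simp add: local_form_def tangent_vec_eq_coord_vec charts_at_iff)

lemma local_form_linear:
  assumes M: "smooth_manifold M" and \<beta>: "one_form M \<beta>" and c: "c \<in> charts_at M p"
  shows "linear (local_form M \<beta> c (snd c p))"
proof -
  have t: "topological_manifold M" using M by (simp add: smooth_manifold_topological)
  have p: "chart_inv c (snd c p) = p" "p \<in> points M"
    using c t charts_at_imp_point[OF t c] by (auto simp: charts_at_iff)
  have "local_form M \<beta> c (snd c p) (a *\<^sub>R v + b *\<^sub>R w) =
     a * local_form M \<beta> c (snd c p) v + b * local_form M \<beta> c (snd c p) w" for a b v w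
    unfolding local_form_def p coord_vec_linear[OF M c]
    by (rule one_form_linear[OF \<beta> p(2)]) (simp_all add: coord_vec_in_tangent_space[OF M c])
  from this[of 1 _ 1] this[of _ _ 0] show ?thesis by (intro linearI) auto
qed

lemma local_form_smooth_on:
  "one_form M \<beta> \<Longrightarrow> c \<in> atlas M \<Longrightarrow> smooth_on (snd c ` fst c) (\<lambda>x. local_form M \<beta> c x w)"
  by (simp add: one_form_def)

lemma local_form_Basis_sum:
  assumes "smooth_manifold M" "one_form M \<beta>" "c \<in> atlas M" "x \<in> snd c ` fst c"
  shows "local_form M \<beta> c x w = (\<Sum>b\<in>Basis. (w \<bullet> b) * local_form M \<beta> c x b)"
proof -
  obtain p where p: "x = snd c p" "c \<in> charts_at M p" using assms by (auto simp: charts_at_iff)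
  have l: "linear (local_form M \<beta> c x)" using local_form_linear[OF assms(1,2) p(2)] p(1) by simp
  have "local_form M \<beta> c x w = local_form M \<beta> c x (\<Sum>b\<in>Basis. (w \<bullet> b) *\<^sub>R b)"
    by (simp only: euclidean_representation)
  then show ?thesis by (simp add: linear_sum[OF l] linear_scale[OF l])
qed

lemma local_form_change_chart:
  assumes M: "smooth_manifold M" and c: "c \<in> charts_at M p" and d: "d \<in> charts_at M p"
  shows "local_form M \<beta> c (snd c p) w =
    local_form M \<beta> d (snd d p) (chart_change c d p w)"
proof -
  have p: "chart_inv c (snd c p) = p" "chart_inv d (snd d p) = p"
    using c d smooth_manifold_topological[OF M] by (auto simp: charts_at_iff)
  have "coord_vec M d p (coord_vec M c p w d) = coord_vec M c p w"
    by (rule tangent_vec_eq_coord_vec[OF d coord_vec_in_tangent_space[OF M c]])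
  then show ?thesis using d by (simp add: local_form_def p coord_vec_def[of M c p w])
qed

lemma local_form_pullback:
  assumes M: "smooth_manifold M" and N: "smooth_manifold N" and f: "smooth_map M N f"
    and c: "c \<in> charts_at M p" and d: "d \<in> charts_at N (f p)"
  shows "local_form M (pullback M N f \<beta>) c (snd c p) w =
    local_form N \<beta> d (snd d (f p)) (coord_deriv f c d p w)"
proof -
  have t: "topological_manifold M" using M by (simp add: smooth_manifold_topological)
  have at: "c \<in> atlas M" "p \<in> fst c" using c by (auto simp: charts_at_iff)
  have p: "p \<in> points M" using chart_subset[OF t at(1)] at by auto
  have v: "coord_vec M c p w \<in> tangent_space M p" by (rule coord_vec_in_tangent_space[OF M c])
  have "local_form M (pullback M N f \<beta>) c (snd c p) w = \<beta> (f p) (tangent_map M N f p (coord_vec M c p w))"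
    using t at by (simp add: local_form_def pullback_def)
  also have "\<dots> = local_form N \<beta> d (snd d (f p)) (tangent_map M N f p (coord_vec M c p w) d)"
    by (rule form_eq_local_form[OF N d tangent_map_in_tangent_space[OF M N f p]])
  also have "tangent_map M N f p (coord_vec M c p w) d =
      coord_deriv f c d p w"
    using tangent_map_chart[OF M f c v d] by (simp add: coord_vec_same[OF M c])
  finally show ?thesis .
qed

text \<open>In coordinates the pullback is a sum of products of derivatives of the map with
  coefficients of the form, so it is smooth.\<close>

lemma one_form_pullback:
  assumes M: "smooth_manifold M" and N: "smooth_manifold N" and f: "smooth_map M N f" and \<beta>: "one_form N \<beta>"
  shows "one_form M (pullback M N f \<beta>)"
proof -
  have t: "topological_manifold M" "topological_manifold N" using M N by (auto simp: smooth_manifold_topological)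
  have "pullback M N f \<beta> p (\<lambda>c. a *\<^sub>R v c + b *\<^sub>R w c) = a * pullback M N f \<beta> p v + b * pullback M N f \<beta> p w"
    if p: "p \<in> points M" for p v w a b
    unfolding pullback_def tangent_map_linear[OF M f p]
    by (intro one_form_linear[OF \<beta>] smooth_map_in_points[OF f p] tangent_map_in_tangent_space[OF M N f p])
  moreover have "smooth_on (snd c ` fst c) (\<lambda>x. local_form M (pullback M N f \<beta>) c x w)"
    if c: "c \<in> atlas M" for c w
  proof (rule smooth_on_local)
    fix x assume "x \<in> snd c ` fst c"
    then obtain p where p: "x = snd c p" "p \<in> fst c" by auto
    then have "f p \<in> points N" using chart_subset[OF t(1) c] smooth_map_in_points[OF f] by auto
    from chart_at_in[OF t(2) this] obtain d where d: "d \<in> atlas N" "f p \<in> fst d"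
      unfolding charts_at_iff by blast
    define V where "V = snd c ` {p \<in> fst c. f p \<in> fst d}"
    define Y where "Y = snd d \<circ> f \<circ> chart_inv c"
    have V: "open V" "x \<in> V"
      using smooth_map_domain_open[OF t smooth_map_continuous[OF f] c chart_openin[OF t(2) d(1)]] p d
      by (auto simp: V_def)
    have Y: "smooth_on V Y" unfolding V_def Y_def by (rule smooth_map_smooth_on[OF f c d(1)])
    have YV: "Y ` V \<subseteq> snd d ` fst d" using t c by (auto simp: V_def Y_def)
    have "local_form M (pullback M N f \<beta>) c y w =
        (\<Sum>b\<in>Basis. (frechet_derivative Y (at y) w \<bullet> b) * local_form N \<beta> d (Y y) b)" if y: "y \<in> V" for y
    proof -
      obtain q where q: "y = snd c q" "q \<in> fst c" "f q \<in> fst d" using y by (auto simp: V_def)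
      have Yy: "Y y = snd d (f q)" using q t c by (simp add: Y_def)
      have "local_form M (pullback M N f \<beta>) c y w = local_form N \<beta> d (Y y) (frechet_derivative Y (at y) w)"
        using local_form_pullback[OF M N f, of c q d \<beta> w] q c d unfolding Yy
        by (simp add: charts_at_iff Y_def)
      also have "\<dots> = (\<Sum>b\<in>Basis. (frechet_derivative Y (at y) w \<bullet> b) * local_form N \<beta> d (Y y) b)"
        by (rule local_form_Basis_sum[OF N \<beta> d(1)]) (use YV y in auto)
      finally show ?thesis .
    qed
    moreover have "smooth_on V (\<lambda>y. \<Sum>b\<in>Basis. (frechet_derivative Y (at y) w \<bullet> b) * local_form N \<beta> d (Y y) b)"
      using smooth_on_compose[OF V(1) Y local_form_smooth_on[OF \<beta> d(1)] YV]
      by (intro smooth_on_sum smooth_on_mult V(1) smooth_on_bilinear[OF bounded_bilinear_inner]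
          smooth_on_frechet_derivative Y smooth_on_const) (simp add: o_def)
    ultimately show "\<exists>V g. open V \<and> x \<in> V \<and> smooth_on V g \<and> (\<forall>y\<in>V. local_form M (pullback M N f \<beta>) c y w = g y)"
      using V by blast
  qed
  ultimately show ?thesis by (simp add: one_form_def)
qed

lemma local_form_derivative_Basis_sum:
  fixes M :: "('p, 'e::euclidean_space, 'z) charted_space_scheme"
  assumes M: "smooth_manifold M" and \<beta>: "one_form M \<beta>" and c: "c \<in> atlas M" "x \<in> snd c ` fst c"
  shows "frechet_derivative (\<lambda>z. local_form M \<beta> c z u) (at x) h =
    (\<Sum>b\<in>Basis. (u \<bullet> b) * frechet_derivative (\<lambda>z. local_form M \<beta> c z b) (at x) h)"
proof -
  have "((\<lambda>z. \<Sum>b\<in>Basis. (u \<bullet> b) * local_form M \<beta> c z b) has_derivative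
      (\<lambda>h. \<Sum>b\<in>Basis. (u \<bullet> b) * frechet_derivative (\<lambda>z. local_form M \<beta> c z b) (at x) h)) (at x)"
    by (intro has_derivative_sum has_derivative_mult_right smooth_on_has_derivative[OF local_form_smooth_on[OF \<beta> c(1)] c(2)])
  then have "((\<lambda>z. local_form M \<beta> c z u) has_derivative
      (\<lambda>h. \<Sum>b\<in>Basis. (u \<bullet> b) * frechet_derivative (\<lambda>z. local_form M \<beta> c z b) (at x) h)) (at x)"
    by (rule has_derivative_transform_within_open
        [OF _ chart_open_image[OF smooth_manifold_topological[OF M] c(1)] c(2) local_form_Basis_sum[OF M \<beta> c(1), symmetric]])
  from frechet_derivative_at[OF this] show ?thesis by (metis (no_types))
qed

section \<open>Locally defined potentials and first homology\<close>

definition chain_eval :: "('b \<Rightarrow> real) \<Rightarrow> ('b \<Rightarrow>\<^sub>0 int) \<Rightarrow> real" where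
  "chain_eval g c = (\<Sum>s\<in>Poly_Mapping.keys c. of_int (Poly_Mapping.lookup c s) * g s)"

lemma chain_eval_superset:
  assumes "finite A" "Poly_Mapping.keys c \<subseteq> A"
  shows "chain_eval g c = (\<Sum>s\<in>A. of_int (Poly_Mapping.lookup c s) * g s)"
  unfolding chain_eval_def
  by (rule sum.mono_neutral_left) (use assms in \<open>auto simp: in_keys_iff\<close>)

lemma chain_eval_diff: "chain_eval g (a - b) = chain_eval g a - chain_eval g b"
proof -
  let ?A = "Poly_Mapping.keys a \<union> Poly_Mapping.keys b"
  have "Poly_Mapping.keys (a - b) \<subseteq> ?A" by (rule keys_diff)
  then have "chain_eval g (a - b) = (\<Sum>s\<in>?A. of_int (Poly_Mapping.lookup (a - b) s) * g s)"
    by (intro chain_eval_superset) auto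
  also have "\<dots> = (\<Sum>s\<in>?A. of_int (Poly_Mapping.lookup a s) * g s) - (\<Sum>s\<in>?A. of_int (Poly_Mapping.lookup b s) * g s)"
    by (simp add: lookup_minus algebra_simps flip: sum_subtractf)
  finally show ?thesis
    using chain_eval_superset[of ?A a g] chain_eval_superset[of ?A b g] by simp
qed

lemma chain_eval_0 [simp]: "chain_eval g 0 = 0"
  by (simp add: chain_eval_def)

lemma chain_eval_minus: "chain_eval g (- a) = - chain_eval g a"
  using chain_eval_diff[of g 0 a] by simp

lemma chain_eval_add: "chain_eval g (a + b) = chain_eval g a + chain_eval g b"
  using chain_eval_diff[of g a "- b"] by (simp add: chain_eval_minus)

lemma chain_eval_of [simp]: "chain_eval g (frag_of s) = g s"
  by (simp add: chain_eval_def)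

abbreviation simplex_vertex :: "nat \<Rightarrow> nat \<Rightarrow> real" where
  "simplex_vertex j \<equiv> (\<lambda>i. if i = j then 1 else 0)"

definition point_simplex :: "'a \<Rightarrow> (nat \<Rightarrow> real) \<Rightarrow> 'a" where
  "point_simplex x = restrict (\<lambda>_. x) (standard_simplex 0)"

definition path_simplex :: "(real \<Rightarrow> 'a) \<Rightarrow> (nat \<Rightarrow> real) \<Rightarrow> 'a" where
  "path_simplex g = restrict (\<lambda>l. g (l 1)) (standard_simplex 1)"

lemma chain_boundary_1_of:
  "chain_boundary 1 (frag_of s) = frag_of (point_simplex (s (simplex_vertex 1))) - frag_of (point_simplex (s (simplex_vertex 0)))"
proof -
  have "simplical_face 0 (simplex_vertex 0) = (simplex_vertex 1 :: nat \<Rightarrow> real)"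
    "simplical_face (Suc 0) (simplex_vertex 0) = (simplex_vertex 0 :: nat \<Rightarrow> real)"
    by (auto simp: simplical_face_def fun_eq_iff)
  then have "singular_face 1 0 s = point_simplex (s (simplex_vertex 1))"
    "singular_face 1 1 s = point_simplex (s (simplex_vertex 0))"
    unfolding singular_face_def point_simplex_def by (simp_all add: standard_simplex_0 cong: restrict_cong)
  then show ?thesis
    by (simp add: chain_boundary_of)
qed

lemma singular_simplex_path:
  assumes "pathin X g" "g ` {0..1} \<subseteq> U"
  shows "singular_simplex 1 X (path_simplex g)" "path_simplex g ` standard_simplex 1 \<subseteq> U"
    "path_simplex g (simplex_vertex 0) = g 0" "path_simplex g (simplex_vertex 1) = g 1"
proof -
  have "continuous_map (subtopology (powertop_real UNIV) (standard_simplex 1)) euclideanreal (\<lambda>l. l 1)"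
    by (intro continuous_map_from_subtopology continuous_map_product_projection) simp
  then have "continuous_map (subtopology (powertop_real UNIV) (standard_simplex 1)) (top_of_set {0..1}) (\<lambda>l. l 1)"
    by (auto simp: continuous_map_in_subtopology standard_simplex_def)
  from continuous_map_compose[OF this assms(1)[unfolded pathin_def]]
  have "continuous_map (subtopology (powertop_real UNIV) (standard_simplex 1)) X (path_simplex g)"
    by (rule continuous_map_eq) (simp add: path_simplex_def)
  then show "singular_simplex 1 X (path_simplex g)"
    by (simp add: singular_simplex_def path_simplex_def)
  show "path_simplex g ` standard_simplex 1 \<subseteq> U"
    using assms(2) by (auto simp: path_simplex_def standard_simplex_def)
  have "simplex_vertex 0 \<in> standard_simplex 1" "simplex_vertex 1 \<in> standard_simplex 1" by simp_all
  then show "path_simplex g (simplex_vertex 0) = g 0" "path_simplex g (simplex_vertex 1) = g 1"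
    by (simp_all add: path_simplex_def)
qed

lemma singular_subdivision_funpow_chain:
  "singular_chain p X c \<Longrightarrow> singular_chain p X ((singular_subdivision p ^^ n) c)"
  by (induction n) (auto intro: singular_chain_singular_subdivision)

lemma chain_boundary_singular_subdivision_funpow:
  assumes "singular_chain (Suc p) X c"
  shows "chain_boundary (Suc p) ((singular_subdivision (Suc p) ^^ n) c) = (singular_subdivision p ^^ n) (chain_boundary (Suc p) c)"
  using assms
  by (induction n)
    (auto simp: chain_boundary_singular_subdivision[OF singular_subdivision_funpow_chain])

text \<open>The model case is the family of local primitives \<open>f i\<close> of a closed 1-form. The differences
  \<open>f i - f j\<close>, being locally constant, are a Cech 1-cocycle with real coefficients.\<close>

locale local_potentials =
  fixes X :: "'a topology" and I :: "'i set" and U :: "'i \<Rightarrow> 'a set" and f :: "'i \<Rightarrow> 'a \<Rightarrow> real"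
  assumes open_cover: "\<And>i. i \<in> I \<Longrightarrow> openin X (U i)" "topspace X \<subseteq> (\<Union>i\<in>I. U i)"
    and path_connected_cover: "\<And>i. i \<in> I \<Longrightarrow> path_connectedin X (U i)"
    and difference_constant: "\<And>i j K x y. \<lbrakk>i \<in> I; j \<in> I; connectedin X K; K \<subseteq> U i \<inter> U j; x \<in> K; y \<in> K\<rbrakk> \<Longrightarrow>
       f i y - f i x = f j y - f j x"
begin

definition small_chain :: "nat \<Rightarrow> 'a chain \<Rightarrow> bool" where
  "small_chain p c \<longleftrightarrow>
    Poly_Mapping.keys c \<subseteq> {s. singular_simplex p X s \<and> (\<exists>i\<in>I. s ` standard_simplex p \<subseteq> U i)}"

text \<open>The choice of the potential does not matter, since the image of a simplex is connected (\<open>increment_eq\<close>).\<close>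

definition increment :: "((nat \<Rightarrow> real) \<Rightarrow> 'a) \<Rightarrow> real" where
  "increment s = (let i = SOME i. i \<in> I \<and> s ` standard_simplex 1 \<subseteq> U i
     in f i (s (simplex_vertex 1)) - f i (s (simplex_vertex 0)))"

lemma increment_eq:
  assumes s: "singular_simplex 1 X s" and i: "i \<in> I" "s ` standard_simplex 1 \<subseteq> U i"
  shows "increment s = f i (s (simplex_vertex 1)) - f i (s (simplex_vertex 0))"
proof -
  define j where "j = (SOME i. i \<in> I \<and> s ` standard_simplex 1 \<subseteq> U i)"
  have "j \<in> I \<and> s ` standard_simplex 1 \<subseteq> U j"
    unfolding j_def by (rule someI_ex) (use i in auto)
  moreover have "connectedin X (s ` standard_simplex 1)"
  proof (rule connectedin_continuous_map_image)
    show "continuous_map (subtopology (powertop_real UNIV) (standard_simplex 1)) X s"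
      using s by (simp add: singular_simplex_def)
    show "connectedin (subtopology (powertop_real UNIV) (standard_simplex 1)) (standard_simplex 1)"
      using connectedin_standard_simplex by (simp add: connectedin_subtopology)
  qed
  moreover have "s (simplex_vertex 0) \<in> s ` standard_simplex 1" "s (simplex_vertex 1) \<in> s ` standard_simplex 1"
    by (intro imageI; simp)+
  ultimately show ?thesis
    using difference_constant[of j i "s ` standard_simplex 1"] i unfolding increment_def Let_def j_def[symmetric]
    by blast
qed

lemma small_chain_in: "i \<in> I \<Longrightarrow> singular_chain p (subtopology X (U i)) c \<Longrightarrow> small_chain p c"
  by (auto simp: small_chain_def singular_chain_def subset_iff singular_simplex_subtopology)

lemma small_chain_singular: "small_chain p c \<Longrightarrow> singular_chain p X c"
  by (auto simp: small_chain_def singular_chain_def)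

lemma small_chain_diff: "small_chain p a \<Longrightarrow> small_chain p b \<Longrightarrow> small_chain p (a - b)"
  unfolding small_chain_def by (meson Un_least keys_diff order_trans)

lemma small_chain_minus: "small_chain p (- a) \<longleftrightarrow> small_chain p a"
  by (simp add: small_chain_def)

lemma small_chain_add: "small_chain p a \<Longrightarrow> small_chain p b \<Longrightarrow> small_chain p (a + b)"
  using small_chain_diff[of p a "- b"] by (simp add: small_chain_minus)

lemma small_chain_0 [simp]: "small_chain p 0"
  by (simp add: small_chain_def)

text \<open>Inside one set of the cover the increments are differences of values of one function, so they only see
  the boundary of a chain. Hence subdivision does not change the total increment, and the boundary of a small
  2-chain has total increment 0.\<close>

lemma increment_chain_in:
  assumes i: "i \<in> I" and c: "singular_chain 1 (subtopology X (U i)) c"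
  shows "chain_eval increment c = chain_eval (\<lambda>t. f i (t (simplex_vertex 0))) (chain_boundary 1 c)"
  using c unfolding singular_chain_def
proof (induction rule: frag_induction)
  case (one s)
  then have "singular_simplex 1 X s" "s ` standard_simplex 1 \<subseteq> U i"
    by (simp_all add: singular_simplex_subtopology)
  then show ?case
    unfolding chain_boundary_1_of chain_eval_diff chain_eval_of
    by (simp add: increment_eq[OF _ i] point_simplex_def standard_simplex_0)
qed (simp_all add: chain_eval_diff chain_boundary_diff)

lemma increment_subdivision:
  assumes "small_chain 1 c"
  shows "chain_eval increment (singular_subdivision 1 c) = chain_eval increment c \<and>
    small_chain 1 (singular_subdivision 1 c)"
  using assms unfolding small_chain_def[of 1 c]
proof (induction rule: frag_induction)
  case (one s)
  then obtain i where i: "i \<in> I" "singular_simplex 1 (subtopology X (U i)) s"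
    by (auto simp: singular_simplex_subtopology)
  then have s: "singular_chain 1 (subtopology X (U i)) (frag_of s)"
    by (simp add: singular_chain_of)
  note Ss = singular_chain_singular_subdivision[OF s]
  have "chain_boundary 1 (singular_subdivision 1 (frag_of s)) = chain_boundary 1 (frag_of s)"
    using chain_boundary_singular_subdivision[OF s] singular_subdivision_zero[of _ "chain_boundary 1 (frag_of s)"]
      singular_chain_boundary[OF s] by simp
  then show ?case
    using increment_chain_in[OF i(1) s] increment_chain_in[OF i(1) Ss] small_chain_in[OF i(1) Ss] by simp
qed (simp_all add: chain_eval_diff singular_subdivision_diff small_chain_diff)

lemma increment_subdivision_funpow:
  "small_chain 1 c \<Longrightarrow> chain_eval increment ((singular_subdivision 1 ^^ n) c) = chain_eval increment c \<and>
    small_chain 1 ((singular_subdivision 1 ^^ n) c)"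
proof (induction n)
  case (Suc n)
  then show ?case using increment_subdivision[of "(singular_subdivision 1 ^^ n) c"] by simp
qed simp

lemma increment_boundary_small:
  assumes "small_chain 2 e" shows "chain_eval increment (chain_boundary 2 e) = 0"
  using assms unfolding small_chain_def
proof (induction rule: frag_induction)
  case (one s)
  then obtain i where i: "i \<in> I" "singular_simplex 2 (subtopology X (U i)) s"
    by (auto simp: singular_simplex_subtopology)
  then have s: "singular_chain (Suc 1) (subtopology X (U i)) (frag_of s)"
    by (simp add: singular_chain_of numeral_2_eq_2)
  from increment_chain_in[OF i(1) singular_chain_boundary_alt[OF s]] chain_boundary_boundary_alt[OF s]
  show ?case by (simp add: numeral_2_eq_2)
qed (simp_all add: chain_eval_diff chain_boundary_diff)

text \<open>After sufficiently many subdivisions a bounding chain of a cycle is small, and subdivision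
  does not change the total increment.\<close>

lemma increment_boundary:
  assumes c: "small_chain 1 c" and b: "singular_relboundary 1 X {} c"
  shows "chain_eval increment c = 0"
proof -
  obtain e where e: "singular_chain (Suc 1) X e" "chain_boundary (Suc 1) e = c"
    using b by (auto simp: singular_boundary)
  obtain n where n: "\<And>m s. \<lbrakk>n \<le> m; s \<in> Poly_Mapping.keys ((singular_subdivision (Suc 1) ^^ m) e)\<rbrakk>
      \<Longrightarrow> \<exists>V\<in>U ` I. s \<in> standard_simplex (Suc 1) \<rightarrow> V"
    using sufficient_iterated_singular_subdivision_exists[of "U ` I" X "Suc 1" e] open_cover e(1) by blast
  let ?e = "(singular_subdivision (Suc 1) ^^ n) e"
  have "singular_chain (Suc 1) X ?e"
    using e(1) by (rule singular_subdivision_funpow_chain)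
  then have "small_chain 2 ?e"
    using n[OF order_refl] unfolding small_chain_def singular_chain_def numeral_2_eq_2 by fastforce
  from increment_boundary_small[OF this]
  have "chain_eval increment ((singular_subdivision 1 ^^ n) c) = 0"
    using chain_boundary_singular_subdivision_funpow[OF e(1), of n] e(2) by (simp add: numeral_2_eq_2)
  then show ?thesis using increment_subdivision_funpow[OF c, of n] by simp
qed

definition joins :: "'a chain \<Rightarrow> 'a \<Rightarrow> 'a \<Rightarrow> bool" where
  "joins c x y \<longleftrightarrow> small_chain 1 c \<and> chain_boundary 1 c = frag_of (point_simplex y) - frag_of (point_simplex x)"

text \<open>The global potential at \<open>x\<close> is the increment along a small chain from a base point, which is chosen once for
  all points that small chains join to \<open>x\<close>. Every cycle being a boundary, this is independent of the chain.\<close>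

theorem global_potential:
  assumes H: "\<And>c. singular_relcycle 1 X {} c \<Longrightarrow> singular_relboundary 1 X {} c"
  shows "\<exists>F. \<forall>i\<in>I. \<forall>x\<in>U i. \<forall>y\<in>U i. F y - F x = f i y - f i x"
proof -
  define base where "base x = (SOME z. \<exists>c. joins c z x)" for x
  define F where "F x = chain_eval increment (SOME c. joins c (base x) x)" for x
  have refl: "joins 0 x x" for x by (simp add: joins_def)
  have trans: "joins (c + d) x z" if "joins c x y" "joins d y z" for c d x y z
    using that by (simp add: joins_def small_chain_add chain_boundary_add)
  have sym: "joins (- c) y x" if "joins c x y" for c x y
    using that by (simp add: joins_def small_chain_minus chain_boundary_minus)
  have F: "F x = chain_eval increment c" if c: "joins c (base x) x" for c x
  proof -
    define d where "d = (SOME c. joins c (base x) x)"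
    have d: "joins d (base x) x" unfolding d_def using c by (rule someI)
    then have cyc: "small_chain 1 (d - c)" "chain_boundary 1 (d - c) = 0"
      using c by (simp_all add: joins_def small_chain_diff chain_boundary_diff)
    then have "chain_eval increment (d - c) = 0"
      by (intro increment_boundary H) (simp_all add: singular_cycle small_chain_singular)
    then show ?thesis by (simp add: F_def chain_eval_diff flip: d_def)
  qed
  have "F y - F x = f i y - f i x" if i: "i \<in> I" and xy: "x \<in> U i" "y \<in> U i" for i x y
  proof -
    obtain g where g: "pathin X g" "g ` {0..1} \<subseteq> U i" "g 0 = x" "g 1 = y"
      using path_connected_cover[OF i] xy unfolding path_connectedin by (metis image_subset_iff_funcset)
    note s = singular_simplex_path[OF g(1,2)]
    define a where "a = frag_of (path_simplex g)"
    have a: "joins a x y"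
      unfolding joins_def a_def chain_boundary_1_of s(3,4) g(3,4)
      using s(1,2) i by (auto simp: small_chain_def)
    have inc: "chain_eval increment a = f i y - f i x"
      unfolding a_def by (simp add: increment_eq[OF s(1) i s(2)] s(3,4)[simplified] g)
    have "(\<lambda>z. \<exists>c. joins c z x) = (\<lambda>z. \<exists>c. joins c z y)"
      using a trans sym by blast
    then have base: "base x = base y" by (simp add: base_def)
    have "\<exists>z c. joins c z x" using refl by blast
    then have "\<exists>c. joins c (base x) x" unfolding base_def by (rule someI_ex)
    then obtain c where c: "joins c (base x) x" by blast
    from F[OF this] F[of "c + a" y] trans[OF c a] inc base show ?thesis
      by (simp add: chain_eval_add)
  qed
  then show ?thesis by blast
qed

end

lemma genus_0_cycle_bounds:
  assumes "has_genus X 0" "singular_relcycle 1 X {} c"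
  shows "singular_relboundary 1 X {} c"
proof -
  let ?G = "homology_group 1 X"
  obtain h where h: "h \<in> iso ?G (free_Abelian_group {..<2 * 0 :: nat})"
    using assms(1) by (auto simp: has_genus_def is_iso_def)
  have "carrier (free_Abelian_group {..<2 * 0 :: nat}) = {0}"
    by (auto simp: free_Abelian_group_def)
  then have bij: "bij_betw h (carrier ?G) {0}"
    using h by (auto simp: iso_def)
  have c: "homologous_rel_set 1 X {} c \<in> carrier ?G"
    using carrier_relative_homology_group[of 1 X "{}"] assms(2) by auto
  have b: "singular_relboundary_set 1 X {} \<in> carrier ?G"
    using monoid.one_closed[OF group.is_monoid[OF group_relative_homology_group[of 1 X "{}"]]]
      one_relative_homology_group[of 1 X "{}"] by simp
  have "homologous_rel_set 1 X {} c = singular_relboundary_set 1 X {}"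
    using bij_betwE[OF bij, rule_format, OF c] bij_betwE[OF bij, rule_format, OF b]
    by (intro inj_onD[OF bij_betw_imp_inj_on[OF bij] _ c b]) (simp only: singleton_iff)
  then show ?thesis by (simp only: homologous_rel_set_eq_relboundary)
qed

section \<open>Closed 1-forms and their primitives\<close>

definition primitive_on ::
    "('p, 'e::euclidean_space, 'z) charted_space_scheme \<Rightarrow> ('p, 'e) form1 \<Rightarrow> 'p set \<Rightarrow> ('p \<Rightarrow> real) \<Rightarrow> bool" where
  "primitive_on M \<beta> W F \<longleftrightarrow> openin (mtop M) W \<and>
     (\<forall>q\<in>W. \<forall>c\<in>charts_at M q. ((F \<circ> chart_inv c) has_derivative local_form M \<beta> c (snd c q)) (at (snd c q)))"

definition locally_exact ::
    "('p, 'e::euclidean_space, 'z) charted_space_scheme \<Rightarrow> ('p, 'e) form1 \<Rightarrow> bool" where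
  "locally_exact M \<beta> \<longleftrightarrow> (\<forall>p\<in>points M. \<exists>W F. p \<in> W \<and> primitive_on M \<beta> W F)"

text \<open>Closedness of a form refers to one chart at each point. It carries over to any other chart, because
  the terms with second derivatives of the coordinate change cancel by symmetry.\<close>

lemma closed_form_in_chart:
  fixes M :: "('p, 'e::euclidean_space, 'z) charted_space_scheme"
  assumes M: "smooth_manifold M" and \<beta>: "one_form M \<beta>" and cl: "closed_form M \<beta>" and d: "d \<in> charts_at M q"
  shows "frechet_derivative (\<lambda>y. local_form M \<beta> d y w) (at (snd d q)) v =
    frechet_derivative (\<lambda>y. local_form M \<beta> d y v) (at (snd d q)) w"
proof -
  have t: "topological_manifold M" using M by (simp add: smooth_manifold_topological)
  have q: "q \<in> points M" by (rule charts_at_imp_point[OF t d])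
  define c where "c = chart_at M q"
  have c: "c \<in> charts_at M q" using q t by (simp add: c_def chart_at_in)
  have at: "c \<in> atlas M" "d \<in> atlas M" "q \<in> fst c" "q \<in> fst d" using c d by (auto simp: charts_at_iff)
  define x where "x = snd d q"
  define \<tau> where "\<tau> = snd c \<circ> chart_inv d"
  define V where "V = snd d ` (fst d \<inter> fst c)"
  define B where "B u z = local_form M \<beta> c z u" for u z
  define T where "T u y = frechet_derivative \<tau> (at y) u" for u y
  have V: "open V" "x \<in> V"
    using chart_image_open[OF t at(2) chart_openin[OF t at(1)]] at by (auto simp: V_def x_def)
  have \<tau>: "smooth_on V \<tau>" unfolding V_def \<tau>_def by (rule transition_smooth_on[OF M at(2,1)])
  have \<tau>x: "\<tau> x = snd c q" using t at by (simp add: \<tau>_def x_def)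
  have B: "(B u has_derivative frechet_derivative (B u) (at (\<tau> x))) (at (\<tau> x))" for u
    using smooth_on_has_derivative[OF local_form_smooth_on[OF \<beta> at(1)]] at unfolding B_def \<tau>x by auto
  have T: "(T u has_derivative frechet_derivative (T u) (at x)) (at x)" for u
    unfolding T_def by (rule smooth_on_has_derivative[OF smooth_on_frechet_derivative[OF \<tau>] V(2)])
  have B_sum: "frechet_derivative (B u) (at (\<tau> x)) h =
      (\<Sum>b\<in>Basis. (u \<bullet> b) * frechet_derivative (B b) (at (\<tau> x)) h)" for u h
  proof -
    have "B u = (\<lambda>z. local_form M \<beta> c z u)" for u by (simp add: B_def fun_eq_iff)
    then show ?thesis
      using local_form_derivative_Basis_sum[OF M \<beta> at(1), of "\<tau> x" u h] at by (simp add: \<tau>x)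
  qed
  have D: "frechet_derivative (\<lambda>y. local_form M \<beta> d y w) (at x) v =
      (\<Sum>b\<in>Basis. (frechet_derivative (T w) (at x) v \<bullet> b) * B b (\<tau> x))
      + frechet_derivative (B (T w x)) (at (\<tau> x)) (T v x)" for v w
  proof -
    have "((\<lambda>y. \<Sum>b\<in>Basis. (T w y \<bullet> b) * B b (\<tau> y)) has_derivative
        (\<lambda>h. \<Sum>b\<in>Basis. (T w x \<bullet> b) * frechet_derivative (B b) (at (\<tau> x)) (T h x)
           + (frechet_derivative (T w) (at x) h \<bullet> b) * B b (\<tau> x))) (at x)"
    proof (intro has_derivative_sum has_derivative_mult has_derivative_inner_left T)
      fix b :: 'e
      show "((\<lambda>y. B b (\<tau> y)) has_derivative (\<lambda>h. frechet_derivative (B b) (at (\<tau> x)) (T h x))) (at x)"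
        using diff_chain_at[OF smooth_on_has_derivative[OF \<tau> V(2)] B] by (simp add: o_def T_def)
    qed
    then have "((\<lambda>y. local_form M \<beta> d y w) has_derivative
        (\<lambda>h. \<Sum>b\<in>Basis. (T w x \<bullet> b) * frechet_derivative (B b) (at (\<tau> x)) (T h x)
           + (frechet_derivative (T w) (at x) h \<bullet> b) * B b (\<tau> x))) (at x)"
    proof (rule has_derivative_transform_within_open[OF _ V])
      fix y assume "y \<in> V"
      then obtain p where p: "y = snd d p" "p \<in> fst d" "p \<in> fst c" by (auto simp: V_def)
      have "\<tau> y = snd c p" using p t at by (simp add: \<tau>_def)
      moreover have "local_form M \<beta> d y w = local_form M \<beta> c (snd c p) (T w y)"
        using local_form_change_chart[OF M, of d p c] p at by (simp add: charts_at_iff T_def \<tau>_def)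
      moreover have "\<dots> = (\<Sum>b\<in>Basis. (T w y \<bullet> b) * B b (snd c p))"
        unfolding B_def by (rule local_form_Basis_sum[OF M \<beta> at(1)]) (use p in auto)
      ultimately show "(\<Sum>b\<in>Basis. (T w y \<bullet> b) * B b (\<tau> y)) = local_form M \<beta> d y w" by simp
    qed
    from frechet_derivative_at[OF this, symmetric] show ?thesis
      unfolding B_sum[of "T w x"] by (simp add: sum.distrib)
  qed
  have sym: "frechet_derivative (T w) (at x) v = frechet_derivative (T v) (at x) w"
    unfolding T_def by (rule second_derivative_symmetric[OF V \<tau>])
  have "ext_deriv M \<beta> q (coord_vec M c q (T v x)) (coord_vec M c q (T w x)) = 0"
    using cl q coord_vec_in_tangent_space[OF M c] by (simp add: closed_form_def)
  then have "frechet_derivative (B (T w x)) (at (\<tau> x)) (T v x) = frechet_derivative (B (T v x)) (at (\<tau> x)) (T w x)"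
    unfolding ext_deriv_def Let_def c_def[symmetric] coord_vec_same[OF M c] \<tau>x B_def by simp
  then show ?thesis unfolding x_def[symmetric] D sym by simp
qed

lemma closed_form_locally_exact:
  assumes M: "smooth_manifold M" and \<beta>: "one_form M \<beta>" and cl: "closed_form M \<beta>"
  shows "locally_exact M \<beta>"
  unfolding locally_exact_def
proof
  fix p assume p: "p \<in> points M"
  have t: "topological_manifold M" using M by (simp add: smooth_manifold_topological)
  define c where "c = chart_at M p"
  have c: "c \<in> atlas M" "p \<in> fst c" using chart_at_in[OF t p] unfolding c_def charts_at_iff by blast+
  obtain r where r: "r > 0" "ball (snd c p) r \<subseteq> snd c ` fst c"
    using chart_open_image[OF t c(1)] c(2) openE by blast
  have in_chart: "\<exists>q. c \<in> charts_at M q \<and> x = snd c q" if "x \<in> ball (snd c p) r" for x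
    using that r(2) c(1) by (auto simp: charts_at_iff)
  obtain F where F: "\<And>x. x \<in> ball (snd c p) r \<Longrightarrow> (F has_derivative local_form M \<beta> c x) (at x)"
  proof -
    have "\<exists>F. \<forall>x\<in>ball (snd c p) r. (F has_derivative local_form M \<beta> c x) (at x)"
    proof (rule Poincare_lemma_ball)
      show "linear (local_form M \<beta> c x)" if x: "x \<in> ball (snd c p) r" for x
      proof -
        obtain q where q: "c \<in> charts_at M q" "x = snd c q" using in_chart[OF x] by blast
        show ?thesis unfolding q(2) by (rule local_form_linear[OF M \<beta> q(1)])
      qed
      show "Ck_on 1 (ball (snd c p) r) (\<lambda>x. local_form M \<beta> c x w)" for w
        using local_form_smooth_on[OF \<beta> c(1)] Ck_on_subset[OF _ r(2)] unfolding smooth_on_def by blast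
      show "frechet_derivative (\<lambda>y. local_form M \<beta> c y w) (at x) v =
          frechet_derivative (\<lambda>y. local_form M \<beta> c y v) (at x) w" if x: "x \<in> ball (snd c p) r" for x v w
      proof -
        obtain q where q: "c \<in> charts_at M q" "x = snd c q" using in_chart[OF x] by blast
        show ?thesis unfolding q(2) by (rule closed_form_in_chart[OF M \<beta> cl q(1)])
      qed
    qed
    then show ?thesis using that by blast
  qed
  define W where "W = {q \<in> fst c. snd c q \<in> ball (snd c p) r}"
  have "primitive_on M \<beta> W (F \<circ> snd c)"
    unfolding primitive_on_def
  proof (intro conjI ballI)
    show "openin (mtop M) W" unfolding W_def by (rule chart_preimage_openin[OF t c(1)]) simp
    fix q d assume q: "q \<in> W" and d: "d \<in> charts_at M q"
    have cq: "c \<in> charts_at M q" using q c(1) by (simp add: W_def charts_at_iff)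
    have "(F has_derivative local_form M \<beta> c (snd c q)) (at (snd c q))"
      using F q by (simp add: W_def)
    then have "((F \<circ> snd c) \<circ> chart_inv c has_derivative local_form M \<beta> c (snd c q)) (at (snd c q))"
      by (rule has_derivative_transform_within_open[OF _ chart_open_image[OF t c(1)]]) (use q in \<open>auto simp: W_def\<close>)
    note deriv = has_derivative_change_source_chart[OF M cq d this]
    have "local_form M \<beta> d (snd d q) =
        local_form M \<beta> c (snd c q) \<circ> chart_change d c q"
      by (rule ext) (simp only: o_apply local_form_change_chart[OF M d cq])
    then show "((F \<circ> snd c) \<circ> chart_inv d has_derivative local_form M \<beta> d (snd d q)) (at (snd d q))"
      using deriv by simp
  qed
  moreover have "p \<in> W" using r c by (simp add: W_def)
  ultimately show "\<exists>W F. p \<in> W \<and> primitive_on M \<beta> W F" by blast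
qed

text \<open>Pulling back the primitives themselves avoids the exterior derivative of the pullback.\<close>

lemma locally_exact_pullback:
  assumes M: "smooth_manifold M" and N: "smooth_manifold N" and f: "smooth_map M N f" and \<beta>: "locally_exact N \<beta>"
  shows "locally_exact M (pullback M N f \<beta>)"
  unfolding locally_exact_def
proof
  have t: "topological_manifold M" "topological_manifold N" using M N by (auto simp: smooth_manifold_topological)
  fix p assume p: "p \<in> points M"
  obtain W F where W: "f p \<in> W" "primitive_on N \<beta> W F"
    using \<beta> smooth_map_in_points[OF f p] by (auto simp: locally_exact_def)
  define W' where "W' = {q \<in> points M. f q \<in> W}"
  have "primitive_on M (pullback M N f \<beta>) W' (F \<circ> f)"
    unfolding primitive_on_def
  proof (intro conjI ballI)
    show "openin (mtop M) W'"
      using W(2) smooth_map_continuous[OF f] by (auto simp: W'_def primitive_on_def continuous_map_def)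
    fix q c assume q: "q \<in> W'" and c: "c \<in> charts_at M q"
    define d where "d = chart_at N (f q)"
    have d: "d \<in> charts_at N (f q)"
      unfolding d_def using q by (intro chart_at_in[OF t(2)] smooth_map_in_points[OF f]) (simp add: W'_def)
    have at: "c \<in> atlas M" "q \<in> fst c" "d \<in> atlas N" "f q \<in> fst d" using c d by (auto simp: charts_at_iff)
    define V where "V = snd c ` {p \<in> fst c. f p \<in> fst d}"
    define Y where "Y = snd d \<circ> f \<circ> chart_inv c"
    have V: "open V" "snd c q \<in> V"
      using smooth_map_domain_open[OF t smooth_map_continuous[OF f] at(1) chart_openin[OF t(2) at(3)]] at
      by (auto simp: V_def)
    have Yq: "Y (snd c q) = snd d (f q)" using t at by (simp add: Y_def)
    have FY: "((F \<circ> chart_inv d) has_derivative local_form N \<beta> d (Y (snd c q))) (at (Y (snd c q)))"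
      using W(2) q d unfolding Yq by (auto simp: primitive_on_def W'_def)
    have "((F \<circ> chart_inv d) \<circ> Y has_derivative
        (\<lambda>w. local_form N \<beta> d (Y (snd c q)) (frechet_derivative Y (at (snd c q)) w))) (at (snd c q))"
      using diff_chain_at[OF smooth_map_has_derivative[OF f c d, folded Y_def] FY] by (simp add: o_def)
    then have "((F \<circ> f) \<circ> chart_inv c has_derivative
        (\<lambda>w. local_form N \<beta> d (Y (snd c q)) (frechet_derivative Y (at (snd c q)) w))) (at (snd c q))"
      by (rule has_derivative_transform_within_open[OF _ V]) (use t at in \<open>auto simp: V_def Y_def\<close>)
    moreover have "local_form M (pullback M N f \<beta>) c (snd c q) =
        (\<lambda>w. local_form N \<beta> d (Y (snd c q)) (frechet_derivative Y (at (snd c q)) w))"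
      unfolding Yq by (rule ext) (unfold Y_def, rule local_form_pullback[OF M N f c d])
    ultimately show "((F \<circ> f) \<circ> chart_inv c has_derivative local_form M (pullback M N f \<beta>) c (snd c q)) (at (snd c q))"
      by simp
  qed
  moreover have "p \<in> W'" using p W(1) by (simp add: W'_def)
  ultimately show "\<exists>W F. p \<in> W \<and> primitive_on M (pullback M N f \<beta>) W F" by blast
qed

text \<open>In charts the difference of two primitives has derivative 0, so it is locally constant.\<close>

lemma primitive_difference_constant:
  assumes M: "smooth_manifold M" and F: "primitive_on M \<beta> V F" and G: "primitive_on M \<beta> W G"
    and K: "connectedin (mtop M) K" "K \<subseteq> V \<inter> W" and xy: "x \<in> K" "y \<in> K"
  shows "F y - F x = G y - G x"
proof -
  have t: "topological_manifold M" using M by (simp add: smooth_manifold_topological)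
  have oVW: "openin (mtop M) (V \<inter> W)" using F G by (auto simp: primitive_on_def)
  define h where "h q = F q - G q" for q
  have loc: "\<exists>N. openin (mtop M) N \<and> q \<in> N \<and> N \<subseteq> V \<inter> W \<and> (\<forall>q'\<in>N. h q' = h q)" if q: "q \<in> V \<inter> W" for q
  proof -
    have qM: "q \<in> points M" using q openin_subset[OF oVW] by auto
    define c where "c = chart_at M q"
    have c: "c \<in> atlas M" "q \<in> fst c" using chart_at_in[OF t qM] unfolding c_def charts_at_iff by blast+
    have "open (snd c ` (fst c \<inter> (V \<inter> W)))" by (rule chart_image_open[OF t c(1) oVW])
    then obtain r where r: "r > 0" "ball (snd c q) r \<subseteq> snd c ` (fst c \<inter> (V \<inter> W))"
      using c(2) q openE by blast
    have "\<exists>k. \<forall>z\<in>ball (snd c q) r. (h \<circ> chart_inv c) z = k"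
    proof (rule has_derivative_zero_constant)
      fix z assume "z \<in> ball (snd c q) r"
      then obtain q' where q': "z = snd c q'" "q' \<in> fst c" "q' \<in> V" "q' \<in> W" using r(2) by blast
      then have "c \<in> charts_at M q'" using c by (simp add: charts_at_iff)
      then have "((F \<circ> chart_inv c) has_derivative local_form M \<beta> c z) (at z)"
        "((G \<circ> chart_inv c) has_derivative local_form M \<beta> c z) (at z)"
        using F G q' by (simp_all add: primitive_on_def)
      from has_derivative_diff[OF this] show "((h \<circ> chart_inv c) has_derivative (\<lambda>_. 0)) (at z within ball (snd c q) r)"
        by (simp add: h_def o_def has_derivative_at_withinI)
    qed simp
    then obtain k where k: "\<And>z. z \<in> ball (snd c q) r \<Longrightarrow> h (chart_inv c z) = k" by auto
    define N where "N = {q' \<in> fst c. snd c q' \<in> ball (snd c q) r}"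
    have "openin (mtop M) N" unfolding N_def by (rule chart_preimage_openin[OF t c(1)]) simp
    moreover have "q \<in> N" using c r by (simp add: N_def)
    moreover have "N \<subseteq> V \<inter> W"
      using r(2) chart_in_image_iff[OF t c(1), of _ "V \<inter> W"] unfolding N_def by blast
    moreover have "h q' = k" if "q' \<in> N" for q'
      using k[of "snd c q'"] that chart_inv_left[OF t c(1)] by (simp add: N_def)
    ultimately show ?thesis by metis
  qed
  define A where "A = {q \<in> V \<inter> W. h q = h x}"
  define B where "B = {q \<in> V \<inter> W. h q \<noteq> h x}"
  have o: "openin (mtop M) {q \<in> V \<inter> W. P (h q)}" for P
  proof (subst openin_subopen, intro ballI)
    fix q assume q: "q \<in> {q \<in> V \<inter> W. P (h q)}"
    then obtain N where N: "openin (mtop M) N" "q \<in> N" "N \<subseteq> V \<inter> W" "\<forall>q'\<in>N. h q' = h q"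
      using loc[of q] by blast
    have "N \<subseteq> {q \<in> V \<inter> W. P (h q)}"
    proof
      fix q' assume "q' \<in> N"
      then have "h q' = h q" "q' \<in> V \<inter> W" using N(3,4) by blast+
      then show "q' \<in> {q \<in> V \<inter> W. P (h q)}" using q by simp
    qed
    then show "\<exists>N. openin (mtop M) N \<and> q \<in> N \<and> N \<subseteq> {q \<in> V \<inter> W. P (h q)}"
      using N(1,2) by blast
  qed
  have "openin (mtop M) A" "openin (mtop M) B"
    unfolding A_def B_def by (rule o)+
  moreover have "K \<subseteq> A \<union> B" "A \<inter> B \<inter> K = {}" using K(2) by (auto simp: A_def B_def)
  moreover have "A \<inter> K \<noteq> {}" using xy K(2) by (auto simp: A_def)
  ultimately have "B \<inter> K = {}" using K(1) unfolding connectedin by blast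
  then have "h y = h x" using xy K(2) by (auto simp: B_def)
  then show ?thesis by (simp add: h_def)
qed

lemma primitive_on_continuous:
  assumes M: "topological_manifold M" and F: "primitive_on M \<beta> W F"
  shows "continuous_map (subtopology (mtop M) W) euclideanreal F"
proof -
  have W: "openin (mtop M) W" "W \<subseteq> points M" using F openin_subset by (auto simp: primitive_on_def)
  have "openin (mtop M) {q \<in> W. F q \<in> T}" if T: "open T" for T
  proof (subst openin_subopen, intro ballI)
    fix q assume q: "q \<in> {q \<in> W. F q \<in> T}"
    define c where "c = chart_at M q"
    have c: "c \<in> atlas M" "q \<in> fst c" using chart_at_in[OF M, of q] q W unfolding c_def charts_at_iff by blast+
    define V where "V = snd c ` (fst c \<inter> W)"
    have V: "open V" unfolding V_def by (rule chart_image_open[OF M c(1) W(1)])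
    have "continuous_on V (F \<circ> chart_inv c)"
    proof (intro continuous_at_imp_continuous_on ballI)
      fix z assume "z \<in> V"
      then obtain q' where q': "z = snd c q'" "q' \<in> fst c" "q' \<in> W" by (auto simp: V_def)
      then have "c \<in> charts_at M q'" using c by (simp add: charts_at_iff)
      then show "isCont (F \<circ> chart_inv c) z"
        using F q' unfolding primitive_on_def by (blast intro: has_derivative_continuous)
    qed
    then have "open (V \<inter> (F \<circ> chart_inv c) -` T)" using V T continuous_open_preimage by blast
    note o = chart_preimage_openin[OF M c(1) this]
    have "{p \<in> fst c. snd c p \<in> V \<inter> (F \<circ> chart_inv c) -` T} \<subseteq> {q \<in> W. F q \<in> T}"
    proof
      fix p assume "p \<in> {p \<in> fst c. snd c p \<in> V \<inter> (F \<circ> chart_inv c) -` T}"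
      then have "p \<in> fst c" "snd c p \<in> V" "F (chart_inv c (snd c p)) \<in> T" by auto
      then show "p \<in> {q \<in> W. F q \<in> T}"
        using chart_in_image_iff[OF M c(1)] chart_inv_left[OF M c(1)] by (simp add: V_def)
    qed
    moreover have "q \<in> {p \<in> fst c. snd c p \<in> V \<inter> (F \<circ> chart_inv c) -` T}"
      using q c chart_inv_left[OF M c(1)] by (auto simp: V_def)
    ultimately show "\<exists>N. openin (mtop M) N \<and> q \<in> N \<and> N \<subseteq> {q \<in> W. F q \<in> T}" using o by blast
  qed
  then have "openin (subtopology (mtop M) W) {q \<in> W. F q \<in> T}" if "open T" for T
    using that by (auto simp: openin_subtopology)
  then show ?thesis using W(2) by (simp add: continuous_map_def Int_absorb1)
qed

text \<open>The local primitives fit together by \<open>global_potential\<close>, the resulting function has a maximum by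
  compactness, and its derivative vanishes there.\<close>

theorem locally_exact_zero_of_genus_0:
  assumes M: "smooth_manifold M" and cpt: "compact_space (mtop M)" and \<beta>: "locally_exact M \<beta>"
    and C: "C \<in> connected_components_of (mtop M)" and g: "has_genus (subtopology (mtop M) C) 0"
  shows "\<exists>z\<in>C. \<forall>v\<in>tangent_space M z. \<beta> z v = 0"
proof -
  have t: "topological_manifold M" using M by (simp add: smooth_manifold_topological)
  have CM: "C \<subseteq> points M" "C \<noteq> {}"
    using C connected_components_of_subset nonempty_connected_components_of by blast+
  define X where "X = subtopology (mtop M) C"
  have tX: "topspace X = C" using CM by (auto simp: X_def)
  define I where "I = {(V, F). V \<subseteq> C \<and> path_connectedin (mtop M) V \<and> primitive_on M \<beta> V F}"
  have cover: "\<exists>i\<in>I. z \<in> fst i" if z: "z \<in> C" for z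
  proof -
    have zM: "z \<in> points M" using z CM by auto
    obtain W F where W: "z \<in> W" "primitive_on M \<beta> W F" using \<beta> zM unfolding locally_exact_def by blast
    define c where "c = chart_at M z"
    have c: "c \<in> atlas M" "z \<in> fst c" using chart_at_in[OF t zM] unfolding c_def charts_at_iff by blast+
    have "openin (mtop M) W" using W(2) by (simp add: primitive_on_def)
    then obtain r where r: "r > 0" "ball (snd c z) r \<subseteq> snd c ` (fst c \<inter> W)"
      using chart_image_open[OF t c(1)] c(2) W(1) openE by (metis IntI imageI)
    define V where "V = chart_inv c ` ball (snd c z) r"
    have V_eq: "V = {q \<in> fst c. snd c q \<in> ball (snd c z) r}"
      unfolding V_def using r(2) chart_inv_left[OF t c(1)] by (auto simp: image_iff) (metis (no_types, lifting) Int_iff imageE mem_ball subsetD)+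
    have VW: "V \<subseteq> W" unfolding V_def using r(2) chart_inv_left[OF t c(1)] by auto
    have oV: "openin (mtop M) V" unfolding V_eq by (rule chart_preimage_openin[OF t c(1)]) simp
    have zV: "z \<in> V" unfolding V_eq using r c by simp
    have "path_connectedin (mtop M) V"
      unfolding V_def
    proof (rule path_connectedin_continuous_map_image[OF chart_inv_continuous[OF t c(1)]])
      show "path_connectedin (top_of_set (snd c ` fst c)) (ball (snd c z) r)"
        using r(2) convex_imp_path_connected[OF convex_ball]
        by (auto simp: path_connectedin_subtopology path_connectedin_euclidean)
    qed
    moreover from this have "V \<subseteq> C"
      using connected_components_of_maximal[OF C path_connectedin_imp_connectedin] z zV by (auto simp: disjnt_iff)
    moreover have "primitive_on M \<beta> V F" using W(2) VW oV by (auto simp: primitive_on_def)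
    ultimately show ?thesis using zV by (auto simp: I_def)
  qed
  interpret local_potentials X I fst snd
  proof
    show "openin X (fst i)" if "i \<in> I" for i
      using that by (auto simp: I_def X_def primitive_on_def openin_subtopology_Int2 openin_subtopology intro!: exI[of _ "fst i"])
    show "topspace X \<subseteq> (\<Union>i\<in>I. fst i)" using cover by (auto simp: tX)
    show "path_connectedin X (fst i)" if "i \<in> I" for i
      using that by (auto simp: I_def X_def path_connectedin_subtopology)
    show "snd i y - snd i x = snd j y - snd j x"
      if "i \<in> I" "j \<in> I" "connectedin X K" "K \<subseteq> fst i \<inter> fst j" "x \<in> K" "y \<in> K" for i j K x y
      by (rule primitive_difference_constant[OF M, of \<beta> "fst i" "snd i" "fst j" "snd j" K])
        (use that in \<open>auto simp: I_def X_def connectedin_subtopology\<close>)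
  qed
  obtain F where F: "\<And>i x y. i \<in> I \<Longrightarrow> x \<in> fst i \<Longrightarrow> y \<in> fst i \<Longrightarrow> F y - F x = snd i y - snd i x"
    using global_potential[OF genus_0_cycle_bounds[OF g[folded X_def]]] by blast
  have prim: "primitive_on M \<beta> C F"
    unfolding primitive_on_def
  proof (intro conjI ballI)
    show "openin (mtop M) C"
    proof (subst openin_subopen, intro ballI)
      fix z assume "z \<in> C"
      from cover[OF this] show "\<exists>T. openin (mtop M) T \<and> z \<in> T \<and> T \<subseteq> C"
        by (auto simp: I_def primitive_on_def)
    qed
    fix q c assume q: "q \<in> C" and c: "c \<in> charts_at M q"
    obtain V G where i: "(V, G) \<in> I" "q \<in> V" using cover[OF q] by auto
    then have V: "openin (mtop M) V" "((G \<circ> chart_inv c) has_derivative local_form M \<beta> c (snd c q)) (at (snd c q))"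
      using c by (auto simp: I_def primitive_on_def)
    have at: "c \<in> atlas M" "q \<in> fst c" using c by (auto simp: charts_at_iff)
    have "((\<lambda>z. (G \<circ> chart_inv c) z + (F q - G q)) has_derivative local_form M \<beta> c (snd c q)) (at (snd c q))"
      using has_derivative_add[OF V(2) has_derivative_const] by simp
    then show "((F \<circ> chart_inv c) has_derivative local_form M \<beta> c (snd c q)) (at (snd c q))"
    proof (rule has_derivative_transform_within_open[OF _ chart_image_open[OF t at(1) V(1)]])
      show "snd c q \<in> snd c ` (fst c \<inter> V)" using at i(2) by auto
      fix z assume "z \<in> snd c ` (fst c \<inter> V)"
      then have "chart_inv c z \<in> V" using chart_inv_left[OF t at(1)] by auto
      from F[OF i(1), of q "chart_inv c z"] this i(2)
      show "(G \<circ> chart_inv c) z + (F q - G q) = (F \<circ> chart_inv c) z" by simp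
    qed
  qed
  have "compactin (mtop M) C"
    using closedin_compact_space[OF cpt closedin_connected_components_of[OF C]] .
  then have "compact_space X" by (simp add: X_def compactin_subspace)
  then have "compactin X C" using tX by (simp add: compact_space_def)
  from image_compactin[OF this primitive_on_continuous[OF t prim, folded X_def]]
  have "compact (F ` C)" by simp
  from compact_attains_sup[OF this] CM obtain z where z: "z \<in> C" "\<And>y. y \<in> C \<Longrightarrow> F y \<le> F z" by auto
  define c where "c = chart_at M z"
  have c: "c \<in> charts_at M z" using chart_at_in[OF t] z CM by (auto simp: c_def)
  then have at: "c \<in> atlas M" "z \<in> fst c" by (auto simp: charts_at_iff)
  have "openin (mtop M) C" using prim by (simp add: primitive_on_def)
  have "local_form M \<beta> c (snd c z) = (\<lambda>v. 0)"
  proof (rule differential_zero_maxmin)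
    show "open (snd c ` (fst c \<inter> C))" by (rule chart_image_open[OF t at(1)]) fact
    show "snd c z \<in> snd c ` (fst c \<inter> C)" using at z by auto
    show "((F \<circ> chart_inv c) has_derivative local_form M \<beta> c (snd c z)) (at (snd c z))"
      using prim z c by (simp add: primitive_on_def)
    show "(\<forall>y\<in>snd c ` (fst c \<inter> C). (F \<circ> chart_inv c) y \<le> (F \<circ> chart_inv c) (snd c z)) \<or>
      (\<forall>y\<in>snd c ` (fst c \<inter> C). (F \<circ> chart_inv c) (snd c z) \<le> (F \<circ> chart_inv c) y)"
      using z(2) at chart_inv_left[OF t at(1)] by auto
  qed
  then have "\<forall>v\<in>tangent_space M z. \<beta> z v = 0"
    using form_eq_local_form[OF M c, of _ \<beta>] by simp
  then show ?thesis using z(1) by blast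
qed

section \<open>Rounding corners\<close>

text \<open>A smooth version of \<open>max 0\<close>; with it one motion is faded out and another faded in without any
  speed becoming negative.\<close>

definition smooth_ramp :: "real \<Rightarrow> real" where
  "smooth_ramp s = s * smooth_step s"

definition smooth_ramp_deriv :: "real \<Rightarrow> real" where
  "smooth_ramp_deriv s = frechet_derivative smooth_ramp (at s) 1"

lemma smooth_on_smooth_ramp: "smooth_on UNIV smooth_ramp"
  unfolding smooth_ramp_def[abs_def] by (intro smooth_on_mult open_UNIV smooth_on_id smooth_on_smooth_step)

lemma smooth_on_real_has_derivative:
  fixes f :: "real \<Rightarrow> 'a::real_normed_vector"
  assumes "smooth_on S f" "t \<in> S"
  shows "(f has_vector_derivative frechet_derivative f (at t) 1) (at t)"
proof -
  note d = smooth_on_has_derivative[OF assms]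
  have "frechet_derivative f (at t) = (\<lambda>h. h *\<^sub>R frechet_derivative f (at t) 1)"
  proof
    fix h :: real
    show "frechet_derivative f (at t) h = h *\<^sub>R frechet_derivative f (at t) 1"
      using linear_scale[OF has_derivative_linear[OF d], of h 1] by (simp only: real_scaleR_def mult_1_right)
  qed
  then show ?thesis unfolding has_vector_derivative_def using d by simp
qed

lemma smooth_ramp_has_derivative: "(smooth_ramp has_real_derivative smooth_ramp_deriv s) (at s)"
  using smooth_on_real_has_derivative[OF smooth_on_smooth_ramp, of s]
  by (simp add: smooth_ramp_deriv_def has_real_derivative_iff_has_vector_derivative)

lemma smooth_ramp_eq_0: "s \<le> 0 \<Longrightarrow> smooth_ramp s = 0"
  and smooth_ramp_eq: "s \<ge> 1 \<Longrightarrow> smooth_ramp s = s"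
  by (simp_all add: smooth_ramp_def smooth_step_eq_0 smooth_step_eq_1)

lemma smooth_ramp_nonneg: "0 \<le> smooth_ramp s" and smooth_ramp_le: "smooth_ramp s \<le> max 0 s"
proof -
  show "0 \<le> smooth_ramp s"
    using smooth_step_nonneg[of s] smooth_ramp_eq_0[of s] by (cases "s \<le> 0") (auto simp: smooth_ramp_def)
  show "smooth_ramp s \<le> max 0 s"
    using smooth_step_le_1[of s] smooth_ramp_eq_0[of s]
    by (cases "s \<le> 0") (auto simp: smooth_ramp_def mult_left_le)
qed

lemma smooth_ramp_mono: "s \<le> t \<Longrightarrow> smooth_ramp s \<le> smooth_ramp t"
proof (cases "s \<le> 0")
  case True
  then show ?thesis by (simp add: smooth_ramp_eq_0 smooth_ramp_nonneg)
next
  case False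
  assume "s \<le> t"
  with False show ?thesis
    unfolding smooth_ramp_def by (intro mult_mono smooth_step_mono smooth_step_nonneg) auto
qed

lemma smooth_ramp_deriv_nonneg: "smooth_ramp_deriv s \<ge> 0"
  by (rule mono_on_imp_deriv_nonneg[OF _ smooth_ramp_has_derivative, of UNIV])
    (auto simp: mono_on_def smooth_ramp_mono)

lemma smooth_ramp_deriv_eq_0: "s < 0 \<Longrightarrow> smooth_ramp_deriv s = 0"
proof -
  assume "s < 0"
  have "((\<lambda>_. 0) has_real_derivative 0) (at s)" by simp
  then have "(smooth_ramp has_real_derivative 0) (at s)"
    by (rule has_field_derivative_transform_within_open[where S = "{..<0}"])
      (use \<open>s < 0\<close> in \<open>auto simp: smooth_ramp_eq_0\<close>)
  then show ?thesis using DERIV_unique smooth_ramp_has_derivative by blast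
qed

lemma smooth_ramp_deriv_eq_1: "s > 1 \<Longrightarrow> smooth_ramp_deriv s = 1"
proof -
  assume "s > 1"
  have "((\<lambda>s. s) has_real_derivative 1) (at s)" by simp
  then have "(smooth_ramp has_real_derivative 1) (at s)"
    by (rule has_field_derivative_transform_within_open[where S = "{1<..}"])
      (use \<open>s > 1\<close> in \<open>auto simp: smooth_ramp_eq\<close>)
  then show ?thesis using DERIV_unique smooth_ramp_has_derivative by blast
qed

text \<open>Let the half-spaces \<open>{v. 0 < m x v}\<close> vary continuously with \<open>x\<close>. A straight segment with velocity \<open>w\<close>
  heading for \<open>b\<close> can be continued into any curve \<open>\<sigma>\<close> that starts close to \<open>b\<close> with an admissible
  velocity, with admissible velocity throughout: the segment is first displaced by the small vector \<open>\<eta>\<close>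
  in order to hit the curve, and then the speed \<open>L'\<close> along the segment is
  faded out while the speed \<open>K'\<close> along the curve is faded in. All velocities are small perturbations of
  \<open>w\<close> or conic combinations of admissible vectors.\<close>

lemma smooth_corner:
  fixes m :: "'e::euclidean_space \<Rightarrow> 'e \<Rightarrow> real"
  assumes r: "r > 0" and \<delta>: "\<delta> > 0" "\<delta> * norm w \<le> r / 4"
    and lin: "\<And>x. x \<in> ball b r \<Longrightarrow> linear (m x)"
    and op: "open {(x, v). x \<in> ball b r \<and> m x v > 0}"
    and cone: "\<And>x v. x \<in> ball b r \<Longrightarrow> v \<in> ball w r \<Longrightarrow> m x v > 0"
  shows "\<exists>\<rho>>0. \<rho> \<le> r \<and> (\<forall>\<sigma> e. \<sigma> 0 \<in> ball b \<rho> \<and> e > 0 \<and> smooth_on (ball 0 e) \<sigma> \<and>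
      m (\<sigma> 0) (frechet_derivative \<sigma> (at 0) 1) > 0 \<longrightarrow>
    (\<exists>\<xi> a. a > 0 \<and> smooth_on {- a<..<\<delta> + a} \<xi> \<and>
      (\<forall>t\<in>{- a<..<\<delta> + a}. \<xi> t \<in> ball b r \<and> m (\<xi> t) (frechet_derivative \<xi> (at t) 1) > 0) \<and>
      (\<forall>t\<in>{- a<..<a}. \<xi> t = b + (t - \<delta>) *\<^sub>R w) \<and>
      (\<forall>t\<in>{\<delta> - a<..<\<delta> + a}. \<xi> t = \<sigma> (t - \<delta>))))"
proof -
  define \<psi> where "\<psi> t = smooth_step (2 / \<delta> * t - 1 / 2)" for t
  define \<psi>' where "\<psi>' t = frechet_derivative \<psi> (at t) 1" for t
  have s\<psi>: "smooth_on UNIV \<psi>"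
    using smooth_on_compose[OF open_UNIV smooth_on_affine[of UNIV "2 / \<delta>" "- 1 / 2"] smooth_on_smooth_step]
    by (simp add: o_def \<psi>_def[abs_def])
  have d\<psi>: "(\<psi> has_real_derivative \<psi>' t) (at t)" for t
    using smooth_on_real_has_derivative[OF s\<psi>, of t]
    by (simp add: \<psi>'_def has_real_derivative_iff_has_vector_derivative)
  have \<psi>01: "0 \<le> \<psi> t" "\<psi> t \<le> 1" for t
    by (simp_all add: \<psi>_def smooth_step_nonneg smooth_step_le_1)
  have \<psi>0: "\<psi> t = 0" if "t \<le> \<delta> / 4" for t
    using that \<delta> unfolding \<psi>_def by (intro smooth_step_eq_0) (simp add: field_simps)
  have \<psi>1: "\<psi> t = 1" if "t \<ge> 3 / 4 * \<delta>" for t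
    using that \<delta> unfolding \<psi>_def by (intro smooth_step_eq_1) (simp add: field_simps)
  have \<psi>'0: "\<psi>' t = 0" if "t > 3 / 4 * \<delta>" for t
  proof -
    have "((\<lambda>_. 1) has_real_derivative 0) (at t)" by simp
    then have "(\<psi> has_real_derivative 0) (at t)"
      by (rule has_field_derivative_transform_within_open[where S = "{3 / 4 * \<delta><..}"]) (use that \<psi>1 in auto)
    then show ?thesis using DERIV_unique d\<psi> by blast
  qed
  obtain C where C: "C > 0" "\<And>t. t \<in> {- \<delta>..2 * \<delta>} \<Longrightarrow> \<bar>\<psi>' t\<bar> \<le> C"
  proof -
    have "continuous_on {- \<delta>..2 * \<delta>} \<psi>'"
      using smooth_on_continuous[OF smooth_on_frechet_derivative[OF s\<psi>, of 1]] unfolding \<psi>'_def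
      by (rule continuous_on_subset) simp
    from compact_imp_bounded[OF compact_continuous_image[OF this compact_Icc]]
    obtain C where "C > 0" "\<forall>y\<in>\<psi>' ` {- \<delta>..2 * \<delta>}. norm y \<le> C"
      unfolding bounded_pos by blast
    then show ?thesis using that[of C] by auto
  qed
  \<comment> \<open>The displacement \<open>\<eta>\<close> below has norm less than \<open>2 * \<rho>\<close>, so it contributes less than \<open>r\<close> to the velocity.\<close>
  define \<rho> where "\<rho> = min (r / 8) (r / (4 * C))"
  have \<rho>: "\<rho> > 0" "8 * \<rho> \<le> r" "\<rho> \<le> r" "C * (2 * \<rho>) < r"
  proof -
    show "\<rho> > 0" "8 * \<rho> \<le> r" "\<rho> \<le> r" using r C by (auto simp: \<rho>_def)
    have "C * \<rho> \<le> C * (r / (4 * C))" using C(1) by (intro mult_left_mono) (auto simp: \<rho>_def)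
    also have "\<dots> = r / 4" using C(1) by simp
    finally show "C * (2 * \<rho>) < r" using r by simp
  qed
  have "\<exists>\<xi> a. a > 0 \<and> smooth_on {- a<..<\<delta> + a} \<xi> \<and>
      (\<forall>t\<in>{- a<..<\<delta> + a}. \<xi> t \<in> ball b r \<and> m (\<xi> t) (frechet_derivative \<xi> (at t) 1) > 0) \<and>
      (\<forall>t\<in>{- a<..<a}. \<xi> t = b + (t - \<delta>) *\<^sub>R w) \<and>
      (\<forall>t\<in>{\<delta> - a<..<\<delta> + a}. \<xi> t = \<sigma> (t - \<delta>))"
    if \<sigma>0: "\<sigma> 0 \<in> ball b \<rho>" and e: "e > 0" and \<sigma>: "smooth_on (ball 0 e) \<sigma>"
      and pos: "m (\<sigma> 0) (frechet_derivative \<sigma> (at 0) 1) > 0" for \<sigma> e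
  proof -
    define \<sigma>' where "\<sigma>' k = frechet_derivative \<sigma> (at k) 1" for k
    have d\<sigma>: "(\<sigma> has_vector_derivative \<sigma>' k) (at k)" if "k \<in> ball 0 e" for k
      unfolding \<sigma>'_def by (rule smooth_on_real_has_derivative[OF \<sigma> that])
    have c\<sigma>: "continuous_on (ball 0 e) \<sigma>" "continuous_on (ball 0 e) \<sigma>'"
      using smooth_on_continuous[OF \<sigma>] smooth_on_continuous[OF smooth_on_frechet_derivative[OF \<sigma>, of 1]]
      by (simp_all add: \<sigma>'_def[abs_def])
    \<comment> \<open>Admissibility of the velocity of \<open>\<sigma>\<close> persists near the starting point, also at points off the curve.\<close>
    obtain \<theta> where \<theta>: "\<theta> > 0" "\<And>x k. dist x (\<sigma> 0) < \<theta> \<Longrightarrow> \<bar>k\<bar> < \<theta> \<Longrightarrow> k \<in> ball 0 e \<Longrightarrow> m x (\<sigma>' k) > 0"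
    proof -
      have "\<sigma> 0 \<in> ball b r" using \<sigma>0 \<rho> by auto
      then have "(\<sigma> 0, \<sigma>' 0) \<in> {(x, v). x \<in> ball b r \<and> m x v > 0}" using pos by (simp add: \<sigma>'_def)
      obtain A B where AB': "open A" "open B" "(\<sigma> 0, \<sigma>' 0) \<in> A \<times> B"
        and AB5: "A \<times> B \<subseteq> {(x, v). x \<in> ball b r \<and> m x v > 0}"
        by (rule open_prod_elim[OF op \<open>(\<sigma> 0, \<sigma>' 0) \<in> _\<close>])
      then have AB: "open A" "open B" "\<sigma> 0 \<in> A" "\<sigma>' 0 \<in> B" by auto
      obtain t1 where t1: "t1 > 0" "ball (\<sigma> 0) t1 \<subseteq> A" using AB openE by blast
      obtain t2 where t2: "t2 > 0" "ball (\<sigma>' 0) t2 \<subseteq> B" using AB openE by blast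
      obtain t3 where t3: "t3 > 0" "\<And>k. k \<in> ball 0 e \<Longrightarrow> dist k 0 < t3 \<Longrightarrow> dist (\<sigma>' k) (\<sigma>' 0) < t2"
        using c\<sigma>(2) e t2(1) unfolding continuous_on_iff by (metis centre_in_ball)
      show ?thesis
      proof (rule that[of "min t1 t3"])
        show "min t1 t3 > 0" using t1 t3 by simp
        fix x k assume "dist x (\<sigma> 0) < min t1 t3" "\<bar>k\<bar> < min t1 t3" "k \<in> ball 0 e"
        then have "x \<in> A" "\<sigma>' k \<in> B" using t1(2) t2(2) t3(2)[of k] by (auto simp: dist_commute subset_iff)
        then show "m x (\<sigma>' k) > 0" using AB5 by auto
      qed
    qed
    define \<kappa> where "\<kappa> = min \<rho> \<theta> / 2"
    have \<kappa>: "\<kappa> > 0" "\<kappa> \<le> \<rho> / 2" "\<kappa> \<le> \<theta> / 2" using \<rho> \<theta> by (auto simp: \<kappa>_def)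
    obtain d where d: "d > 0" "\<And>k. k \<in> ball 0 e \<Longrightarrow> dist k 0 < d \<Longrightarrow> dist (\<sigma> k) (\<sigma> 0) < \<kappa>"
      using c\<sigma>(1) e \<kappa>(1) unfolding continuous_on_iff by (metis centre_in_ball)
    obtain a where a: "a > 0" "a \<le> \<delta> / 8" "a < e" "a < \<theta>" "a < d" "a * norm w < \<kappa>"
    proof -
      define a where "a = min (min (\<delta> / 8) (min (e / 2) (\<theta> / 2))) (min (d / 2) (\<kappa> / (norm w + 1)))"
      have le: "a \<le> \<delta> / 8" "a \<le> e / 2" "a \<le> \<theta> / 2" "a \<le> d / 2" "a \<le> \<kappa> / (norm w + 1)"
        by (simp_all only: a_def min_le_iff_disj order_refl simp_thms)
      have nw: "norm w + 1 > 0" by (smt (verit) norm_ge_zero)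
      then have "a > 0" using \<delta> e \<theta> d \<kappa> by (auto simp: a_def)
      moreover have "a * norm w < \<kappa>"
      proof -
        have "a * norm w < a * (norm w + 1)" using \<open>a > 0\<close> by simp
        also have "\<dots> \<le> \<kappa> / (norm w + 1) * (norm w + 1)" using nw using le(5) by (intro mult_right_mono) auto
        finally show ?thesis using nw by simp
      qed
      moreover have "a \<le> \<delta> / 8" "a < e" "a < \<theta>" "a < d" using e \<theta>(1) d(1) le by linarith+
      ultimately show ?thesis using that by blast
    qed
    have near: "norm (\<sigma> k - \<sigma> 0) < \<kappa>" "k \<in> ball 0 e" if "\<bar>k\<bar> \<le> a" for k
      using d(2)[of k] a that by (auto simp: dist_norm)
    \<comment> \<open>The curve is followed at unit speed from time \<open>\<delta> - a / 2\<close> on, the segment until the later time \<open>\<delta> - a / 3\<close>;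
      so at each time at least one of the speeds is 1.\<close>
    define K where "K t = - a + a / 2 * smooth_ramp (2 / a * (t - \<delta>) + 2)" for t
    define K' where "K' t = smooth_ramp_deriv (2 / a * (t - \<delta>) + 2)" for t
    define L where "L t = - a / 6 - a / 6 * smooth_ramp (- (6 / a * (t - \<delta>)) - 1)" for t
    define L' where "L' t = smooth_ramp_deriv (- (6 / a * (t - \<delta>)) - 1)" for t
    define \<eta> where "\<eta> = \<sigma> (- a) + (a / 6) *\<^sub>R w - b"
    define \<xi> where "\<xi> t = b + L t *\<^sub>R w + \<psi> t *\<^sub>R \<eta> + (\<sigma> (K t) - \<sigma> (- a))" for t
    have K_left: "K t = - a" if "t \<le> \<delta> - a" for t
      using that a(1) unfolding K_def by (subst smooth_ramp_eq_0) (simp_all add: field_simps)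
    have K_right: "K t = t - \<delta>" if "t \<ge> \<delta> - a / 2" for t
      using that a(1) unfolding K_def by (subst smooth_ramp_eq) (simp_all add: field_simps)
    have L_left: "L t = t - \<delta>" if "t \<le> \<delta> - a / 3" for t
      using that a(1) unfolding L_def by (subst smooth_ramp_eq) (simp_all add: field_simps)
    have L_right: "L t = - a / 6" if "t \<ge> \<delta> - a / 6" for t
      using that a(1) unfolding L_def by (subst smooth_ramp_eq_0) (simp_all add: field_simps)
    have K'_nonneg: "K' t \<ge> 0" and L'_nonneg: "L' t \<ge> 0" for t
      by (simp_all add: K'_def L'_def smooth_ramp_deriv_nonneg)
    have K'_left: "K' t = 0" if "t < \<delta> - a" for t
      using that a(1) unfolding K'_def by (intro smooth_ramp_deriv_eq_0) (simp add: field_simps)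
    have K'_right: "K' t = 1" if "t > \<delta> - a / 2" for t
      using that a(1) unfolding K'_def by (intro smooth_ramp_deriv_eq_1) (simp add: field_simps)
    have L'_left: "L' t = 1" if "t < \<delta> - a / 3" for t
      using that a(1) unfolding L'_def by (intro smooth_ramp_deriv_eq_1) (simp add: field_simps)
    have K_bound: "\<bar>K t\<bar> \<le> a" if "t \<le> \<delta> + a" for t
    proof -
      have "a / 2 * smooth_ramp (2 / a * (t - \<delta>) + 2) \<le> a / 2 * max 0 (2 / a * (t - \<delta>) + 2)"
        using a(1) by (intro mult_left_mono smooth_ramp_le) auto
      also have "\<dots> \<le> 2 * a" using that a(1) by (auto simp: max_def field_simps)
      finally have "K t \<le> a" by (simp add: K_def)
      moreover have "K t \<ge> - a" using a(1) smooth_ramp_nonneg by (simp add: K_def)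
      ultimately show ?thesis by simp
    qed
    have L_bound: "min (- a / 6) (t - \<delta>) \<le> L t \<and> L t \<le> - a / 6" for t
    proof -
      have "a / 6 * smooth_ramp (- (6 / a * (t - \<delta>)) - 1) \<le> a / 6 * max 0 (- (6 / a * (t - \<delta>)) - 1)"
        using a(1) by (intro mult_left_mono smooth_ramp_le) auto
      also have "\<dots> = max 0 (\<delta> - t - a / 6)" using a(1) by (auto simp: max_def field_simps)
      finally have "min (- a / 6) (t - \<delta>) \<le> L t" by (auto simp: L_def max_def min_def split: if_splits)
      moreover have "L t \<le> - a / 6" using a(1) smooth_ramp_nonneg by (simp add: L_def)
      ultimately show ?thesis by simp
    qed
    have \<eta>: "norm \<eta> < 2 * \<rho>"
    proof -
      have "\<eta> = (\<sigma> (- a) - \<sigma> 0) + (a / 6) *\<^sub>R w + (\<sigma> 0 - b)" by (simp add: \<eta>_def)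
      then have "norm \<eta> \<le> norm (\<sigma> (- a) - \<sigma> 0) + norm ((a / 6) *\<^sub>R w) + norm (\<sigma> 0 - b)"
        using norm_triangle_ineq[of "(\<sigma> (- a) - \<sigma> 0) + (a / 6) *\<^sub>R w" "\<sigma> 0 - b"]
          norm_triangle_ineq[of "\<sigma> (- a) - \<sigma> 0" "(a / 6) *\<^sub>R w"] by simp
      moreover have "norm ((a / 6) *\<^sub>R w) \<le> a * norm w" using a(1) by (simp add: mult_right_mono)
      moreover have "norm (\<sigma> 0 - b) < \<rho>" using \<sigma>0 by (simp add: dist_norm norm_minus_commute)
      ultimately show ?thesis using near(1)[of "- a"] a \<kappa>(2) by linarith
    qed
    let ?J = "{- (a / 6)<..<\<delta> + a / 6}"
    have in_ball: "\<xi> t \<in> ball b r" if t: "t \<in> ?J" for t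
    proof -
      have "norm (\<xi> t - b) \<le> norm (L t *\<^sub>R w) + norm (\<psi> t *\<^sub>R \<eta>) + norm (\<sigma> (K t) - \<sigma> (- a))"
      proof -
        have "\<xi> t - b = L t *\<^sub>R w + \<psi> t *\<^sub>R \<eta> + (\<sigma> (K t) - \<sigma> (- a))" by (simp add: \<xi>_def)
        then show ?thesis
          using norm_triangle_ineq[of "L t *\<^sub>R w + \<psi> t *\<^sub>R \<eta>" "\<sigma> (K t) - \<sigma> (- a)"]
            norm_triangle_ineq[of "L t *\<^sub>R w" "\<psi> t *\<^sub>R \<eta>"] by simp
      qed
      moreover have "norm (L t *\<^sub>R w) \<le> \<delta> * norm w + a * norm w"
      proof -
        have "\<bar>L t\<bar> \<le> \<delta> + a" using L_bound[of t] t a by (auto simp: min_def split: if_splits)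
        then have "\<bar>L t\<bar> * norm w \<le> (\<delta> + a) * norm w" by (intro mult_right_mono) auto
        then show ?thesis by (simp add: algebra_simps)
      qed
      moreover have "norm (\<psi> t *\<^sub>R \<eta>) \<le> norm \<eta>"
        using \<psi>01[of t] by (simp add: mult_left_le_one_le)
      moreover have "norm (\<sigma> (K t) - \<sigma> (- a)) < 2 * \<kappa>"
      proof -
        have "norm (\<sigma> (K t) - \<sigma> (- a)) \<le> norm (\<sigma> (K t) - \<sigma> 0) + norm (\<sigma> (- a) - \<sigma> 0)"
          using norm_triangle_ineq4[of "\<sigma> (K t) - \<sigma> 0" "\<sigma> (- a) - \<sigma> 0"] by simp
        then show ?thesis using near(1)[of "K t"] near(1)[of "- a"] K_bound[of t] t a(1) by auto
      qed
      ultimately have "norm (\<xi> t - b) < r" using \<delta>(2) \<eta> a(6) \<kappa>(2) \<rho>(1,2) by linarith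
      then show ?thesis by (simp add: dist_norm norm_minus_commute)
    qed
    have sK: "smooth_on UNIV K"
    proof -
      have "smooth_on UNIV (\<lambda>t. smooth_ramp (2 / a * (t - \<delta>) + 2))"
        using smooth_on_compose[OF open_UNIV smooth_on_affine[of UNIV "2 / a" "2 - 2 / a * \<delta>"] smooth_on_smooth_ramp]
        by (simp add: o_def algebra_simps diff_divide_distrib)
      from smooth_on_compose[OF open_UNIV this smooth_on_affine[of UNIV "a / 2" "- a"]]
      show ?thesis by (simp add: o_def K_def[abs_def])
    qed
    have sL: "smooth_on UNIV L"
    proof -
      have "smooth_on UNIV (\<lambda>t. smooth_ramp (- (6 / a * (t - \<delta>)) - 1))"
        using smooth_on_compose[OF open_UNIV smooth_on_affine[of UNIV "- (6 / a)" "6 / a * \<delta> - 1"] smooth_on_smooth_ramp]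
        by (simp add: o_def algebra_simps diff_divide_distrib)
      from smooth_on_compose[OF open_UNIV this smooth_on_affine[of UNIV "- (a / 6)" "- a / 6"]]
      have "smooth_on UNIV (\<lambda>t. - (a / 6) * smooth_ramp (- (6 / a * (t - \<delta>)) - 1) + - a / 6)"
        by (simp only: o_def real_scaleR_def subset_UNIV)
      moreover have "L = (\<lambda>t. - (a / 6) * smooth_ramp (- (6 / a * (t - \<delta>)) - 1) + - a / 6)"
        by (simp add: L_def fun_eq_iff)
      ultimately show ?thesis by simp
    qed
    have K_in: "K t \<in> ball 0 e" if "t \<in> ?J" for t
      using near(2)[OF K_bound[of t]] that a(1) by auto
    have s\<xi>: "smooth_on ?J \<xi>"
    proof -
      have "smooth_on ?J (\<sigma> \<circ> K)"
        by (rule smooth_on_compose[OF _ smooth_on_subset[OF sK] \<sigma>]) (use K_in in auto)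
      then have "smooth_on ?J (\<lambda>t. \<sigma> (K t))" by (simp add: o_def)
      moreover have "smooth_on ?J L" "smooth_on ?J \<psi>"
        using smooth_on_subset[OF sL] smooth_on_subset[OF s\<psi>] by auto
      ultimately have "smooth_on ?J (\<lambda>t. (b + L t *\<^sub>R w + \<psi> t *\<^sub>R \<eta>) + (\<sigma> (K t) + (- \<sigma> (- a))))"
        by (intro smooth_on_add smooth_on_scaleR smooth_on_const) auto
      then show ?thesis by (simp add: \<xi>_def[abs_def])
    qed
    have deriv: "frechet_derivative \<xi> (at t) 1 = L' t *\<^sub>R w + \<psi>' t *\<^sub>R \<eta> + K' t *\<^sub>R \<sigma>' (K t)" if t: "t \<in> ?J" for t
    proof -
      have dK: "(K has_real_derivative K' t) (at t)"
        unfolding K_def K'_def using a(1)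
        by (auto intro!: derivative_eq_intros DERIV_chain2[OF smooth_ramp_has_derivative])
      have dL: "(L has_real_derivative L' t) (at t)"
        unfolding L_def L'_def using a(1)
        by (auto intro!: derivative_eq_intros DERIV_chain2[OF smooth_ramp_has_derivative])
      have "((\<sigma> \<circ> K) has_vector_derivative K' t *\<^sub>R \<sigma>' (K t)) (at t)"
        by (rule vector_diff_chain_at[OF dK[unfolded has_real_derivative_iff_has_vector_derivative] d\<sigma>[OF K_in[OF t]]])
      then have \<sigma>K: "((\<lambda>t. \<sigma> (K t)) has_vector_derivative K' t *\<^sub>R \<sigma>' (K t)) (at t)"
        by (simp add: o_def)
      have along: "((\<lambda>t. f t *\<^sub>R u) has_vector_derivative f' *\<^sub>R u) (at t)"
        if "(f has_real_derivative f') (at t)" for f f' and u :: 'e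
        using has_vector_derivative_scaleR[OF that has_vector_derivative_const[of u]] by simp
      have "(\<xi> has_vector_derivative (0 + L' t *\<^sub>R w + \<psi>' t *\<^sub>R \<eta> + (K' t *\<^sub>R \<sigma>' (K t) - 0))) (at t)"
        unfolding \<xi>_def
        by (intro has_vector_derivative_add has_vector_derivative_diff has_vector_derivative_const
            along dL d\<psi> \<sigma>K)
      then show ?thesis
        using frechet_derivative_at[of \<xi> "\<lambda>h. h *\<^sub>R (L' t *\<^sub>R w + \<psi>' t *\<^sub>R \<eta> + K' t *\<^sub>R \<sigma>' (K t))" t, symmetric]
        by (simp add: has_vector_derivative_def)
    qed
    have positive: "m (\<xi> t) (frechet_derivative \<xi> (at t) 1) > 0" if t: "t \<in> ?J" for t
    proof (cases "t < \<delta> - a")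
      case True
      have v: "frechet_derivative \<xi> (at t) 1 = w + \<psi>' t *\<^sub>R \<eta>"
        using True a(1) by (simp add: deriv[OF t] K'_left L'_left)
      have "norm (\<psi>' t *\<^sub>R \<eta>) \<le> C * (2 * \<rho>)"
        using C(2)[of t] C(1) \<eta> t a \<delta> by (auto intro!: mult_mono)
      then have "w + \<psi>' t *\<^sub>R \<eta> \<in> ball w r" using \<rho>(4) by (simp add: dist_norm)
      then show ?thesis unfolding v by (rule cone[OF in_ball[OF t]])
    next
      case False
      have \<psi>t: "\<psi> t = 1" "\<psi>' t = 0"
        using False a(1,2) \<delta>(1) by (auto intro!: \<psi>1 \<psi>'0)
      have l: "linear (m (\<xi> t))" by (rule lin[OF in_ball[OF t]])
      have "\<xi> t = \<sigma> (K t) + (L t + a / 6) *\<^sub>R w"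
        by (simp add: \<xi>_def \<psi>t \<eta>_def algebra_simps)
      then have "dist (\<xi> t) (\<sigma> 0) \<le> norm (\<sigma> (K t) - \<sigma> 0) + norm ((L t + a / 6) *\<^sub>R w)"
        using norm_triangle_ineq[of "\<sigma> (K t) - \<sigma> 0" "(L t + a / 6) *\<^sub>R w"] by (simp add: dist_norm algebra_simps)
      also have "norm ((L t + a / 6) *\<^sub>R w) \<le> a * norm w"
      proof -
        have "\<bar>L t + a / 6\<bar> \<le> a" using L_bound[of t] False a(1) by (auto simp: min_def split: if_splits)
        then show ?thesis by (simp add: mult_right_mono)
      qed
      finally have "dist (\<xi> t) (\<sigma> 0) < \<theta>"
        using near(1)[of "K t"] K_bound[of t] t a(1,6) \<kappa>(3) by auto
      then have p1: "m (\<xi> t) (\<sigma>' (K t)) > 0"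
        using \<theta>(2)[of "\<xi> t" "K t"] K_bound[of t] K_in[OF t] t a(1,4) by auto
      have p2: "m (\<xi> t) w > 0" using cone[OF in_ball[OF t], of w] r by simp
      have "m (\<xi> t) (frechet_derivative \<xi> (at t) 1) = L' t * m (\<xi> t) w + K' t * m (\<xi> t) (\<sigma>' (K t))"
        by (simp add: deriv[OF t] \<psi>t linear_add[OF l] linear_scale[OF l])
      moreover have "L' t > 0 \<or> K' t > 0"
        using L'_left[of t] K'_right[of t] a(1) by (cases "t < \<delta> - a / 3") auto
      ultimately show ?thesis
        using p1 p2 L'_nonneg[of t] K'_nonneg[of t]
        by (auto intro: add_pos_nonneg add_nonneg_pos)
    qed
    have "\<xi> t = b + (t - \<delta>) *\<^sub>R w" if "t \<in> {- (a / 6)<..<a / 6}" for t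
    proof -
      have "t \<le> \<delta> / 4" "t \<le> \<delta> - a / 3" "t \<le> \<delta> - a" using that a(1,2) \<delta>(1) by auto
      then show ?thesis by (simp add: \<xi>_def K_left L_left \<psi>0)
    qed
    moreover have "\<xi> t = \<sigma> (t - \<delta>)" if "t \<in> {\<delta> - a / 6<..<\<delta> + a / 6}" for t
    proof -
      have "t \<ge> 3 / 4 * \<delta>" "t \<ge> \<delta> - a / 6" "t \<ge> \<delta> - a / 2" using that a(1,2) \<delta>(1) by auto
      then show ?thesis by (simp add: \<xi>_def K_right L_right \<psi>1 \<eta>_def)
    qed
    ultimately show ?thesis
      using s\<xi> in_ball positive a(1) by (intro exI[of _ \<xi>] exI[of _ "a / 6"]) auto
  qed
  then show ?thesis using \<rho> by (intro exI[of _ \<rho>]) auto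
qed

section \<open>Closed curves on which a 1-form is positive\<close>

locale manifold_one_form =
  fixes S :: "('s, 'e::euclidean_space, 'z) charted_space_scheme" and \<mu> :: "('s, 'e) form1"
  assumes manifold: "smooth_manifold S" and form: "one_form S \<mu>"
begin

lemma topological: "topological_manifold S"
  using manifold by (rule smooth_manifold_topological)

text \<open>For some \<open>c\<close> and \<open>e\<close> this holds depending only on the germ of the curve at \<open>t\<close>, so that curves can be glued along
  common germs.\<close>

definition positive_in :: "('s, 'e) chart \<Rightarrow> real \<Rightarrow> (real \<Rightarrow> 's) \<Rightarrow> real \<Rightarrow> bool" where
  "positive_in c e \<gamma> t \<longleftrightarrow> c \<in> atlas S \<and> e > 0 \<and>
     (\<forall>s\<in>ball t e. \<gamma> s \<in> fst c) \<and> smooth_on (ball t e) (snd c \<circ> \<gamma>) \<and>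
     local_form S \<mu> c (snd c (\<gamma> t)) (frechet_derivative (snd c \<circ> \<gamma>) (at t) 1) > 0"

definition positive_at :: "(real \<Rightarrow> 's) \<Rightarrow> real \<Rightarrow> bool" where
  "positive_at \<gamma> t \<longleftrightarrow> (\<exists>c e. positive_in c e \<gamma> t)"

lemma positive_in_smaller: "positive_in c e \<gamma> t \<Longrightarrow> 0 < d \<Longrightarrow> d \<le> e \<Longrightarrow> positive_in c d \<gamma> t"
  unfolding positive_in_def using subset_ball[of d e t] smooth_on_subset by blast

lemma positive_in_charts_at: "positive_in c e \<gamma> t \<Longrightarrow> c \<in> charts_at S (\<gamma> t)"
  by (auto simp: positive_in_def charts_at_iff)

lemma positive_at_cong:
  assumes "positive_at \<gamma> t" "d > 0" "\<And>s. s \<in> ball t d \<Longrightarrow> \<gamma>' s = \<gamma> s"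
  shows "positive_at \<gamma>' t"
proof -
  obtain c e where ce: "positive_in c e \<gamma> t" using assms(1) unfolding positive_at_def by blast
  then have "e > 0" by (simp add: positive_in_def)
  then have c: "positive_in c (min d e) \<gamma> t"
    using assms(2) by (intro positive_in_smaller[OF ce]) auto
  have eq: "(snd c \<circ> \<gamma>') s = (snd c \<circ> \<gamma>) s" "\<gamma>' s = \<gamma> s" if "s \<in> ball t (min d e)" for s
    using assms(3)[of s] that by auto
  have t: "t \<in> ball t (min d e)" using c by (simp add: positive_in_def)
  have "frechet_derivative (snd c \<circ> \<gamma>') (at t) = frechet_derivative (snd c \<circ> \<gamma>) (at t)"
    by (rule frechet_derivative_cong_open(1)[OF open_ball t eq(1)])
  moreover have "smooth_on (ball t (min d e)) (snd c \<circ> \<gamma>') \<longleftrightarrow> smooth_on (ball t (min d e)) (snd c \<circ> \<gamma>)"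
    by (rule smooth_on_cong[OF open_ball eq(1)])
  ultimately have "positive_in c (min d e) \<gamma>' t"
    using c eq(2) eq(2)[OF t] unfolding positive_in_def by simp
  then show ?thesis unfolding positive_at_def by blast
qed

lemma positive_in_imp_positive_at_chart:
  assumes "positive_in c e \<gamma> t"
  shows "((snd c \<circ> \<gamma>) has_vector_derivative frechet_derivative (snd c \<circ> \<gamma>) (at t) 1) (at t)"
    "linear (local_form S \<mu> c (snd c (\<gamma> t)))"
  using assms smooth_on_real_has_derivative[of "ball t e" "snd c \<circ> \<gamma>" t]
    local_form_linear[OF manifold form positive_in_charts_at[OF assms]]
  by (auto simp: positive_in_def)

lemma positive_at_affine:
  assumes "positive_at \<gamma> (k * t + b)" "k > 0"
  shows "positive_at (\<lambda>s. \<gamma> (k * s + b)) t"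
proof -
  obtain c e where c: "positive_in c e \<gamma> (k * t + b)" using assms(1) unfolding positive_at_def by blast
  have ball: "k * s + b \<in> ball (k * t + b) e" if "s \<in> ball t (e / k)" for s
  proof -
    have "\<bar>k * t + b - (k * s + b)\<bar> = k * \<bar>t - s\<bar>" using assms(2) by (simp add: abs_mult flip: right_diff_distrib)
    also have "\<dots> < e" using that assms(2) by (simp add: dist_real_def pos_less_divide_eq mult.commute)
    finally show ?thesis by (simp add: dist_real_def)
  qed
  have sm: "smooth_on (ball (k * t + b) e) (snd c \<circ> \<gamma>)" using c by (simp add: positive_in_def)
  have "smooth_on (ball t (e / k)) ((snd c \<circ> \<gamma>) \<circ> (\<lambda>s. k *\<^sub>R s + b))"
    by (rule smooth_on_compose[OF open_ball smooth_on_affine sm]) (use ball in auto)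
  then have 1: "smooth_on (ball t (e / k)) (snd c \<circ> (\<lambda>s. \<gamma> (k * s + b)))" by (simp add: o_def)
  have "((\<lambda>s. k * s + b) has_vector_derivative k) (at t)"
    by (auto intro!: derivative_eq_intros)
  from vector_diff_chain_at[OF this positive_in_imp_positive_at_chart(1)[OF c]]
  have "frechet_derivative (snd c \<circ> (\<lambda>s. \<gamma> (k * s + b))) (at t) 1 = k *\<^sub>R frechet_derivative (snd c \<circ> \<gamma>) (at (k * t + b)) 1"
    using frechet_derivative_at[symmetric] by (fastforce simp: has_vector_derivative_def o_def)
  then have "local_form S \<mu> c (snd c (\<gamma> (k * t + b))) (frechet_derivative (snd c \<circ> (\<lambda>s. \<gamma> (k * s + b))) (at t) 1) > 0"
    using c assms(2) linear_scale[OF positive_in_imp_positive_at_chart(2)[OF c]] by (simp add: positive_in_def)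
  then have "positive_in c (e / k) (\<lambda>s. \<gamma> (k * s + b)) t"
    using c 1 ball assms(2) by (auto simp: positive_in_def)
  then show ?thesis unfolding positive_at_def by blast
qed

lemma positive_at_shift: "positive_at \<gamma> (t + b) \<Longrightarrow> positive_at (\<lambda>s. \<gamma> (s + b)) t"
  using positive_at_affine[of \<gamma> 1 t b] by simp

lemma positive_at_chart:
  assumes "positive_at \<gamma> t" and d: "d \<in> charts_at S (\<gamma> t)"
  shows "\<exists>e. positive_in d e \<gamma> t"
proof -
  obtain c e where c: "positive_in c e \<gamma> t" using assms(1) unfolding positive_at_def by blast
  note cd = positive_in_charts_at[OF c]
  have at: "c \<in> atlas S" "d \<in> atlas S" "\<gamma> t \<in> fst c" "\<gamma> t \<in> fst d" using cd d by (auto simp: charts_at_iff)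
  define V where "V = snd c ` (fst c \<inter> fst d)"
  have V: "open V" "(snd c \<circ> \<gamma>) t \<in> V"
    using chart_image_open[OF topological at(1) chart_openin[OF topological at(2)]] at by (auto simp: V_def)
  have sm: "smooth_on (ball t e) (snd c \<circ> \<gamma>)" "e > 0" "\<And>s. s \<in> ball t e \<Longrightarrow> \<gamma> s \<in> fst c"
    using c by (auto simp: positive_in_def)
  have "open (ball t e \<inter> (snd c \<circ> \<gamma>) -` V)"
    using smooth_on_continuous[OF sm(1)] V(1) by (intro continuous_open_preimage) auto
  then obtain e' where e': "e' > 0" "ball t e' \<subseteq> ball t e \<inter> (snd c \<circ> \<gamma>) -` V"
    using openE[of _ t] V(2) sm(2) by (metis Int_iff centre_in_ball vimage_eq)
  have in_cd: "\<gamma> s \<in> fst c" "\<gamma> s \<in> fst d" if s: "s \<in> ball t e'" for s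
  proof -
    show "\<gamma> s \<in> fst c" using e'(2) s sm(3) by auto
    moreover have "snd c (\<gamma> s) \<in> V" using e'(2) s by auto
    ultimately show "\<gamma> s \<in> fst d" using chart_in_image_iff[OF topological at(1)] by (simp add: V_def)
  qed
  have eq: "(snd d \<circ> \<gamma>) s = ((snd d \<circ> chart_inv c) \<circ> (snd c \<circ> \<gamma>)) s" if "s \<in> ball t e'" for s
    using in_cd[OF that] chart_inv_left[OF topological at(1)] by simp
  have "smooth_on (ball t e') ((snd d \<circ> chart_inv c) \<circ> (snd c \<circ> \<gamma>))"
    by (rule smooth_on_compose[OF open_ball smooth_on_subset[OF sm(1)] transition_smooth_on[OF manifold at(1,2), folded V_def]])
      (use e'(2) in auto)
  moreover have "smooth_on (ball t e') (snd d \<circ> \<gamma>) \<longleftrightarrow> smooth_on (ball t e') ((snd d \<circ> chart_inv c) \<circ> (snd c \<circ> \<gamma>))"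
    by (rule smooth_on_cong[OF open_ball eq])
  ultimately have "smooth_on (ball t e') (snd d \<circ> \<gamma>)" by blast
  moreover have "frechet_derivative (snd d \<circ> \<gamma>) (at t) 1 =
      chart_change c d (\<gamma> t) (frechet_derivative (snd c \<circ> \<gamma>) (at t) 1)"
  proof -
    have "((snd c \<circ> \<gamma>) has_derivative frechet_derivative (snd c \<circ> \<gamma>) (at t)) (at t)"
      using sm by (intro smooth_on_has_derivative[OF sm(1)]) simp
    from frechet_derivative_at[OF has_derivative_change_target_chart[OF manifold open_ball _ in_cd(1) cd d this]] e'(1)
    show ?thesis by (metis centre_in_ball comp_apply)
  qed
  ultimately have "positive_in d e' \<gamma> t"
    using c at(2) e'(1) in_cd(2) local_form_change_chart[OF manifold cd d, of \<mu>] by (simp add: positive_in_def)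
  then show ?thesis by blast
qed

lemma positive_curve_smooth_map:
  assumes "\<And>t. positive_at \<gamma> t" shows "smooth_map euclid S \<gamma>"
proof -
  have chart: "\<exists>e. positive_in d e \<gamma> t" if "d \<in> charts_at S (\<gamma> t)" for d t
    using positive_at_chart[OF assms that] .
  have inS: "\<gamma> t \<in> points S" for t
    using assms[of t] positive_in_charts_at charts_at_imp_point[OF topological] unfolding positive_at_def by blast
  have "open {t. \<gamma> t \<in> W}" if W: "openin (mtop S) W" for W
  proof (rule openI)
    fix t assume t: "t \<in> {t. \<gamma> t \<in> W}"
    obtain c e where c: "positive_in c e \<gamma> t" using assms[of t] unfolding positive_at_def by blast
    then have at: "c \<in> atlas S" "e > 0" "\<And>s. s \<in> ball t e \<Longrightarrow> \<gamma> s \<in> fst c" by (auto simp: positive_in_def)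
    define V where "V = snd c ` (fst c \<inter> W)"
    have "open V" unfolding V_def by (rule chart_image_open[OF topological at(1) W])
    moreover have "continuous_on (ball t e) (snd c \<circ> \<gamma>)"
      using c by (intro smooth_on_continuous) (simp add: positive_in_def)
    ultimately have "open (ball t e \<inter> (snd c \<circ> \<gamma>) -` V)"
      by (intro continuous_open_preimage) auto
    moreover have "t \<in> ball t e \<inter> (snd c \<circ> \<gamma>) -` V" using t at by (auto simp: V_def)
    ultimately obtain d where d: "d > 0" "ball t d \<subseteq> ball t e \<inter> (snd c \<circ> \<gamma>) -` V" using openE by blast
    have "\<gamma> s \<in> W" if "s \<in> ball t d" for s
    proof -
      have "\<gamma> s \<in> fst c" "snd c (\<gamma> s) \<in> V" using that d(2) at(3) by auto
      then show ?thesis using chart_in_image_iff[OF topological at(1)] by (simp add: V_def)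
    qed
    then show "\<exists>d>0. ball t d \<subseteq> {t. \<gamma> t \<in> W}" using d(1) by auto
  qed
  then have cont: "continuous_map euclidean (mtop S) \<gamma>"
    using inS by (auto simp: continuous_map_def)
  have "smooth_on {t. \<gamma> t \<in> fst d} (snd d \<circ> \<gamma>)" if d: "d \<in> atlas S" for d
  proof (rule smooth_on_local)
    fix t assume "t \<in> {t. \<gamma> t \<in> fst d}"
    then obtain e where "positive_in d e \<gamma> t" using chart[of d t] d by (auto simp: charts_at_iff)
    then show "\<exists>V g. open V \<and> t \<in> V \<and> smooth_on V g \<and> (\<forall>y\<in>V. (snd d \<circ> \<gamma>) y = g y)"
      by (intro exI[of _ "ball t e"] exI[of _ "snd d \<circ> \<gamma>"]) (auto simp: positive_in_def)
  qed
  then show ?thesis using cont by (simp add: smooth_map_def)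
qed

lemma positive_at_velocity:
  assumes "smooth_map euclid S \<gamma>" "positive_at \<gamma> t" shows "\<mu> (\<gamma> t) (velocity S \<gamma> t) > 0"
proof -
  obtain c e where c: "positive_in c e \<gamma> t" using assms(2) unfolding positive_at_def by blast
  note ct = positive_in_charts_at[OF c]
  have "\<mu> (\<gamma> t) (velocity S \<gamma> t) = local_form S \<mu> c (snd c (\<gamma> t)) (velocity S \<gamma> t c)"
    by (rule form_eq_local_form[OF manifold ct velocity_in_tangent_space[OF manifold assms(1)]])
  then show ?thesis using c ct by (simp add: positive_in_def velocity_chart)
qed

text \<open>Prescribing germs, and not just points, at both ends makes this relation transitive without any smoothing.\<close>

definition links :: "(real \<Rightarrow> 's) \<Rightarrow> (real \<Rightarrow> 's) \<Rightarrow> bool" where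
  "links g h \<longleftrightarrow> (\<exists>T \<gamma> e. T > 0 \<and> e > 0 \<and> (\<forall>t\<in>{0..T}. positive_at \<gamma> t) \<and>
     (\<forall>s\<in>ball 0 e. \<gamma> s = g s \<and> \<gamma> (T + s) = h s))"

lemma links_trans:
  assumes "links g h" "links h k" shows "links g k"
proof -
  obtain T1 \<gamma>1 e1 where A: "T1 > 0" "e1 > 0" "\<And>t. t \<in> {0..T1} \<Longrightarrow> positive_at \<gamma>1 t"
    "\<And>s. s \<in> ball 0 e1 \<Longrightarrow> \<gamma>1 s = g s" "\<And>s. s \<in> ball 0 e1 \<Longrightarrow> \<gamma>1 (T1 + s) = h s"
    using assms(1) unfolding links_def by blast
  obtain T2 \<gamma>2 e2 where B: "T2 > 0" "e2 > 0" "\<And>t. t \<in> {0..T2} \<Longrightarrow> positive_at \<gamma>2 t"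
    "\<And>s. s \<in> ball 0 e2 \<Longrightarrow> \<gamma>2 s = h s" "\<And>s. s \<in> ball 0 e2 \<Longrightarrow> \<gamma>2 (T2 + s) = k s"
    using assms(2) unfolding links_def by blast
  define \<gamma> where "\<gamma> t = (if t \<le> T1 then \<gamma>1 t else \<gamma>2 (t - T1))" for t
  define e where "e = min (min e1 e2) (min T1 T2)"
  have e: "e > 0" "e \<le> e1" "e \<le> e2" "e \<le> T1" "e \<le> T2" using A(1,2) B(1,2) by (simp_all add: e_def)
  have mid: "\<gamma> s = \<gamma>1 s" if "s \<in> ball T1 e" for s
  proof (cases "s \<le> T1")
    case False
    have "s - T1 \<in> ball 0 e1" "s - T1 \<in> ball 0 e2" using that e by (auto simp: dist_real_def)
    from A(5)[OF this(1)] B(4)[OF this(2)] False show ?thesis by (simp add: \<gamma>_def)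
  qed (simp add: \<gamma>_def)
  have pos: "positive_at \<gamma> t" if t: "t \<in> {0..T1 + T2}" for t
  proof -
    consider "t < T1" | "t = T1" | "t > T1" by linarith
    then show ?thesis
    proof cases
      case 1
      have "positive_at \<gamma>1 t" using A(3)[of t] 1 t by simp
      then show ?thesis
        by (rule positive_at_cong[of _ _ "T1 - t"]) (use 1 in \<open>auto simp: \<gamma>_def dist_real_def\<close>)
    next
      case 2
      have "positive_at \<gamma>1 t" using A(1) A(3)[of t] 2 by simp
      then show ?thesis
        by (rule positive_at_cong[OF _ e(1)]) (use mid 2 in blast)
    next
      case 3
      have "positive_at \<gamma>2 (t + (- T1))" using B(3)[of "t - T1"] 3 t by simp
      from positive_at_shift[OF this] show ?thesis
        by (rule positive_at_cong[of _ _ "t - T1"]) (use 3 in \<open>auto simp: \<gamma>_def dist_real_def\<close>)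
    qed
  qed
  have "\<gamma> s = g s \<and> \<gamma> (T1 + T2 + s) = k s" if s: "s \<in> ball 0 e" for s
  proof -
    have "\<bar>s\<bar> < e" using s by (simp add: dist_real_def)
    then have "s \<le> T1" "T1 + T2 + s > T1" "s \<in> ball 0 e1" "s \<in> ball 0 e2"
      using e by (auto simp: dist_real_def)
    then show ?thesis using A(4)[of s] B(5)[of s] by (simp add: \<gamma>_def)
  qed
  then show ?thesis
    unfolding links_def using A(1) B(1) e(1) pos
    by (intro exI[of _ "T1 + T2"] exI[of _ \<gamma>] exI[of _ e]) auto
qed

text \<open>Near a multiple of the period, the periodic continuation runs through the common germ at both ends; so it is smooth
  there.\<close>

lemma links_self_periodic:
  assumes "links g g"
  shows "\<exists>\<Gamma>. (\<forall>t. \<Gamma> (t + 2 * pi) = \<Gamma> t) \<and> (\<forall>t. positive_at \<Gamma> t)"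
proof -
  obtain T \<gamma> e0 where T: "T > 0" "e0 > 0" "\<And>t. t \<in> {0..T} \<Longrightarrow> positive_at \<gamma> t"
    "\<And>s. s \<in> ball 0 e0 \<Longrightarrow> \<gamma> s = g s" "\<And>s. s \<in> ball 0 e0 \<Longrightarrow> \<gamma> (T + s) = g s"
    using assms unfolding links_def by blast
  define e where "e = min e0 T"
  have e: "e > 0" "e \<le> e0" "e \<le> T" using T by (auto simp: e_def)
  define G where "G t = \<gamma> (t - T * of_int \<lfloor>t / T\<rfloor>)" for t
  have G_eq: "G t = \<gamma> (t - T * of_int n)" if "T * of_int n \<le> t" "t < T * of_int n + T" for t n
  proof -
    have "\<lfloor>t / T\<rfloor> = n" using that T(1) by (intro floor_unique) (simp_all add: field_simps)
    then show ?thesis by (simp add: G_def)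
  qed
  have pos: "positive_at G t" for t
  proof -
    define n where "n = \<lfloor>t / T\<rfloor>"
    have "of_int n \<le> t / T" "t / T < of_int n + 1" by (auto simp: n_def)
    then have n: "T * of_int n \<le> t" "t < T * of_int n + T" using T(1) by (simp_all add: field_simps)
    have "positive_at \<gamma> (t + (- (T * of_int n)))" using n T(3)[of "t - T * of_int n"] by simp
    note p = positive_at_shift[OF this]
    define d where "d = min (T * of_int n + T - t) (if t = T * of_int n then e else t - T * of_int n)"
    have "d > 0" using n e(1) by (auto simp: d_def)
    with p show ?thesis
    proof (rule positive_at_cong)
      fix s assume s: "s \<in> ball t d"
      then have s2: "s < T * of_int n + T" by (auto simp: d_def dist_real_def)
      show "G s = \<gamma> (s + - (T * of_int n))"
      proof (cases "s < T * of_int n")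
        case False
        then show ?thesis using G_eq[of n s] s2 by simp
      next
        case True
        then have tn: "t = T * of_int n" "s > t - e" using s n by (auto simp: d_def dist_real_def split: if_splits)
        define u where "u = s - T * of_int n"
        have u: "u \<in> ball 0 e0" using tn True e by (auto simp: u_def dist_real_def)
        have "G s = \<gamma> (s - T * of_int (n - 1))"
          using True tn e by (intro G_eq) (auto simp: algebra_simps)
        also have "s - T * of_int (n - 1) = T + u" by (simp add: u_def algebra_simps)
        also have "\<gamma> (T + u) = \<gamma> u" using T(4,5)[OF u] by simp
        finally show ?thesis by (simp add: u_def)
      qed
    qed
  qed
  have per: "G (t + T) = G t" for t
  proof -
    have "\<lfloor>(t + T) / T\<rfloor> = \<lfloor>t / T\<rfloor> + 1" using T(1) by (simp add: add_divide_distrib)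
    then show ?thesis by (simp add: G_def algebra_simps)
  qed
  define \<Gamma> where "\<Gamma> t = G (T / (2 * pi) * t)" for t
  have "\<Gamma> (t + 2 * pi) = \<Gamma> t" for t
  proof -
    have "T / (2 * pi) * (t + 2 * pi) = T / (2 * pi) * t + T" by (simp add: field_simps)
    then show ?thesis using per by (simp only: \<Gamma>_def)
  qed
  moreover have "positive_at \<Gamma> t" for t
    using positive_at_affine[of G "T / (2 * pi)" t 0] pos T(1) by (simp add: \<Gamma>_def[abs_def])
  ultimately show ?thesis by blast
qed

lemma positive_form_open:
  assumes c: "c \<in> atlas S" shows "open {(x, v). x \<in> snd c ` fst c \<and> local_form S \<mu> c x v > 0}"
proof -
  define A where "A = snd c ` fst c"
  have A: "open A" unfolding A_def by (rule chart_open_image[OF topological c])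
  have "continuous_on (A \<times> UNIV) (\<lambda>p. \<Sum>b\<in>Basis. (snd p \<bullet> b) * local_form S \<mu> c (fst p) b)"
  proof (intro continuous_on_sum continuous_on_mult continuous_intros)
    fix b :: 'e
    show "continuous_on (A \<times> UNIV) (\<lambda>p. local_form S \<mu> c (fst p) b)"
      by (rule continuous_on_compose2[OF smooth_on_continuous[OF local_form_smooth_on[OF form c, of b, folded A_def]]])
        (auto intro!: continuous_intros)
  qed
  then have "open ((A \<times> UNIV) \<inter> (\<lambda>p. \<Sum>b\<in>Basis. (snd p \<bullet> b) * local_form S \<mu> c (fst p) b) -` {0<..})"
    using A by (intro continuous_open_preimage open_Times) auto
  also have "(A \<times> UNIV) \<inter> (\<lambda>p. \<Sum>b\<in>Basis. (snd p \<bullet> b) * local_form S \<mu> c (fst p) b) -` {0<..} =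
      {(x, v). x \<in> A \<and> local_form S \<mu> c x v > 0}"
    using local_form_Basis_sum[OF manifold form c, folded A_def] by auto
  finally show ?thesis by (simp add: A_def)
qed

text \<open>The germ \<open>g\<close> runs along a straight line in a chart and aims at \<open>z\<close>; it starts before \<open>z\<close>, so that there is
  time to turn into any germ \<open>h\<close> passing close to \<open>z\<close>.\<close>

lemma station:
  assumes z: "z \<in> points S" and v: "v \<in> tangent_space S z" "\<mu> z v \<noteq> 0"
  shows "\<exists>g W. openin (mtop S) W \<and> z \<in> W \<and> positive_at g 0 \<and> (\<forall>h. positive_at h 0 \<and> h 0 \<in> W \<longrightarrow> links g h)"
proof -
  define c where "c = chart_at S z"
  have cz: "c \<in> charts_at S z" unfolding c_def by (rule chart_at_in[OF topological z])
  then have at: "c \<in> atlas S" "z \<in> fst c" by (auto simp: charts_at_iff)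
  define m where "m = local_form S \<mu> c"
  define b where "b = snd c z"
  have b: "b \<in> snd c ` fst c" using at by (simp add: b_def)
  have linb: "linear (m b)" unfolding m_def b_def by (rule local_form_linear[OF manifold form cz])
  have lin: "linear (m x)" if "x \<in> snd c ` fst c" for x
    using that local_form_linear[OF manifold form, of c] at(1) by (auto simp: m_def charts_at_iff)
  define w where "w = (if \<mu> z v > 0 then v c else - v c)"
  have "\<mu> z v = m b (v c)" unfolding m_def b_def by (rule form_eq_local_form[OF manifold cz v(1)])
  then have w: "m b w > 0" using v(2) linear_neg[OF linb] by (auto simp: w_def)
  have op: "open {(x, v). x \<in> snd c ` fst c \<and> m x v > 0}"
    unfolding m_def by (rule positive_form_open[OF at(1)])
  have "(b, w) \<in> {(x, v). x \<in> snd c ` fst c \<and> m x v > 0}" using b w by simp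
  then obtain A B where AB: "open A" "open B" "(b, w) \<in> A \<times> B" "A \<times> B \<subseteq> {(x, v). x \<in> snd c ` fst c \<and> m x v > 0}"
    by (rule open_prod_elim[OF op])
  obtain r1 r2 where r12: "r1 > 0" "ball b r1 \<subseteq> A" "r2 > 0" "ball w r2 \<subseteq> B"
    using AB openE by (metis mem_Sigma_iff)
  define r where "r = min r1 r2"
  have r: "r > 0" using r12 by (simp add: r_def)
  have cone: "x \<in> snd c ` fst c \<and> m x v > 0" if "x \<in> ball b r" "v \<in> ball w r" for x v
    using AB(4) r12 that by (auto simp: r_def subset_iff)
  have br: "ball b r \<subseteq> snd c ` fst c" using cone[of _ w] r by auto
  define \<delta> where "\<delta> = r / (4 * (norm w + 1))"
  have nw: "norm w + 1 > 0" by (smt (verit) norm_ge_zero)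
  have \<delta>: "\<delta> > 0" "\<delta> * norm w \<le> r / 4"
  proof -
    show "\<delta> > 0" using r nw by (simp add: \<delta>_def)
    then have "\<delta> * norm w \<le> \<delta> * (norm w + 1)" by (simp add: mult_left_mono)
    also have "\<dots> = r / 4" using nw by (simp add: \<delta>_def field_simps)
    finally show "\<delta> * norm w \<le> r / 4" .
  qed
  have opb: "open {(x, v). x \<in> ball b r \<and> m x v > 0}"
  proof -
    have "{(x, v). x \<in> ball b r \<and> m x v > 0} = {(x, v). x \<in> snd c ` fst c \<and> m x v > 0} \<inter> (ball b r \<times> UNIV)"
      using br by auto
    then show ?thesis using op by (simp add: open_Int open_Times)
  qed
  define arc where "arc \<sigma> \<xi> a \<longleftrightarrow> a > 0 \<and> smooth_on {- a<..<\<delta> + a} \<xi> \<and>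
      (\<forall>t\<in>{- a<..<\<delta> + a}. \<xi> t \<in> ball b r \<and> m (\<xi> t) (frechet_derivative \<xi> (at t) 1) > 0) \<and>
      (\<forall>t\<in>{- a<..<a}. \<xi> t = b + (t - \<delta>) *\<^sub>R w) \<and>
      (\<forall>t\<in>{\<delta> - a<..<\<delta> + a}. \<xi> t = \<sigma> (t - \<delta>))" for \<sigma> \<xi> a
  have "\<exists>\<rho>>0. \<rho> \<le> r \<and> (\<forall>\<sigma> e. \<sigma> 0 \<in> ball b \<rho> \<and> e > 0 \<and> smooth_on (ball 0 e) \<sigma> \<and>
      m (\<sigma> 0) (frechet_derivative \<sigma> (at 0) 1) > 0 \<longrightarrow> (\<exists>\<xi> a. arc \<sigma> \<xi> a))"
    unfolding arc_def by (rule smooth_corner[OF r \<delta> _ opb]) (use lin br cone in auto)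
  then obtain \<rho> where \<rho>: "\<rho> > 0" "\<rho> \<le> r" and corner: "\<And>\<sigma> e. \<sigma> 0 \<in> ball b \<rho> \<Longrightarrow> e > 0 \<Longrightarrow>
      smooth_on (ball 0 e) \<sigma> \<Longrightarrow> m (\<sigma> 0) (frechet_derivative \<sigma> (at 0) 1) > 0 \<Longrightarrow> \<exists>\<xi> a. arc \<sigma> \<xi> a"
    by blast
  have lift: "positive_at (\<lambda>t. chart_inv c (\<xi> t)) t"
    if J: "open J" "t \<in> J" "smooth_on J \<xi>" "\<And>s. s \<in> J \<Longrightarrow> \<xi> s \<in> ball b r" "m (\<xi> t) (frechet_derivative \<xi> (at t) 1) > 0"
    for \<xi> J t
  proof -
    obtain e where e: "e > 0" "ball t e \<subseteq> J" using J(1,2) openE by blast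
    have img: "\<xi> s \<in> snd c ` fst c" if "s \<in> ball t e" for s
      using J(4) e(2) br that by blast
    have eq: "(snd c \<circ> (\<lambda>t. chart_inv c (\<xi> t))) s = \<xi> s" if "s \<in> ball t e" for s
      using img[OF that] by simp
    have te: "t \<in> ball t e" using e(1) by simp
    have "smooth_on (ball t e) (snd c \<circ> (\<lambda>t. chart_inv c (\<xi> t))) \<longleftrightarrow> smooth_on (ball t e) \<xi>"
      by (rule smooth_on_cong[OF open_ball eq])
    then have "smooth_on (ball t e) (snd c \<circ> (\<lambda>t. chart_inv c (\<xi> t)))"
      using smooth_on_subset[OF J(3) e(2)] by blast
    moreover have "frechet_derivative (snd c \<circ> (\<lambda>t. chart_inv c (\<xi> t))) (at t) = frechet_derivative \<xi> (at t)"
      by (rule frechet_derivative_cong_open(1)[OF open_ball te eq])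
    ultimately have "positive_in c e (\<lambda>t. chart_inv c (\<xi> t)) t"
      using e(1) at(1) img J(5) eq[OF te] by (simp add: positive_in_def m_def)
    then show ?thesis unfolding positive_at_def by blast
  qed
  define g where "g s = chart_inv c (b + (s - \<delta>) *\<^sub>R w)" for s
  define W where "W = {q \<in> fst c. snd c q \<in> ball b \<rho>}"
  have "openin (mtop S) W" unfolding W_def by (rule chart_preimage_openin[OF topological at(1)]) simp
  moreover have "z \<in> W" using at \<rho> by (simp add: W_def b_def)
  moreover have "positive_at g 0"
    unfolding g_def
  proof (rule lift)
    show "smooth_on (ball 0 \<delta>) (\<lambda>s. b + (s - \<delta>) *\<^sub>R w)"
      using smooth_on_scaleR[OF open_ball smooth_on_affine[of _ 1 "- \<delta>"] smooth_on_const]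
      by (intro smooth_on_add open_ball smooth_on_const) simp
    show inb: "b + (s - \<delta>) *\<^sub>R w \<in> ball b r" if "s \<in> ball 0 \<delta>" for s
    proof -
      have "\<bar>s - \<delta>\<bar> * norm w \<le> (2 * \<delta>) * norm w" using that by (intro mult_right_mono) (auto simp: dist_real_def)
      also have "\<dots> < r" using \<delta>(2) r by linarith
      finally show ?thesis by (simp add: dist_norm)
    qed
    have "((\<lambda>s. b + (s - \<delta>) *\<^sub>R w) has_vector_derivative w) (at 0)"
      by (auto intro!: derivative_eq_intros)
    then have "frechet_derivative (\<lambda>s. b + (s - \<delta>) *\<^sub>R w) (at 0) 1 = w"
      using frechet_derivative_at[of "\<lambda>s. b + (s - \<delta>) *\<^sub>R w" "\<lambda>h. h *\<^sub>R w" 0, symmetric] by (simp add: has_vector_derivative_def)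
    then show "m (b + (0 - \<delta>) *\<^sub>R w) (frechet_derivative (\<lambda>s. b + (s - \<delta>) *\<^sub>R w) (at 0) 1) > 0"
      using cone[OF inb[of 0], of w] \<delta>(1) r by simp
  qed (use \<delta> in auto)
  moreover have "links g h" if h: "positive_at h 0" "h 0 \<in> W" for h
  proof -
    have "c \<in> charts_at S (h 0)" using h(2) at(1) by (simp add: W_def charts_at_iff)
    from positive_at_chart[OF h(1) this] obtain e where e: "positive_in c e h 0" by blast
    have "\<exists>\<xi> a. arc (snd c \<circ> h) \<xi> a"
      using e h(2) by (intro corner[of _ e]) (auto simp: positive_in_def W_def m_def)
    then obtain \<xi> a where "arc (snd c \<circ> h) \<xi> a" by blast
    then have \<xi>: "a > 0" "smooth_on {- a<..<\<delta> + a} \<xi>"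
      "\<And>t. t \<in> {- a<..<\<delta> + a} \<Longrightarrow> \<xi> t \<in> ball b r \<and> m (\<xi> t) (frechet_derivative \<xi> (at t) 1) > 0"
      "\<And>t. t \<in> {- a<..<a} \<Longrightarrow> \<xi> t = b + (t - \<delta>) *\<^sub>R w"
      "\<And>t. t \<in> {\<delta> - a<..<\<delta> + a} \<Longrightarrow> \<xi> t = snd c (h (t - \<delta>))"
      unfolding arc_def o_def by blast+
    define \<gamma> where "\<gamma> t = chart_inv c (\<xi> t)" for t
    have "positive_at \<gamma> t" if "t \<in> {0..\<delta>}" for t
      unfolding \<gamma>_def by (rule lift[of "{- a<..<\<delta> + a}"]) (use that \<xi>(1-3) in auto)
    moreover have "\<gamma> s = g s \<and> \<gamma> (\<delta> + s) = h s" if s: "s \<in> ball 0 (min a e)" for s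
    proof -
      have "s \<in> {- a<..<a}" "\<delta> + s \<in> {\<delta> - a<..<\<delta> + a}" "s \<in> ball 0 e" using s by (auto simp: dist_real_def)
      moreover from this have "h s \<in> fst c" using e by (auto simp: positive_in_def)
      ultimately show ?thesis
        using \<xi>(4)[of s] \<xi>(5)[of "\<delta> + s"] chart_inv_left[OF topological at(1), of "h s"] by (simp add: \<gamma>_def g_def)
    qed
    ultimately show "links g h"
      unfolding links_def using \<delta>(1) \<xi>(1) e
      by (intro exI[of _ \<delta>] exI[of _ \<gamma>] exI[of _ "min a e"]) (auto simp: positive_in_def)
  qed
  ultimately show ?thesis by blast
qed

text \<open>Finitely many of the neighbourhoods of stations cover a compact manifold. The germ of each station passes
  through the neighbourhood belonging to some station, so each station has a predecessor; hence there is a cycle.\<close>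

theorem closed_positive_curve:
  assumes cpt: "compact_space (mtop S)" and ne: "points S \<noteq> {}"
    and nz: "\<And>z. z \<in> points S \<Longrightarrow> \<exists>v\<in>tangent_space S z. \<mu> z v \<noteq> 0"
  shows "\<exists>\<gamma>. smooth_map euclid S \<gamma> \<and> (\<forall>t. \<gamma> (t + 2 * pi) = \<gamma> t) \<and> (\<forall>t. \<mu> (\<gamma> t) (velocity S \<gamma> t) > 0)"
proof -
  define at_station where "at_station z g W \<longleftrightarrow> openin (mtop S) W \<and> z \<in> W \<and> positive_at g 0 \<and>
      (\<forall>h. positive_at h 0 \<and> h 0 \<in> W \<longrightarrow> links g h)" for z g W
  have "\<exists>g W. at_station z g W" if z: "z \<in> points S" for z
  proof -
    obtain v where "v \<in> tangent_space S z" "\<mu> z v \<noteq> 0" using nz[OF z] by blast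
    from station[OF z this] show ?thesis unfolding at_station_def .
  qed
  then obtain g W where "\<And>z. z \<in> points S \<Longrightarrow> at_station z (g z) (W z)" by metis
  then have gW: "openin (mtop S) (W z)" "z \<in> W z" "positive_at (g z) 0"
      "\<And>h. positive_at h 0 \<Longrightarrow> h 0 \<in> W z \<Longrightarrow> links (g z) h" if "z \<in> points S" for z
    using that unfolding at_station_def by blast+
  have "compactin (mtop S) (points S)" using cpt by (simp add: compact_space_def)
  moreover have "Ball (W ` points S) (openin (mtop S))" "points S \<subseteq> \<Union> (W ` points S)" using gW(1,2) by blast+
  ultimately obtain \<F> where \<F>: "finite \<F>" "\<F> \<subseteq> W ` points S" "points S \<subseteq> \<Union> \<F>"
    unfolding compactin_def by metis
  obtain Z where Z: "Z \<subseteq> points S" "finite Z" "\<F> = W ` Z"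
    using finite_subset_image[OF \<F>(1,2)] by blast
  define R where "R = {(x, y) \<in> Z \<times> Z. links (g x) (g y)}"
  have pred: "\<exists>x. (x, y) \<in> R" if y: "y \<in> Z" for y
  proof -
    have gy: "positive_at (g y) 0" using gW(3) y Z(1) by blast
    then have "g y 0 \<in> points S"
      using positive_in_charts_at charts_at_imp_point[OF topological] unfolding positive_at_def by blast
    then obtain x where x: "x \<in> Z" "g y 0 \<in> W x" using \<F>(3) Z(3) by blast
    then have "links (g x) (g y)" using gW(4)[OF _ gy] Z(1) by blast
    then show ?thesis using x y by (auto simp: R_def)
  qed
  have "finite R" by (rule finite_subset[of _ "Z \<times> Z"]) (use Z(2) in \<open>auto simp: R_def\<close>)
  have "\<not> acyclic R"
  proof
    assume "acyclic R"
    with \<open>finite R\<close> have wf: "wf R" by (rule finite_acyclic_wf)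
    obtain y0 where y0: "y0 \<in> Z" using ne \<F>(3) Z(3) by blast
    obtain y where y: "y \<in> Z" "\<And>x. (x, y) \<in> R \<Longrightarrow> x \<notin> Z" by (rule wfE_min[OF wf y0]) (rule that)
    obtain x where x: "(x, y) \<in> R" using pred[OF y(1)] by blast
    then have "x \<in> Z" by (simp add: R_def)
    with y(2)[OF x] show False by blast
  qed
  then obtain z where "(z, z) \<in> R\<^sup>+" by (auto simp: acyclic_def)
  moreover have "links (g x) (g y)" if "(x, y) \<in> R\<^sup>+" for x y
    using that by (induction rule: trancl_induct) (auto simp: R_def intro: links_trans)
  ultimately have "links (g z) (g z)" by blast
  from links_self_periodic[OF this] obtain \<Gamma> where \<Gamma>: "\<And>t. \<Gamma> (t + 2 * pi) = \<Gamma> t" "\<And>t. positive_at \<Gamma> t" by blast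
  note sm = positive_curve_smooth_map[OF \<Gamma>(2)]
  show ?thesis using sm \<Gamma>(1) positive_at_velocity[OF sm \<Gamma>(2)] by blast
qed

end

section \<open>The distribution of an exact lcs manifold\<close>

lemma lcs_form_skew: "lcs_form M lam \<alpha> p v w = - lcs_form M lam \<alpha> p w v"
  by (simp add: lcs_form_def ext_deriv_def Let_def)

locale reeb_lcs =
  fixes M :: "('m, 'e::euclidean_space, 'z) charted_space_scheme" and lam \<alpha> :: "('m, 'e) form1"
  assumes lcs: "exact_lcs M lam \<alpha>" and reeb: "reeb_condition M lam \<alpha>"
begin

lemma manifold: "smooth_manifold M"
  and lam: "one_form M lam" and \<alpha>: "one_form M \<alpha>" and closed: "closed_form M \<alpha>"
  using lcs by (simp_all add: exact_lcs_def)

lemma nondegenerate: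
  "p \<in> points M \<Longrightarrow> v \<in> tangent_space M p \<Longrightarrow>
    (\<And>w. w \<in> tangent_space M p \<Longrightarrow> lcs_form M lam \<alpha> p v w = 0) \<Longrightarrow> v = (\<lambda>_. 0)"
  using lcs by (simp add: exact_lcs_def)

lemma topological: "topological_manifold M"
  using manifold by (rule smooth_manifold_topological)

lemma lcs_form_linear_left:
  assumes p: "p \<in> points M" and v: "v \<in> tangent_space M p" "v' \<in> tangent_space M p"
  shows "lcs_form M lam \<alpha> p (\<lambda>c. a *\<^sub>R v c + b *\<^sub>R v' c) w = a * lcs_form M lam \<alpha> p v w + b * lcs_form M lam \<alpha> p v' w"
proof -
  define c where "c = chart_at M p"
  have c: "c \<in> atlas M" "p \<in> fst c" using chart_at_in[OF topological p] unfolding c_def charts_at_iff by blast+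
  define D where "D u h = frechet_derivative (\<lambda>x. local_form M lam c x u) (at (snd c p)) h" for u h
  have "linear (D u)" for u
    unfolding D_def
    using smooth_on_has_derivative[OF local_form_smooth_on[OF lam c(1)]] c(2) has_derivative_linear by blast
  then have 1: "D (w c) (a *\<^sub>R v c + b *\<^sub>R v' c) = a * D (w c) (v c) + b * D (w c) (v' c)"
    by (simp add: linear_add linear_scale)
  have D_sum: "D u h = (\<Sum>i\<in>Basis. (u \<bullet> i) * D i h)" for u h
    unfolding D_def by (rule local_form_derivative_Basis_sum[OF manifold lam c(1)]) (use c in auto)
  have 2: "D (a *\<^sub>R v c + b *\<^sub>R v' c) (w c) = a * D (v c) (w c) + b * D (v' c) (w c)"
    unfolding D_sum[of "a *\<^sub>R v c + b *\<^sub>R v' c"] D_sum[of "v c"] D_sum[of "v' c"]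
    by (simp add: inner_add_left algebra_simps sum.distrib sum_distrib_left)
  have ext: "ext_deriv M lam p v w = D (w c) (v c) - D (v c) (w c)" for v w
    by (simp add: ext_deriv_def Let_def D_def c_def)
  show ?thesis
    unfolding lcs_form_def ext 1 2 one_form_linear[OF lam p v] one_form_linear[OF \<alpha> p v]
    by (simp add: algebra_simps)
qed

lemma lcs_form_linear_right:
  assumes p: "p \<in> points M" and v: "v \<in> tangent_space M p" "v' \<in> tangent_space M p"
  shows "lcs_form M lam \<alpha> p w (\<lambda>c. a *\<^sub>R v c + b *\<^sub>R v' c) = a * lcs_form M lam \<alpha> p w v + b * lcs_form M lam \<alpha> p w v'"
  using lcs_form_linear_left[OF assms, of a b w] lcs_form_skew[of M lam \<alpha> p w] by simp

text \<open>The dual vector field exists by linear algebra: in coordinates a non-degenerate form is an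
  injective, hence surjective, endomorphism.\<close>

lemma lcs_dual_exists1:
  assumes p: "p \<in> points M" and \<beta>: "one_form M \<beta>"
  shows "\<exists>!X. X \<in> tangent_space M p \<and> (\<forall>w\<in>tangent_space M p. lcs_form M lam \<alpha> p X w = \<beta> p w)"
proof (rule ex_ex1I)
  define c where "c = chart_at M p"
  have c: "c \<in> charts_at M p" unfolding c_def by (rule chart_at_in[OF topological p])
  define cv where "cv = coord_vec M c p"
  have cv: "cv u \<in> tangent_space M p" for u unfolding cv_def by (rule coord_vec_in_tangent_space[OF manifold c])
  have cv_lin: "cv (a *\<^sub>R u + b *\<^sub>R u') = (\<lambda>d. a *\<^sub>R cv u d + b *\<^sub>R cv u' d)" for a b u u'
    unfolding cv_def by (rule coord_vec_linear[OF manifold c])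
  have cv_tangent: "\<exists>u. w = cv u" if "w \<in> tangent_space M p" for w
    using tangent_vec_eq_coord_vec[OF c that] unfolding cv_def by metis
  have lin: "linear f" if "\<And>a b u u'. f (a *\<^sub>R u + b *\<^sub>R u') = a *\<^sub>R f u + b *\<^sub>R f u'" for f :: "'e \<Rightarrow> 'c::real_vector"
    using that[of 1 _ 1] that[of _ _ 0] by (intro linearI) auto
  define A where "A u = (\<Sum>i\<in>Basis. lcs_form M lam \<alpha> p (cv u) (cv i) *\<^sub>R i)" for u
  have "linear A"
    unfolding A_def cv_lin lcs_form_linear_left[OF p cv cv]
    by (rule lin) (simp add: cv_lin lcs_form_linear_left[OF p cv cv] scaleR_add_left sum.distrib scaleR_sum_right)
  have A: "lcs_form M lam \<alpha> p (cv u) (cv w) = A u \<bullet> w" for u w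
  proof -
    have l: "linear (\<lambda>w. lcs_form M lam \<alpha> p (cv u) (cv w))"
      by (rule lin) (simp add: cv_lin lcs_form_linear_right[OF p cv cv])
    have "lcs_form M lam \<alpha> p (cv u) (cv w) = lcs_form M lam \<alpha> p (cv u) (cv (\<Sum>i\<in>Basis. (w \<bullet> i) *\<^sub>R i))"
      by (simp only: euclidean_representation)
    also have "\<dots> = (\<Sum>i\<in>Basis. (w \<bullet> i) * lcs_form M lam \<alpha> p (cv u) (cv i))"
      using linear_sum[OF l, of "\<lambda>i. (w \<bullet> i) *\<^sub>R i" Basis] linear_scale[OF l] by simp
    also have "\<dots> = A u \<bullet> w" by (simp add: A_def inner_sum_left inner_commute[of w] mult.commute)
    finally show ?thesis .
  qed
  have "inj A"
    unfolding linear_injective_0[OF \<open>linear A\<close>]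
  proof (intro allI impI)
    fix u assume "A u = 0"
    then have "lcs_form M lam \<alpha> p (cv u) w = 0" if "w \<in> tangent_space M p" for w
      using cv_tangent[OF that] A by auto
    from nondegenerate[OF p cv this] have "cv u c = 0" by simp
    then show "u = 0" using coord_vec_same[OF manifold c] by (simp add: cv_def)
  qed
  then have "surj A" using linear_injective_imp_surjective[OF \<open>linear A\<close>] by simp
  then obtain u where u: "A u = (\<Sum>i\<in>Basis. \<beta> p (cv i) *\<^sub>R i)" by (metis surjD)
  have l: "linear (\<lambda>w. \<beta> p (cv w))"
    by (rule lin) (simp add: cv_lin one_form_linear[OF \<beta> p cv cv])
  have "\<beta> p (cv w) = A u \<bullet> w" for w
  proof -
    have "\<beta> p (cv w) = \<beta> p (cv (\<Sum>i\<in>Basis. (w \<bullet> i) *\<^sub>R i))" by (simp only: euclidean_representation)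
    also have "\<dots> = (\<Sum>i\<in>Basis. (w \<bullet> i) * \<beta> p (cv i))"
      using linear_sum[OF l, of "\<lambda>i. (w \<bullet> i) *\<^sub>R i" Basis] linear_scale[OF l] by simp
    also have "\<dots> = A u \<bullet> w" by (simp add: u inner_sum_left inner_commute[of w] mult.commute)
    finally show ?thesis .
  qed
  then have "\<forall>w\<in>tangent_space M p. lcs_form M lam \<alpha> p (cv u) w = \<beta> p w"
    using cv_tangent A by metis
  then show "\<exists>X. X \<in> tangent_space M p \<and> (\<forall>w\<in>tangent_space M p. lcs_form M lam \<alpha> p X w = \<beta> p w)"
    using cv by blast
next
  fix X Y
  assume X: "X \<in> tangent_space M p \<and> (\<forall>w\<in>tangent_space M p. lcs_form M lam \<alpha> p X w = \<beta> p w)"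
    and Y: "Y \<in> tangent_space M p \<and> (\<forall>w\<in>tangent_space M p. lcs_form M lam \<alpha> p Y w = \<beta> p w)"
  have "(\<lambda>c. 1 *\<^sub>R X c + (- 1) *\<^sub>R Y c) = (\<lambda>_. 0)"
  proof (rule nondegenerate[OF p])
    show "(\<lambda>c. 1 *\<^sub>R X c + (- 1) *\<^sub>R Y c) \<in> tangent_space M p"
      using X Y by (intro tangent_space_linear[OF manifold p]) auto
    show "lcs_form M lam \<alpha> p (\<lambda>c. 1 *\<^sub>R X c + (- 1) *\<^sub>R Y c) w = 0" if "w \<in> tangent_space M p" for w
      using lcs_form_linear_left[OF p, of X Y 1 "- 1" w] X Y that by auto
  qed
  then show "X = Y" by (auto simp: fun_eq_iff)
qed

abbreviation "X_alpha \<equiv> lcs_dual M lam \<alpha> \<alpha>"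
abbreviation "X_lam \<equiv> lcs_dual M lam \<alpha> lam"

lemma lcs_dual:
  assumes "p \<in> points M" "one_form M \<beta>"
  shows "lcs_dual M lam \<alpha> \<beta> p \<in> tangent_space M p"
    "w \<in> tangent_space M p \<Longrightarrow> lcs_form M lam \<alpha> p (lcs_dual M lam \<alpha> \<beta> p) w = \<beta> p w"
  using theI'[OF lcs_dual_exists1[OF assms]] unfolding lcs_dual_def by blast+

lemma lcs_form_self: "lcs_form M lam \<alpha> p v v = 0"
  using lcs_form_skew[of M lam \<alpha> p v v] by simp

lemma lam_Xlam: "p \<in> points M \<Longrightarrow> lam p (X_lam p) = 0"
  and alpha_Xalpha: "p \<in> points M \<Longrightarrow> \<alpha> p (X_alpha p) = 0"
  using lcs_dual[OF _ lam] lcs_dual[OF _ \<alpha>] lcs_form_self by metis+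

lemma lam_Xalpha: "p \<in> points M \<Longrightarrow> lam p (X_alpha p) > 0"
  using reeb by (simp add: reeb_condition_def)

text \<open>Both values are, up to sign, the value of \<open>\<omega>\<close> on the two dual fields.\<close>

lemma alpha_Xlam: "p \<in> points M \<Longrightarrow> \<alpha> p (X_lam p) < 0"
  using lam_Xalpha[of p] lcs_dual[of p lam] lcs_dual[of p \<alpha>] lam \<alpha> lcs_form_skew[of M lam \<alpha> p "X_alpha p" "X_lam p"] by simp

lemma one_form_zero:
  assumes "one_form M \<beta>" "p \<in> points M" shows "\<beta> p (\<lambda>_. 0) = 0"
  using one_form_linear[OF assms zero_in_tangent_space[OF manifold assms(2)] zero_in_tangent_space[OF manifold assms(2)], of 0 0]
  by simp

lemma Xalpha_in_dist: "X_alpha p \<in> lcs_dist M lam \<alpha> p"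
  unfolding lcs_dist_def by (rule CollectI) (intro exI[of _ 1] exI[of _ 0], simp)

lemma Xlam_in_dist: "X_lam p \<in> lcs_dist M lam \<alpha> p"
  unfolding lcs_dist_def by (rule CollectI) (intro exI[of _ 0] exI[of _ 1], simp)

text \<open>The values of \<open>\<lambda>\<close>, \<open>\<alpha>\<close> on \<open>X\<^sub>\<alpha>\<close>, \<open>X\<^sub>\<lambda>\<close> form a diagonal matrix with nonzero diagonal.\<close>

lemma tangent_dim_lcs_dist:
  assumes p: "p \<in> points M" shows "tangent_dim M p (lcs_dist M lam \<alpha> p) = 2"
proof -
  define c where "c = chart_at M p"
  have c: "c \<in> charts_at M p" unfolding c_def by (rule chart_at_in[OF topological p])
  define x where "x = X_alpha p c"
  define y where "y = X_lam p c"
  have ind: "a = 0 \<and> b = 0" if "a *\<^sub>R x + b *\<^sub>R y = 0" for a b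
  proof -
    define v where "v = (\<lambda>d. a *\<^sub>R X_alpha p d + b *\<^sub>R X_lam p d)"
    note X = lcs_dual(1)[OF p \<alpha>] lcs_dual(1)[OF p lam]
    have "v \<in> tangent_space M p" unfolding v_def by (rule tangent_space_linear[OF manifold p X])
    from tangent_vec_eq_coord_vec[OF c this] have "v = coord_vec M c p 0"
      using that by (simp add: v_def x_def y_def)
    also have "\<dots> = (\<lambda>_. 0)"
      using tangent_vec_eq_coord_vec[OF c zero_in_tangent_space[OF manifold p]] .
    finally have v: "v = (\<lambda>_. 0)" .
    have "a * lam p (X_alpha p) + b * lam p (X_lam p) = 0" "a * \<alpha> p (X_alpha p) + b * \<alpha> p (X_lam p) = 0"
      using one_form_linear[OF lam p X, of a b] one_form_linear[OF \<alpha> p X, of a b]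
        one_form_zero[OF lam p] one_form_zero[OF \<alpha> p] v[unfolded v_def] by simp_all
    then show ?thesis using lam_Xalpha[OF p] alpha_Xlam[OF p] lam_Xlam[OF p] alpha_Xalpha[OF p] by auto
  qed
  have y: "y \<noteq> 0" using ind[of 0 1] by auto
  have xy: "x \<notin> span {y}"
  proof
    assume "x \<in> span {y}"
    then obtain k where "x = k *\<^sub>R y" by (auto simp: span_singleton)
    then show False using ind[of 1 "- k"] by simp
  qed
  have "independent {x, y}" "x \<noteq> y"
    using xy y span_base[of y "{y}"] by (auto simp: independent_insert)
  then have "dim (span {x, y}) = 2"
    by (simp add: dim_span dim_eq_card_independent)
  moreover have "(\<lambda>v. v c) ` lcs_dist M lam \<alpha> p = span {x, y}"
  proof
    show "(\<lambda>v. v c) ` lcs_dist M lam \<alpha> p \<subseteq> span {x, y}"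
    proof -
      have "a *\<^sub>R x + b *\<^sub>R y \<in> span {x, y}" for a b
        by (intro span_add span_scale span_base) auto
      then show ?thesis by (auto simp: lcs_dist_def x_def y_def)
    qed
    show "span {x, y} \<subseteq> (\<lambda>v. v c) ` lcs_dist M lam \<alpha> p"
    proof
      fix u assume "u \<in> span {x, y}"
      then obtain a b where "u = a *\<^sub>R x + b *\<^sub>R y"
        by (auto simp: span_insert span_singleton) (metis add.commute diff_add_cancel)
      then show "u \<in> (\<lambda>v. v c) ` lcs_dist M lam \<alpha> p"
        by (intro image_eqI[of _ _ "\<lambda>d. a *\<^sub>R X_alpha p d + b *\<^sub>R X_lam p d"]) (auto simp: x_def y_def lcs_dist_def)
    qed
  qed
  ultimately show ?thesis by (simp add: tangent_dim_def c_def)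
qed

end

section \<open>Reeb curves\<close>

text \<open>Hence the domain of a Reeb 2-curve is nonempty.\<close>

lemma null_class_empty:
  assumes "topological_manifold S" "points S = {}" shows "null_class S \<beta>"
proof -
  have "fst c = {}" if "c \<in> atlas S" for c using chart_subset[OF assms(1) that] assms(2) by simp
  moreover have "Ck_on k {} f" for k and f :: "complex \<Rightarrow> real" by (induction k arbitrary: f) auto
  ultimately have "smooth_map S euclid (normalization S (\<lambda>_. 0 :: real))"
    using assms(2) by (auto simp: smooth_map_def smooth_on_def continuous_map_def)
  then show ?thesis unfolding null_class_def
    by (intro exI[of _ "\<lambda>_. 0"] conjI) (use assms(2) in simp_all)
qed

locale immersed_reeb_2_curve = reeb_lcs M lam \<alpha>
  for M :: "('m, 'e::euclidean_space, 'z) charted_space_scheme" and lam \<alpha> +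
  fixes S :: "'s nodal_surface" and u :: "'s set \<Rightarrow> 'm"
  assumes curve: "reeb_2_curve M lam \<alpha> S u" and immersed: "immersed M S u"
begin

abbreviation "U \<equiv> normalization S u"

lemma nodal: "nodal_riemann_surface S" and compact: "compact_space (mtop S)"
  using curve by (simp_all add: reeb_2_curve_def closed_surface_def)

lemma surface: "smooth_manifold S"
  using nodal riemann_surface_imp_smooth_manifold by (auto simp: nodal_riemann_surface_def)

lemma smooth: "smooth_map S M U"
  using curve by (simp add: reeb_2_curve_def)

lemma points_nonempty: "points S \<noteq> {}"
  using curve null_class_empty[OF smooth_manifold_topological[OF surface]] by (auto simp: reeb_2_curve_def)

lemma tangent_plane:
  assumes z: "z \<in> points S"
  shows "tangent_map S M U z ` tangent_space S z = lcs_dist M lam \<alpha> (U z)"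
proof -
  define c where "c = chart_at S z"
  have c: "c \<in> charts_at S z"
    unfolding c_def by (rule chart_at_in[OF smooth_manifold_topological[OF surface] z])
  define v where "v = coord_vec S c z 1"
  have v: "v \<in> tangent_space S z" unfolding v_def by (rule coord_vec_in_tangent_space[OF surface c])
  have 0: "(\<lambda>_. 0) \<in> tangent_space S z" by (rule zero_in_tangent_space[OF surface z])
  have "v c = 1" using coord_vec_same[OF surface c] by (simp add: v_def)
  then have "v \<noteq> (\<lambda>_. 0)" by auto
  moreover have "inj_on (tangent_map S M U z) (tangent_space S z)"
    using immersed z by (simp add: immersed_def immersion_def)
  ultimately have "tangent_map S M U z v \<noteq> tangent_map S M U z (\<lambda>_. 0)"
    using v 0 by (meson inj_on_def)
  moreover have "tangent_map S M U z (\<lambda>_. 0) = (\<lambda>_. 0)"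
    using tangent_map_linear[OF surface smooth z, of 0 v 0 v] by simp
  ultimately have "\<exists>v\<in>tangent_space S z. tangent_map S M U z v \<noteq> (\<lambda>_. 0)"
    using v by auto
  moreover have "U z \<in> points M" by (rule smooth_map_in_points[OF smooth z])
  ultimately show ?thesis
    using curve z tangent_dim_lcs_dist unfolding reeb_2_curve_def by blast
qed

lemma pullback_lam_nonzero:
  assumes z: "z \<in> points S" shows "\<exists>v\<in>tangent_space S z. pullback S M U lam z v \<noteq> 0"
proof -
  have "X_alpha (U z) \<in> tangent_map S M U z ` tangent_space S z"
    unfolding tangent_plane[OF z] by (rule Xalpha_in_dist)
  then show ?thesis
    using lam_Xalpha[OF smooth_map_in_points[OF smooth z]] by (auto simp: pullback_def) force
qed

lemma pullback_alpha_nonzero: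
  assumes z: "z \<in> points S" shows "\<exists>v\<in>tangent_space S z. pullback S M U \<alpha> z v \<noteq> 0"
proof -
  have "X_lam (U z) \<in> tangent_map S M U z ` tangent_space S z"
    unfolding tangent_plane[OF z] by (rule Xlam_in_dist)
  then show ?thesis
    using alpha_Xlam[OF smooth_map_in_points[OF smooth z]] by (auto simp: pullback_def) force
qed

lemma exists_reeb_1_curve: "\<exists>\<gamma>. reeb_1_curve M lam \<alpha> \<gamma>"
proof -
  interpret pos: manifold_one_form S "pullback S M U lam"
    by unfold_locales (rule surface, rule one_form_pullback[OF surface manifold smooth lam])
  obtain \<gamma> where \<gamma>: "smooth_map euclid S \<gamma>" "\<And>t. \<gamma> (t + 2 * pi) = \<gamma> t"
    "\<And>t. pullback S M U lam (\<gamma> t) (velocity S \<gamma> t) > 0"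
    using pos.closed_positive_curve[OF compact points_nonempty pullback_lam_nonzero] by blast
  have period: "\<gamma> (t + 2 * pi * of_int n) = \<gamma> t" for t n
  proof (induction n rule: int_induct[of _ 0])
    case (step1 i)
    then show ?case using \<gamma>(2)[of "t + 2 * pi * of_int i"] by (simp add: algebra_simps)
  next
    case (step2 i)
    then show ?case using \<gamma>(2)[of "t + 2 * pi * of_int (i - 1)"] by (simp add: algebra_simps)
  qed simp
  \<comment> \<open>The principal argument jumps, but \<open>\<gamma>\<close> has period \<open>2 * pi\<close>.\<close>
  define w where "w x = U (\<gamma> (Arg x))" for x
  have w: "w \<circ> cis = U \<circ> \<gamma>"
  proof
    fix t
    have "cis (Arg (cis t)) = cis t" by (simp add: cis_Arg sgn_cis)
    then have "sin (Arg (cis t)) = sin t \<and> cos (Arg (cis t)) = cos t" by (metis cis.sel)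
    then obtain n :: int where "Arg (cis t) = t + 2 * pi * n" unfolding sin_cos_eq_iff by blast
    then show "(w \<circ> cis) t = (U \<circ> \<gamma>) t" using period by (simp add: w_def)
  qed
  have "reeb_1_curve M lam \<alpha> w"
    unfolding reeb_1_curve_def w
  proof (intro conjI allI)
    show "smooth_map euclid M (U \<circ> \<gamma>)"
      by (rule smooth_map_compose[OF smooth_manifold_euclid surface manifold \<gamma>(1) smooth])
    fix t
    have wt: "w (cis t) = U (\<gamma> t)" using w by (metis comp_apply)
    have vel: "velocity M (U \<circ> \<gamma>) t = tangent_map S M U (\<gamma> t) (velocity S \<gamma> t)"
      by (rule velocity_compose[OF surface \<gamma>(1) smooth])
    show "lam (w (cis t)) (velocity M (U \<circ> \<gamma>) t) > 0"
      using \<gamma>(3)[of t] by (simp only: wt vel pullback_def)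
    have "\<gamma> t \<in> points S" using smooth_map_in_points[OF \<gamma>(1), of t] by simp
    from tangent_plane[OF this] show "velocity M (U \<circ> \<gamma>) t \<in> lcs_dist M lam \<alpha> (w (cis t))"
      unfolding wt vel using velocity_in_tangent_space[OF surface \<gamma>(1), of t] by blast
  qed
  then show ?thesis by blast
qed

text \<open>On a component of genus 0 the pullback of \<open>\<alpha>\<close> would vanish somewhere, but the image of each tangent plane of the
  surface contains \<open>X\<^sub>\<lambda>\<close>, on which \<open>\<alpha>\<close> is negative.\<close>

lemma genus_nonzero:
  assumes C: "C \<in> connected_components_of (mtop S)" and g: "has_genus (subtopology (mtop S) C) g"
  shows "g \<noteq> 0"
proof
  assume "g = 0"
  have "locally_exact S (pullback S M U \<alpha>)"
    by (intro locally_exact_pullback[OF surface manifold smooth] closed_form_locally_exact[OF manifold \<alpha> closed])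
  from locally_exact_zero_of_genus_0[OF surface compact this C g[unfolded \<open>g = 0\<close>]]
  obtain z where "z \<in> C" "\<And>v. v \<in> tangent_space S z \<Longrightarrow> pullback S M U \<alpha> z v = 0" by blast
  moreover from this have "z \<in> points S" using connected_components_of_subset[OF C] by blast
  ultimately show False using pullback_alpha_nonzero by blast
qed

text \<open>By \<open>genus_nonzero\<close> each component contributes at most 0 to the Euler characteristic of the smoothing, which is 0; each
  node contributes \<open>- 2\<close>.\<close>

lemma normal_if_elliptic:
  assumes "elliptic S" shows "normal_surface S"
proof -
  obtain h where h: "\<And>C. C \<in> connected_components_of (mtop S) \<Longrightarrow> has_genus (subtopology (mtop S) C) (h C)"
    "2 - 2 * int 1 = (\<Sum>C\<in>connected_components_of (mtop S). 2 - 2 * int (h C)) - 2 * int (card (nodes S))"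
    using assms unfolding elliptic_def has_nodal_genus_def by blast
  have "(\<Sum>C\<in>connected_components_of (mtop S). 2 - 2 * int (h C)) \<le> 0"
  proof (rule sum_nonpos)
    fix C assume C: "C \<in> connected_components_of (mtop S)"
    show "2 - 2 * int (h C) \<le> 0" using genus_nonzero[OF C h(1)[OF C]] by simp
  qed
  then have "card (nodes S) = 0" using h(2) by simp
  then show ?thesis using nodal by (simp add: normal_surface_def nodal_riemann_surface_def)
qed

end

theorem theorem3p6:
  fixes M :: "('m, 'e::euclidean_space) charted_space"
    and lam \<alpha> :: "('m, 'e) form1"
  assumes "exact_lcs M lam \<alpha>"
    and "reeb_condition M lam \<alpha>"
  shows "((\<exists>(S :: 's nodal_surface) u. reeb_2_curve M lam \<alpha> S u \<and> immersed M S u) \<longrightarrow>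
            (\<exists>\<gamma>. reeb_1_curve M lam \<alpha> \<gamma>)) \<and>
         (\<forall>(S :: 's nodal_surface) u.
            reeb_2_curve M lam \<alpha> S u \<and> immersed M S u \<and> elliptic S \<longrightarrow> normal_surface S)"
proof -
  interpret reeb_lcs M lam \<alpha> using assms by unfold_locales
  have "(\<exists>\<gamma>. reeb_1_curve M lam \<alpha> \<gamma>) \<and> (elliptic S \<longrightarrow> normal_surface S)"
    if "reeb_2_curve M lam \<alpha> S u" "immersed M S u" for S :: "'s nodal_surface" and u
  proof -
    interpret immersed_reeb_2_curve M lam \<alpha> S u using that by unfold_locales
    show ?thesis using exists_reeb_1_curve normal_if_elliptic by blast
  qed
  then show ?thesis by blast
qed

end
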